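(* Let $n\ge3$ and let $\lambda=(\lambda_1<\dots<\lambda_n)$ be a simple real spectrum such that $n_+>1$ or $n_->1$. Then $X_{n,\lambda}$ is not a homology manifold. In particular, $X_{n,\lambda}$ is not a smooth manifold.
   Context: A periodic tridiagonal matrix is a Hermitian $n\times n$ matrix $L=L(\underline a,\underline b)$, $a_i\in\mathbb{R}$, $b_i\in\mathbb{C}$, with diagonal entries $L_{ii}=a_i$, with $L_{i,i+1}=b_i$, $L_{i+1,i}=\overline{b_i}$ for $1\le i\le n-1$, $L_{n,1}=b_n$, $L_{1,n}=\overline{b_n}$, and all other entries $0$. $X_{n,\lambda}$ is the (topological) space of all such matrices with spectrum $\lambda$; its dimension is $2n$. Let $F(x)=\prod_{i=1}^n(x-\lambda_i)$ and let $x_1<\dots<x_{n-1}$ be its critical points, so that $x_{n-1},x_{n-3},\dots$ are local minima and $x_{n-2},x_{n-4},\dots$ are local maxima. Put $M=\min_{i\text{ even}}F(x_{n-i})$ and $m=\min_{i\text{ odd}}(-F(x_{n-i}))$, where $1\le i\le n-1$. $n_+$ is the number of local maxima of $F$ at which the value $M$ is attained, and $n_-$ the number of local minima at which the value $-m$ is attained. A $d$-dimensional space $X$ is a homology manifold if for every $x\in X$ the local homology $H_i(X,X\setminus\{x\})$ is that of $\mathbb{R}^d$ (i.e. zero for $i\ne d$ and the coefficient ring for $i=d$). *)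

theory Defs
  imports
    "HOL-Analysis.Analysis"
    "HOL-Homology.Homology"
    "Jordan_Normal_Form.Spectral_Radius"
begin

section \<open>Isospectral spaces of periodic tridiagonal matrices\<close>

text \<open>
  All sequences are indexed from 1, as are the rows and columns in \<open>periodic_tridiagonal_entry\<close>;
  the matrices of Jordan normal form theory are indexed from 0, whence the shift by \<open>Suc\<close>.
  For \<open>n \<ge> 3\<close> the cases below do not overlap.
\<close>

definition periodic_tridiagonal_entry ::
    "nat \<Rightarrow> (nat \<Rightarrow> real) \<Rightarrow> (nat \<Rightarrow> complex) \<Rightarrow> nat \<Rightarrow> nat \<Rightarrow> complex" where
  "periodic_tridiagonal_entry n a b i j =
     (if i = j then complex_of_real (a i)
      else if j = i + 1 then b i
      else if i = j + 1 then cnj (b j)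
      else if i = n \<and> j = 1 then b n
      else if i = 1 \<and> j = n then cnj (b n)
      else 0)"

definition periodic_tridiagonal ::
    "nat \<Rightarrow> (nat \<Rightarrow> real) \<Rightarrow> (nat \<Rightarrow> complex) \<Rightarrow> complex mat" where
  "periodic_tridiagonal n a b =
     Matrix.mat n n (\<lambda>(i, j). periodic_tridiagonal_entry n a b (Suc i) (Suc j))"

text \<open>
  The usual (entrywise) topology on the \<open>n \<times> n\<close> complex matrices. The type of matrices of
  arbitrary size carries no topology in the library, so it is pulled back from the finite product
  of copies of the complex plane along the map sending a matrix to its family of entries.
\<close>

definition matrix_topology :: "nat \<Rightarrow> complex mat topology" where
  "matrix_topology n =
     pullback_topology (carrier_mat n n)
       (\<lambda>A. restrict (\<lambda>ij. A $$ ij) ({..<n} \<times> {..<n}))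
       (product_topology (\<lambda>_. euclidean) ({..<n} \<times> {..<n}))"

text \<open>
  The spectrum is taken as a set; for the simple spectra considered here (\<open>n\<close> distinct values
  for an \<open>n \<times> n\<close> matrix) this determines the multiplicities.
\<close>

definition isospectral_space :: "nat \<Rightarrow> (nat \<Rightarrow> real) \<Rightarrow> complex mat topology" where
  "isospectral_space n lam =
     subtopology (matrix_topology n)
       {L. (\<exists>a b. L = periodic_tridiagonal n a b) \<and>
           spectrum L = (\<lambda>i. complex_of_real (lam i)) ` {1..n}}"

section \<open>Critical values of the characteristic polynomial\<close>

definition F_poly :: "nat \<Rightarrow> (nat \<Rightarrow> real) \<Rightarrow> real \<Rightarrow> real" where
  "F_poly n lam x = (\<Prod>i = 1..n. x - lam i)"

text \<open>\<open>crit_point n lam i\<close> is the \<open>i\<close>-th smallest critical point, for \<open>1 \<le> i \<le> n - 1\<close>.\<close>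

definition crit_point :: "nat \<Rightarrow> (nat \<Rightarrow> real) \<Rightarrow> nat \<Rightarrow> real" where
  "crit_point n lam i =
     sorted_list_of_set {x. (F_poly n lam has_real_derivative 0) (at x)} ! (i - 1)"

definition M_upper :: "nat \<Rightarrow> (nat \<Rightarrow> real) \<Rightarrow> real" where
  "M_upper n lam = Min ((\<lambda>i. F_poly n lam (crit_point n lam (n - i))) ` {i \<in> {1..n-1}. even i})"

definition m_lower :: "nat \<Rightarrow> (nat \<Rightarrow> real) \<Rightarrow> real" where
  "m_lower n lam = Min ((\<lambda>i. - F_poly n lam (crit_point n lam (n - i))) ` {i \<in> {1..n-1}. odd i})"

definition local_max_at :: "(real \<Rightarrow> real) \<Rightarrow> real \<Rightarrow> bool" where
  "local_max_at f x \<longleftrightarrow> (\<forall>\<^sub>F y in nhds x. f y \<le> f x)"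

definition local_min_at :: "(real \<Rightarrow> real) \<Rightarrow> real \<Rightarrow> bool" where
  "local_min_at f x \<longleftrightarrow> (\<forall>\<^sub>F y in nhds x. f x \<le> f y)"

definition n_plus :: "nat \<Rightarrow> (nat \<Rightarrow> real) \<Rightarrow> nat" where
  "n_plus n lam = card {x. local_max_at (F_poly n lam) x \<and> F_poly n lam x = M_upper n lam}"

definition n_minus :: "nat \<Rightarrow> (nat \<Rightarrow> real) \<Rightarrow> nat" where
  "n_minus n lam = card {x. local_min_at (F_poly n lam) x \<and> F_poly n lam x = - m_lower n lam}"

section \<open>Homology manifolds and smooth manifolds\<close>

text \<open>
  Singular homology with integer coefficients. The parameter \<open>d\<close> is the dimension of \<open>X\<close>; it is
  supplied by the user of the definition and is not asserted by it.
\<close>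

definition homology_manifold :: "nat \<Rightarrow> 'a topology \<Rightarrow> bool" where
  "homology_manifold d X \<longleftrightarrow>
     (\<forall>x \<in> topspace X. \<forall>i :: int.
        (if i = int d
         then relative_homology_group i X (topspace X - {x}) \<cong> integer_group
         else trivial_group (relative_homology_group i X (topspace X - {x}))))"

text \<open>
  \<open>Ck_on d k U f\<close>: the real function \<open>f\<close> is of class \<open>C\<^sup>k\<close> on \<open>U\<close>, an open subset of
  \<open>Euclidean_space d\<close> (the sequences vanishing from index \<open>d\<close> on). It is continuous and, if
  \<open>k > 0\<close>, it has first partial derivatives \<open>g 0, \<dots>, g (d - 1)\<close> at all points of \<open>U\<close>, each of
  class \<open>C\<^sup>k\<^sup>-\<^sup>1\<close> on \<open>U\<close>.
\<close>

primrec Ck_on :: "nat \<Rightarrow> nat \<Rightarrow> (nat \<Rightarrow> real) set \<Rightarrow> ((nat \<Rightarrow> real) \<Rightarrow> real) \<Rightarrow> bool" where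
  "Ck_on d 0 U f \<longleftrightarrow> continuous_map (subtopology (Euclidean_space d) U) euclideanreal f"
| "Ck_on d (Suc k) U f \<longleftrightarrow>
     continuous_map (subtopology (Euclidean_space d) U) euclideanreal f \<and>
     (\<exists>g. \<forall>i<d.
        (\<forall>x\<in>U. ((\<lambda>t. f (x(i := t))) has_real_derivative g i x) (at (x i))) \<and>
        Ck_on d k U (g i))"

definition smooth_map_on :: "nat \<Rightarrow> (nat \<Rightarrow> real) set \<Rightarrow> ((nat \<Rightarrow> real) \<Rightarrow> nat \<Rightarrow> real) \<Rightarrow> bool" where
  "smooth_map_on d U h \<longleftrightarrow> (\<forall>j<d. \<forall>k. Ck_on d k U (\<lambda>x. h x j))"

definition chart :: "nat \<Rightarrow> 'a topology \<Rightarrow> 'a set \<Rightarrow> ('a \<Rightarrow> nat \<Rightarrow> real) \<Rightarrow> bool" where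
  "chart d X U \<phi> \<longleftrightarrow>
     openin X U \<and>
     (\<exists>V. openin (Euclidean_space d) V \<and>
          homeomorphic_map (subtopology X U) (subtopology (Euclidean_space d) V) \<phi>)"

definition smooth_atlas :: "nat \<Rightarrow> 'a topology \<Rightarrow> ('a set \<times> ('a \<Rightarrow> nat \<Rightarrow> real)) set \<Rightarrow> bool" where
  "smooth_atlas d X \<A> \<longleftrightarrow>
     (\<forall>(U, \<phi>) \<in> \<A>. chart d X U \<phi>) \<and>
     (\<Union>(U, \<phi>) \<in> \<A>. U) = topspace X \<and>
     (\<forall>(U, \<phi>) \<in> \<A>. \<forall>(V, \<psi>) \<in> \<A>.
        smooth_map_on d (\<phi> ` (U \<inter> V)) (\<lambda>y. \<psi> (inv_into U \<phi> y)))"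

text \<open>The topological space \<open>X\<close> admits the structure of a smooth \<open>d\<close>-manifold (without boundary).\<close>

definition smooth_manifold :: "nat \<Rightarrow> 'a topology \<Rightarrow> bool" where
  "smooth_manifold d X \<longleftrightarrow>
     Hausdorff_space X \<and> second_countable X \<and> (\<exists>\<A>. smooth_atlas d X \<A>)"

end

theory Submission
  imports Defs
begin

text \<open>
  If no entry \<open>b i\<close> vanishes, a matrix of \<open>X\<close> is determined by its phases and by the following spectral data:
  the product \<open>B = \<Prod>i. b i\<close>, the eigenvalues \<open>\<mu> j\<close> of the matrix with the last row and column deleted
  (one in each gap of \<open>\<lambda>\<close>), and real numbers \<open>p j\<close> satisfying the decoupled equations
  \<open>p j + \<bar>B\<bar>\<^sup>2 / p j = - (F (\<mu> j) + 2 Re B)\<close>. Let \<open>\<sigma> = 1\<close> if \<open>n\<^sub>+ > 1\<close> and \<open>\<sigma> = -1\<close> if \<open>n\<^sub>- > 1\<close>, and let \<open>K\<close> be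
  the set of gaps in which the extremal level \<open>\<sigma> M\<close> is attained (with \<open>m\<close> for \<open>M\<close> if \<open>\<sigma> = -1\<close>). Near \<open>B = - \<sigma> M / 4\<close>
  the equations of the gaps in \<open>K\<close> read \<open>y\<^sub>j\<^sup>2 + z\<^sub>j\<^sup>2 = \<epsilon>(B)\<close> with a common right-hand side, and the other
  equations can be solved for \<open>p j\<close>. So \<open>X\<close> looks like the product of a Euclidean space with the cone over a
  torus of dimension \<open>\<bar>K\<bar> \<ge> 2\<close>. Two different circle factors of the torus give two discs through the
  cone point, and projecting to these factors shows that the classes of the discs are independent in
  local homology, which is therefore neither trivial nor \<open>\<int>\<close> in the degree of the discs.
\<close>

hide_const (open) module.smult up_ring.coeff

section \<open>Local homology\<close>

text \<open>In a gap of sign \<sigma> the equation for \<open>p j\<close> is solvable only if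
  \<open>\<sigma> F (\<mu> j) \<ge> 2 |B| - 2 \<sigma> Re B\<close>. On the gaps of \<open>K\<close>
  the left side is at most \<open>M\<close>, with equality only at the critical point, so all of
  them collapse at once when \<open>B\<close> reaches the parabola
  \<open>2 |B| - 2 \<sigma> Re B = M\<close>, whose real point is \<open>- \<sigma> M / 4\<close>.
  No homeomorphism with a cone is built. Germs of maps suffice: discs \<open>alp k\<close> into the
  space and projections \<open>bet k\<close> out of it. The disc of \<open>k\<close> runs through
  the circle of its own gap; in every other gap of \<open>K\<close> it keeps the node at the
  critical point and takes the nonnegative root of the discriminant. Its projection to such a gap
  has a component that is never negative, so a translation pushes it off the origin. The projections
  evaluate polynomials at the fixed critical points instead of following the moving nodes, which
  makes them visibly continuous. The price is a proof that each of them vanishes, near the singular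
  point, at one matrix only, the same for all \<open>k\<close>.\<close>

lemma local_homology_open_iso:
  assumes "openin X U" "x \<in> U" "closedin X {x}"
  shows "hom_induced p (subtopology X U) (U - {x}) X (topspace X - {x}) id
     \<in> iso (relative_homology_group p (subtopology X U) (U - {x}))
           (relative_homology_group p X (topspace X - {x}))"
proof -
  let ?C = "topspace X - U" and ?T = "topspace X - {x}"
  have sub: "U \<subseteq> topspace X"
    using assms(1) by (rule openin_subset)
  have "X closure_of ?C = ?C"
    using assms(1) by (simp add: closure_of_eq closedin_diff)
  moreover have "X interior_of ?T = ?T"
    using assms(3) by (simp add: interior_of_eq openin_diff)
  ultimately have "X closure_of ?C \<subseteq> X interior_of ?T"
    using assms(2) by auto
  moreover have eqs: "topspace X - ?C = U" "?T - ?C = U - {x}"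
    using sub by auto
  ultimately show ?thesis
    using homology_excision_axiom [of X ?C ?T "topspace X" p] by (simp add: eqs)
qed

text \<open>Complements of homeomorphic closed subsets have isomorphic relative homology, which
  moves \<open>y\<close> to the origin; a dimension shift by \<open>d\<close> then leads to the
  homology of a point.\<close>

lemma local_homology_Euclidean_space:
  assumes "y \<in> topspace (Euclidean_space d)"
  shows "if p = int d
         then relative_homology_group p (Euclidean_space d) (topspace (Euclidean_space d) - {y}) \<cong> integer_group
         else trivial_group (relative_homology_group p (Euclidean_space d) (topspace (Euclidean_space d) - {y}))"
proof -
  let ?o = "\<lambda>i::nat. 0::real"
  let ?H = "relative_homology_group p (Euclidean_space d) (topspace (Euclidean_space d) - {y})"
  have T0: "topspace (Euclidean_space 0) = {?o}"
    by (auto simp: topspace_Euclidean_space)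
  have closed: "closedin (Euclidean_space k) {z}" if "z \<in> topspace (Euclidean_space k)" for k z
    using closedin_Hausdorff_singleton[OF Hausdorff_Euclidean_space that] .
  have o_in: "?o \<in> topspace (Euclidean_space k)" for k
    by (simp add: topspace_Euclidean_space)
  have "subtopology (Euclidean_space d) {y} homeomorphic_space subtopology (Euclidean_space d) {?o}"
    using assms o_in unfolding homeomorphic_space_def homeomorphic_maps_def
    by (intro exI[of _ "\<lambda>_. ?o"] exI[of _ "\<lambda>_. y"]) (auto simp: continuous_map_in_subtopology)
  then have "?H \<cong> relative_homology_group p (Euclidean_space d) (topspace (Euclidean_space d) - {?o})"
    by (intro isomorphic_relative_homology_groups_Euclidean_complements closed o_in assms)
  moreover have "relative_homology_group (p - int d) (Euclidean_space 0) (topspace (Euclidean_space 0) - {?o})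
      \<cong> relative_homology_group (p - int d + int d) (Euclidean_space (0 + d)) (topspace (Euclidean_space (0 + d)) - {?o})"
    by (intro relative_homology_group_Euclidean_complement_step closed o_in)
  ultimately have iso: "?H \<cong> homology_group (p - int d) (Euclidean_space 0)"
    by (simp add: T0) (meson group.iso_sym group_relative_homology_group iso_trans)
  show ?thesis
  proof (cases "p = int d")
    case True
    then have "homology_group (p - int d) (Euclidean_space 0) \<cong> integer_group"
      using homology_coefficients T0 by simp
    then show ?thesis
      using True iso iso_trans by auto
  next
    case False
    then have "trivial_group (homology_group (p - int d) (Euclidean_space 0))"
      using homology_dimension_axiom[OF T0, of "p - int d"] by simp
    then show ?thesis
      using False isomorphic_group_triviality[OF iso] by simp
  qed
qed

text \<open>A chart domain and its image are open, so excision replaces both by the whole spaces;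
  the Hausdorff property supplies the closed points that excision asks for.\<close>

lemma smooth_manifold_imp_homology_manifold:
  assumes "smooth_manifold d X"
  shows "homology_manifold d X"
  unfolding homology_manifold_def
proof (intro ballI allI)
  fix x and i :: int
  assume x: "x \<in> topspace X"
  obtain \<A> where haus: "Hausdorff_space X" and atlas: "smooth_atlas d X \<A>"
    using assms unfolding smooth_manifold_def by blast
  then obtain U \<phi> where "(U, \<phi>) \<in> \<A>" "x \<in> U"
    using x unfolding smooth_atlas_def by blast
  then have "chart d X U \<phi>"
    using atlas unfolding smooth_atlas_def by blast
  then obtain V where U: "openin X U" and V: "openin (Euclidean_space d) V"
    and hm: "homeomorphic_map (subtopology X U) (subtopology (Euclidean_space d) V) \<phi>"
    unfolding chart_def by blast
  let ?E = "Euclidean_space d"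
  let ?G = "\<lambda>X x. relative_homology_group i X (topspace X - {x})"
  have top: "topspace (subtopology X U) = U" "topspace (subtopology ?E V) = V"
    using U V openin_subset by fastforce+
  have im: "\<phi> ` U = V" and inj: "inj_on \<phi> U"
    using hm top homeomorphic_eq_everything_map[of "subtopology X U" "subtopology ?E V" \<phi>] by auto
  have y: "\<phi> x \<in> V" "\<phi> x \<in> topspace ?E"
    using im \<open>x \<in> U\<close> V openin_subset by blast+
  have "?G (subtopology X U) x \<cong> ?G X x"
    using local_homology_open_iso[OF U \<open>x \<in> U\<close>, of i] closedin_Hausdorff_singleton[OF haus x]
    by (metis is_isoI top(1))
  moreover have "?G (subtopology ?E V) (\<phi> x) \<cong> ?G ?E (\<phi> x)"
    using local_homology_open_iso[OF V y(1), of i]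
      closedin_Hausdorff_singleton[OF Hausdorff_Euclidean_space y(2)]
    by (metis is_isoI top(2))
  moreover have "\<phi> ` (U - {x}) = V - {\<phi> x}"
    using im inj \<open>x \<in> U\<close> by (auto simp: inj_on_def)
  then have "?G (subtopology X U) x \<cong> ?G (subtopology ?E V) (\<phi> x)"
    using homeomorphic_map_relative_homology_iso[OF hm, of "U - {x}" "V - {\<phi> x}" i] top
    by (metis Diff_subset is_isoI)
  ultimately have iso: "?G X x \<cong> ?G ?E (\<phi> x)"
    by (meson group.iso_sym group_relative_homology_group iso_trans)
  show "if i = int d then ?G X x \<cong> integer_group else trivial_group (?G X x)"
    using local_homology_Euclidean_space[OF y(2), of i] iso isomorphic_group_triviality[OF iso]
    by (auto split: if_splits intro: iso_trans)
qed

section \<open>Two independent classes in local homology\<close>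

lemma hom_integer_group_eq:
  assumes "h \<in> hom integer_group integer_group"
  shows "h k = k * h 1"
proof -
  have add: "h (a + b) = h a + h b" for a b
    using assms by (auto simp: hom_def)
  have h0: "h 0 = 0"
    using add[of 0 0] by simp
  show ?thesis
  proof (induction k rule: int_induct[where k = 0])
    case (step1 i)
    then show ?case using add[of i 1] by (simp add: algebra_simps)
  next
    case (step2 i)
    then show ?case using add[of "i - 1" 1] by (simp add: algebra_simps)
  qed (simp add: h0)
qed

text \<open>With \<open>P\<close> and \<open>G\<close> identified with the integers, all four maps
  are multiplications. Injectivity of the diagonal composites makes the factors of
  \<open>A\<^sub>2\<close> and \<open>B\<^sub>1\<close> nonzero, which contradicts
  \<open>off\<close>. One vanishing off-diagonal composite is enough, as a triangular matrix with
  nonzero diagonal has rank 2.\<close>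

lemma no_two_independent_retracts:
  assumes P: "group P" "P \<cong> integer_group" and G: "group G" "G \<cong> integer_group \<or> trivial_group G"
    and A: "A\<^sub>1 \<in> hom P G" "A\<^sub>2 \<in> hom P G" and B: "B\<^sub>1 \<in> hom G P" "B\<^sub>2 \<in> hom G P"
    and diag: "inj_on (B\<^sub>1 \<circ> A\<^sub>1) (carrier P)" "inj_on (B\<^sub>2 \<circ> A\<^sub>2) (carrier P)"
    and off: "\<And>x. x \<in> carrier P \<Longrightarrow> B\<^sub>1 (A\<^sub>2 x) = \<one>\<^bsub>P\<^esub>"
  shows False
proof -
  obtain \<theta> where \<theta>: "\<theta> \<in> iso P integer_group"
    using P by (auto simp: is_iso_def)
  have "\<not> trivial_group P"
    using isomorphic_group_triviality[OF P(2) P(1)] nontrivial_integer_group by simp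
  moreover have one: "\<one>\<^bsub>P\<^esub> \<in> carrier P"
    using P(1) by (simp add: group.is_monoid)
  ultimately obtain x where x: "x \<in> carrier P" "x \<noteq> \<one>\<^bsub>P\<^esub>"
    using P(1) unfolding trivial_group_def by blast
  have hom1: "f \<one>\<^bsub>K\<^esub> = \<one>\<^bsub>L\<^esub>" if "f \<in> hom K L" "group K" "group L" for f K L
    using that hom_one by blast
  have BA1: "B\<^sub>1 (A\<^sub>1 x) \<noteq> \<one>\<^bsub>P\<^esub>"
    using diag(1) x one hom1[OF A(1) P(1) G(1)] hom1[OF B(1) G(1) P(1)] by (auto simp: inj_on_def)
  have BA2: "B\<^sub>2 (A\<^sub>2 x) \<noteq> \<one>\<^bsub>P\<^esub>"
    using diag(2) x one hom1[OF A(2) P(1) G(1)] hom1[OF B(2) G(1) P(1)] by (auto simp: inj_on_def)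
  have AG: "A\<^sub>1 x \<in> carrier G" "A\<^sub>2 x \<in> carrier G"
    using A x by (auto simp: hom_def)
  have "\<not> trivial_group G"
    using AG BA1 hom1[OF B(1) G(1) P(1)] by (auto simp: trivial_group_def)
  then obtain \<phi> where \<phi>: "\<phi> \<in> iso G integer_group"
    using G by (auto simp: is_iso_def)
  then obtain \<psi> where \<psi>: "group_isomorphisms G integer_group \<phi> \<psi>"
    using group.iso_iff_group_isomorphisms[OF G(1)] by blast
  have \<psi>hom: "\<psi> \<in> hom integer_group G" and \<psi>\<phi>: "\<And>y. y \<in> carrier G \<Longrightarrow> \<psi> (\<phi> y) = y"
    using \<psi> by (auto simp: group_isomorphisms_def)
  have \<theta>hom: "\<theta> \<in> hom P integer_group" and \<theta>inj: "inj_on \<theta> (carrier P)"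
    using \<theta> by (auto simp: iso_def bij_betw_def)
  have \<theta>1: "\<theta> \<one>\<^bsub>P\<^esub> = 0"
    using hom1[OF \<theta>hom P(1)] by (simp add: group_integer_group)
  define h where "h B = \<theta> \<circ> B \<circ> \<psi>" for B
  have h: "\<theta> (B y) = \<phi> y * h B 1" if "B \<in> hom G P" "y \<in> carrier G" for B y
  proof -
    have "h B \<in> hom integer_group integer_group"
      unfolding h_def using that \<psi>hom \<theta>hom by (auto intro!: hom_compose)
    from hom_integer_group_eq[OF this, of "\<phi> y"] show ?thesis
      using \<psi>\<phi>[OF that(2)] by (simp add: h_def)
  qed
  have BP: "B\<^sub>1 (A\<^sub>1 x) \<in> carrier P" "B\<^sub>2 (A\<^sub>2 x) \<in> carrier P"
    using AG B by (auto simp: hom_def)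
  have "\<phi> (A\<^sub>1 x) * h B\<^sub>1 1 \<noteq> 0"
    using h[OF B(1) AG(1)] BA1 \<theta>1 \<theta>inj BP one by (metis inj_on_eq_iff)
  moreover have "\<phi> (A\<^sub>2 x) * h B\<^sub>1 1 = 0"
    using h[OF B(1) AG(2)] off[OF x(1)] \<theta>1 by simp
  moreover have "\<phi> (A\<^sub>2 x) * h B\<^sub>2 1 \<noteq> 0"
    using h[OF B(2) AG(2)] BA2 \<theta>1 \<theta>inj BP one by (metis inj_on_eq_iff)
  ultimately show False by auto
qed

lemma straight_homotopy:
  assumes g: "continuous_map X (Euclidean_space N) g" and h: "continuous_map X (Euclidean_space N) h"
    and nz: "\<And>t u. t \<in> {0..1} \<Longrightarrow> u \<in> topspace X \<Longrightarrow> u \<in> S \<Longrightarrow> (\<lambda>i. (1 - t) * g u i + t * h u i) \<noteq> (\<lambda>_. 0)"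
    and S: "S \<subseteq> topspace X"
  shows "homotopic_with (\<lambda>h. h \<in> S \<rightarrow> topspace (Euclidean_space N) - {\<lambda>_. 0}) X (Euclidean_space N) g h"
  unfolding homotopic_with_def
proof (intro exI conjI)
  let ?k = "\<lambda>(t, u). (\<lambda>i. (1 - t) * g u i + t * h u i)"
  have gi: "continuous_map X euclideanreal (\<lambda>u. g u i)" and hi: "continuous_map X euclideanreal (\<lambda>u. h u i)" for i
    using g h by (auto simp: Euclidean_space_def continuous_map_in_subtopology continuous_map_componentwise_UNIV)
  have gi': "continuous_map (prod_topology (top_of_set {0..1}) X) euclideanreal (\<lambda>x. g (snd x) i)"
    and hi': "continuous_map (prod_topology (top_of_set {0..1}) X) euclideanreal (\<lambda>x. h (snd x) i)" for i
    using continuous_map_compose[OF continuous_map_snd gi] continuous_map_compose[OF continuous_map_snd hi]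
    by (auto simp: o_def)
  have fst: "continuous_map (prod_topology (top_of_set {0..1::real}) X) euclideanreal fst"
    using continuous_map_fst continuous_map_into_fulltopology by blast
  have gh0: "g u i = 0" "h u i = 0" if "u \<in> topspace X" "N \<le> i" for u i
    using continuous_map_funspace[OF g] continuous_map_funspace[OF h] that
    by (auto simp: topspace_Euclidean_space Pi_iff)
  show k: "continuous_map (prod_topology (top_of_set {0..1}) X) (Euclidean_space N) ?k"
    unfolding Euclidean_space_def continuous_map_in_subtopology continuous_map_componentwise_UNIV
    using gh0 by (auto simp: case_prod_unfold intro!: continuous_intros gi' hi' fst)
  show "\<forall>t\<in>{0..1}. (\<lambda>x. ?k (t, x)) \<in> S \<rightarrow> topspace (Euclidean_space N) - {\<lambda>_. 0}"
    using nz S gh0 by (auto simp: topspace_Euclidean_space)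
qed auto

text \<open>The map factors through the pair \<open>(T, T)\<close>, whose relative homology is
  trivial.\<close>

lemma hom_induced_eq_one:
  assumes f: "continuous_map X Y f" "f \<in> topspace X \<rightarrow> T" and x: "x \<in> carrier (relative_homology_group p X S)"
    and S: "S \<subseteq> topspace X" and T: "T \<subseteq> topspace Y"
  shows "hom_induced p X S Y T f x = \<one>\<^bsub>relative_homology_group p Y T\<^esub>"
proof -
  let ?T = "subtopology Y T"
  have tT: "topspace ?T = T"
    using T by auto
  have fT: "continuous_map X ?T f"
    using f by (auto simp: continuous_map_in_subtopology)
  have "hom_induced p X S Y T f = hom_induced p X S Y T (id \<circ> f)" by simp
  also have "\<dots> = hom_induced p ?T T Y T id \<circ> hom_induced p X S ?T T f"
    using fT f(2) S by (intro hom_induced_compose) (auto simp: continuous_map_from_subtopology)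
  finally have eq: "hom_induced p X S Y T f x = hom_induced p ?T T Y T id (hom_induced p X S ?T T f x)"
    by simp
  have "trivial_group (relative_homology_group p ?T T)"
    using trivial_relative_homology_group_topspace[of p ?T] tT by simp
  then have "hom_induced p X S ?T T f x = \<one>\<^bsub>relative_homology_group p ?T T\<^esub>"
    using hom_induced_carrier[of p X S ?T T f x] by (simp add: trivial_group_def)
  then show ?thesis
    using eq hom_one[OF hom_induced_hom, of p ?T T Y T id] by simp
qed

text \<open>
  If two germs of \<open>N\<close>-dimensional discs at \<open>x\<^sub>0\<close> are separated by two germs of maps to
  \<open>N\<close>-space, then the local homology at \<open>x\<^sub>0\<close> contains a free group of rank 2 in degree \<open>N\<close>.
\<close>
lemma two_discs_not_homology_manifold:
  fixes \<alpha>\<^sub>1 \<alpha>\<^sub>2 :: "(nat \<Rightarrow> real) \<Rightarrow> 'a" and \<beta>\<^sub>1 \<beta>\<^sub>2 :: "'a \<Rightarrow> nat \<Rightarrow> real" and N :: nat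
  defines "E \<equiv> Euclidean_space N"
  assumes U: "openin X U" "x\<^sub>0 \<in> U" "closedin X {x\<^sub>0}" and W: "openin E W" "(\<lambda>_. 0) \<in> W"
    and \<alpha>: "continuous_map (subtopology E W) X \<alpha>\<^sub>1" "continuous_map (subtopology E W) X \<alpha>\<^sub>2"
    and \<alpha>0: "\<alpha>\<^sub>1 (\<lambda>_. 0) = x\<^sub>0" "\<alpha>\<^sub>2 (\<lambda>_. 0) = x\<^sub>0"
    and \<beta>: "continuous_map (subtopology X U) E \<beta>\<^sub>1" "continuous_map (subtopology X U) E \<beta>\<^sub>2"
    and \<beta>0: "\<And>x. x \<in> U \<Longrightarrow> \<beta>\<^sub>1 x = (\<lambda>_. 0) \<longleftrightarrow> x = x\<^sub>0" "\<And>x. x \<in> U \<Longrightarrow> \<beta>\<^sub>2 x = (\<lambda>_. 0) \<longleftrightarrow> x = x\<^sub>0"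
    and diag: "\<And>u t. u \<in> W \<Longrightarrow> u \<noteq> (\<lambda>_. 0) \<Longrightarrow> t \<in> {0..1} \<Longrightarrow> (\<lambda>i. (1 - t) * u i + t * \<beta>\<^sub>1 (\<alpha>\<^sub>1 u) i) \<noteq> (\<lambda>_. 0)"
      "\<And>u t. u \<in> W \<Longrightarrow> u \<noteq> (\<lambda>_. 0) \<Longrightarrow> t \<in> {0..1} \<Longrightarrow> (\<lambda>i. (1 - t) * u i + t * \<beta>\<^sub>2 (\<alpha>\<^sub>2 u) i) \<noteq> (\<lambda>_. 0)"
    and off: "\<And>u t. u \<in> W \<Longrightarrow> u \<noteq> (\<lambda>_. 0) \<or> t \<noteq> 0 \<Longrightarrow> t \<in> {0..1} \<Longrightarrow> (\<lambda>i. \<beta>\<^sub>1 (\<alpha>\<^sub>2 u) i + t * e i) \<noteq> (\<lambda>_. 0)"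
    and e: "e \<in> topspace E"
  shows "\<not> homology_manifold d X"
proof
  assume hm: "homology_manifold d X"
  let ?o = "\<lambda>_::nat. 0::real"
  \<comment> \<open>Both discs must land in \<open>U\<close> to be composed with the projections;
    shrinking their domain leaves the local homology at the origin unchanged.\<close>
  define W' where "W' = {u \<in> topspace (subtopology E W). \<alpha>\<^sub>1 u \<in> U} \<inter> {u \<in> topspace (subtopology E W). \<alpha>\<^sub>2 u \<in> U}"
  have "openin (subtopology E W) W'"
    unfolding W'_def using U \<alpha> by (intro openin_Int openin_continuous_map_preimage) auto
  then have W': "openin E W'"
    using W(1) openin_trans_full by blast
  have W'sub: "W' \<subseteq> W" "W' \<subseteq> topspace E"
    by (auto simp: W'_def)
  have oE: "?o \<in> topspace E"
    by (simp add: E_def topspace_Euclidean_space)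
  have oW': "?o \<in> W'"
    using W(2) oE \<alpha>0 U by (auto simp: W'_def)
  have Usub: "U \<subseteq> topspace X" using U(1) by (rule openin_subset)
  have tW': "topspace (subtopology E W') = W'" and tU: "topspace (subtopology X U) = U"
    using W'sub Usub by auto
  have sub_eq: "subtopology (subtopology E W) W' = subtopology E W'"
    using W'sub by (simp add: subtopology_subtopology inf.absorb2)
  let ?P = "relative_homology_group (int N) (subtopology E W') (W' - {?o})"
  let ?E = "relative_homology_group (int N) E (topspace E - {?o})"
  let ?G = "relative_homology_group (int N) (subtopology X U) (U - {x\<^sub>0})"
  define A where "A \<alpha> = hom_induced (int N) (subtopology E W') (W' - {?o}) (subtopology X U) (U - {x\<^sub>0}) \<alpha>" for \<alpha>
  define B where "B \<beta> = hom_induced (int N) (subtopology X U) (U - {x\<^sub>0}) E (topspace E - {?o}) \<beta>" for \<beta>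
  define I where "I = hom_induced (int N) (subtopology E W') (W' - {?o}) E (topspace E - {?o}) id"
  have I: "I \<in> iso ?P ?E"
    unfolding I_def using W' oW' oE Hausdorff_Euclidean_space
    by (intro local_homology_open_iso) (auto simp: E_def closedin_Hausdorff_singleton)
  have E_iso: "?E \<cong> integer_group"
    using local_homology_Euclidean_space[of ?o N "int N"] oE by (simp add: E_def)
  have G_iso: "?G \<cong> integer_group \<or> trivial_group ?G"
  proof -
    let ?X = "relative_homology_group (int N) X (topspace X - {x\<^sub>0})"
    have "?G \<cong> ?X"
      using local_homology_open_iso[OF U] is_isoI by blast
    moreover have "?X \<cong> integer_group \<or> trivial_group ?X"
      using hm U Usub unfolding homology_manifold_def by (metis subsetD)
    ultimately show ?thesis
      using iso_trans isomorphic_group_triviality by (metis group_relative_homology_group)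
  qed
  have \<alpha>': "continuous_map (subtopology E W') (subtopology X U) \<alpha>\<^sub>1" "continuous_map (subtopology E W') (subtopology X U) \<alpha>\<^sub>2"
    using \<alpha>[THEN continuous_map_from_subtopology, of W'] tW' unfolding sub_eq
    by (auto simp: continuous_map_in_subtopology) (auto simp: W'_def)
  have \<alpha>U: "\<alpha>\<^sub>1 u \<in> U" "\<alpha>\<^sub>2 u \<in> U" if "u \<in> W'" for u
    using that by (auto simp: W'_def)
  have \<alpha>x: "\<alpha>\<^sub>1 u \<noteq> x\<^sub>0" "\<alpha>\<^sub>2 u \<noteq> x\<^sub>0" if "u \<in> W'" "u \<noteq> ?o" for u
    using diag(1)[of u 1] diag(2)[of u 1] that \<beta>0 U(2) W'sub(1) by auto
  have \<alpha>m: "\<alpha>\<^sub>1 \<in> W' - {?o} \<rightarrow> U - {x\<^sub>0}" "\<alpha>\<^sub>2 \<in> W' - {?o} \<rightarrow> U - {x\<^sub>0}"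
    using \<alpha>U \<alpha>x by auto
  have \<beta>m: "\<beta>\<^sub>1 \<in> U - {x\<^sub>0} \<rightarrow> topspace E - {?o}" "\<beta>\<^sub>2 \<in> U - {x\<^sub>0} \<rightarrow> topspace E - {?o}"
    using \<beta>0 continuous_map_funspace[OF \<beta>(1)] continuous_map_funspace[OF \<beta>(2)] tU by auto
  have BA: "B \<beta> (A \<alpha> x) = hom_induced (int N) (subtopology E W') (W' - {?o}) E (topspace E - {?o}) (\<beta> \<circ> \<alpha>) x"
    if "continuous_map (subtopology E W') (subtopology X U) \<alpha>" "\<alpha> \<in> W' - {?o} \<rightarrow> U - {x\<^sub>0}"
      "continuous_map (subtopology X U) E \<beta>" "\<beta> \<in> U - {x\<^sub>0} \<rightarrow> topspace E - {?o}" for \<alpha> \<beta> x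
    unfolding A_def B_def using that by (rule hom_induced_compose')
  have idE: "continuous_map (subtopology E W') E id"
    by (simp add: continuous_map_from_subtopology)
  have diag': "B \<beta> (A \<alpha> x) = I x"
    if "continuous_map (subtopology E W') (subtopology X U) \<alpha>" "\<alpha> \<in> W' - {?o} \<rightarrow> U - {x\<^sub>0}"
      "continuous_map (subtopology X U) E \<beta>" "\<beta> \<in> U - {x\<^sub>0} \<rightarrow> topspace E - {?o}"
      "\<And>u t. u \<in> W \<Longrightarrow> u \<noteq> ?o \<Longrightarrow> t \<in> {0..1} \<Longrightarrow> (\<lambda>i. (1 - t) * u i + t * \<beta> (\<alpha> u) i) \<noteq> ?o" for \<alpha> \<beta> x
  proof -
    have "homotopic_with (\<lambda>h. h \<in> (W' - {?o}) \<rightarrow> topspace E - {?o}) (subtopology E W') E id (\<beta> \<circ> \<alpha>)"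
      unfolding E_def
      by (rule straight_homotopy) (use that idE W'sub tW' in \<open>auto simp: E_def[symmetric] intro: continuous_map_compose\<close>)
    from homology_homotopy_axiom[OF this] show ?thesis
      unfolding BA[OF that(1-4)] I_def by metis
  qed
  have off': "B \<beta>\<^sub>1 (A \<alpha>\<^sub>2 x) = \<one>\<^bsub>?E\<^esub>" if x: "x \<in> carrier ?P" for x
  proof -
    \<comment> \<open>Translation by \<open>e\<close> clears the centre of the disc as well, the one
      point that the subspace of the pair omits; so \<open>?f\<close> sends the whole disc into the
      complement of the origin.\<close>
    let ?f = "\<lambda>u i. (\<beta>\<^sub>1 \<circ> \<alpha>\<^sub>2) u i + e i"
    have ba: "continuous_map (subtopology E W') E (\<beta>\<^sub>1 \<circ> \<alpha>\<^sub>2)"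
      using \<alpha>'(2) \<beta>(1) by (rule continuous_map_compose)
    have f: "continuous_map (subtopology E W') E ?f"
      using continuous_map_Euclidean_space_add[OF ba[unfolded E_def], of "\<lambda>_. e"] e unfolding E_def by simp
    have "homotopic_with (\<lambda>h. h \<in> (W' - {?o}) \<rightarrow> topspace E - {?o}) (subtopology E W') E (\<beta>\<^sub>1 \<circ> \<alpha>\<^sub>2) ?f"
      unfolding E_def
    proof (rule straight_homotopy[OF ba[unfolded E_def] f[unfolded E_def]])
      fix t :: real and u assume "t \<in> {0..1}" "u \<in> W' - {?o}"
      then have "(\<lambda>i. \<beta>\<^sub>1 (\<alpha>\<^sub>2 u) i + t * e i) \<noteq> ?o"
        using W'sub by (intro off) auto
      then show "(\<lambda>i. (1 - t) * (\<beta>\<^sub>1 \<circ> \<alpha>\<^sub>2) u i + t * ((\<beta>\<^sub>1 \<circ> \<alpha>\<^sub>2) u i + e i)) \<noteq> ?o"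
        by (simp add: algebra_simps)
    qed (use tW' E_def in \<open>simp_all add: Diff_subset\<close>)
    from homology_homotopy_axiom[OF this]
    have "B \<beta>\<^sub>1 (A \<alpha>\<^sub>2 x) = hom_induced (int N) (subtopology E W') (W' - {?o}) E (topspace E - {?o}) ?f x"
      unfolding BA[OF \<alpha>'(2) \<alpha>m(2) \<beta>(1) \<beta>m(1)] by metis
    also have "\<dots> = \<one>\<^bsub>?E\<^esub>"
    proof (rule hom_induced_eq_one[OF f _ x])
      have "?f u \<noteq> ?o" if "u \<in> W'" for u
        using off[of u 1] that W'sub by auto
      moreover have "?f u \<in> topspace E" if "u \<in> W'" for u
        using continuous_map_funspace[OF f] that tW' by auto
      ultimately show "?f \<in> topspace (subtopology E W') \<rightarrow> topspace E - {?o}"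
        unfolding tW' by auto
    qed (use tW' in auto)
    finally show ?thesis .
  qed
  obtain J where J: "group_isomorphisms ?P ?E I J"
    using I group.iso_iff_group_isomorphisms group_relative_homology_group by metis
  have Jhom: "J \<in> hom ?E ?P"
    using J by (simp add: group_isomorphisms_def)
  have JI: "J (I x) = x" if "x \<in> carrier ?P" for x
    using J that by (auto simp: group_isomorphisms_def)
  have J1: "J \<one>\<^bsub>?E\<^esub> = \<one>\<^bsub>?P\<^esub>"
    using hom_one[OF Jhom] by simp
  show False
  proof (rule no_two_independent_retracts[of ?P ?G "A \<alpha>\<^sub>1" "A \<alpha>\<^sub>2" "J \<circ> B \<beta>\<^sub>1" "J \<circ> B \<beta>\<^sub>2"])
    show "?P \<cong> integer_group"
      using I E_iso iso_trans is_isoI by blast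
    show "A \<alpha>\<^sub>1 \<in> hom ?P ?G" "A \<alpha>\<^sub>2 \<in> hom ?P ?G"
      unfolding A_def by (rule hom_induced_hom)+
    show "J \<circ> B \<beta>\<^sub>1 \<in> hom ?G ?P" "J \<circ> B \<beta>\<^sub>2 \<in> hom ?G ?P"
      unfolding B_def using Jhom by (auto intro!: hom_compose hom_induced_hom)
    show "inj_on (J \<circ> B \<beta>\<^sub>1 \<circ> A \<alpha>\<^sub>1) (carrier ?P)" "inj_on (J \<circ> B \<beta>\<^sub>2 \<circ> A \<alpha>\<^sub>2) (carrier ?P)"
      using diag'[OF \<alpha>'(1) \<alpha>m(1) \<beta>(1) \<beta>m(1) diag(1)] diag'[OF \<alpha>'(2) \<alpha>m(2) \<beta>(2) \<beta>m(2) diag(2)] JI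
      by (auto simp: inj_on_def)
    show "(J \<circ> B \<beta>\<^sub>1) (A \<alpha>\<^sub>2 x) = \<one>\<^bsub>?P\<^esub>" if "x \<in> carrier ?P" for x
      using off'[OF that] J1 by simp
  qed (rule group_relative_homology_group G_iso)+
qed

section \<open>Determinants of tridiagonal matrices\<close>

text \<open>
  \<open>tridet a \<rho> s k\<close> is the characteristic polynomial of the Hermitian tridiagonal \<open>k \<times> k\<close> matrix with
  diagonal \<open>a (s + 1), \<dots>, a (s + k)\<close> and squared off-diagonal moduli \<open>\<rho> (s + 1), \<dots>, \<rho> (s + k - 1)\<close>.
\<close>
fun tridet :: "(nat \<Rightarrow> real) \<Rightarrow> (nat \<Rightarrow> real) \<Rightarrow> nat \<Rightarrow> nat \<Rightarrow> real poly" where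
  "tridet a \<rho> s 0 = 1"
| "tridet a \<rho> s (Suc 0) = [:- a (Suc s), 1:]"
| "tridet a \<rho> s (Suc (Suc k)) =
     [:- a (s + k + 2), 1:] * tridet a \<rho> s (Suc k) - smult (\<rho> (s + k + 1)) (tridet a \<rho> s k)"

lemma coeff_linear_mult:
  fixes p :: "real poly"
  shows "coeff ([:c, 1:] * p) i = c * coeff p i + (if i = 0 then 0 else coeff p (i - 1))"
  by (cases i) (auto simp: mult_pCons_left)

lemma coeff_tridet:
  "coeff (tridet a \<rho> s k) k = 1"
  "k < i \<Longrightarrow> coeff (tridet a \<rho> s k) i = 0"
proof -
  have "coeff (tridet a \<rho> s k) k = 1 \<and> (\<forall>i>k. coeff (tridet a \<rho> s k) i = 0)"
    by (induction a \<rho> s k rule: tridet.induct)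
      (auto simp: coeff_linear_mult coeff_pCons split: nat.splits simp del: mult_pCons_left)
  then show "coeff (tridet a \<rho> s k) k = 1" "k < i \<Longrightarrow> coeff (tridet a \<rho> s k) i = 0"
    by auto
qed

text \<open>Expansion along the first row instead of the last. The induction expands at the last
  row, then both summands at the first row; the two expansions commute. It goes down by two, hence
  the two base cases.\<close>

lemma tridet_left:
  "tridet a \<rho> s (Suc (Suc k)) =
     [:- a (Suc s), 1:] * tridet a \<rho> (Suc s) (Suc k) - smult (\<rho> (Suc s)) (tridet a \<rho> (Suc (Suc s)) k)"
proof (induction k rule: less_induct)
  case (less k)
  consider "k = 0" | "k = 1" | j where "k = Suc (Suc j)"
    by (cases k; cases "k - 1") auto
  then show ?case
  proof cases
    case 1
    then show ?thesis by (simp add: algebra_simps)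
  next
    case 2
    then show ?thesis by (simp add: algebra_simps smult_add_right smult_diff_right)
  next
    case 3
    have "tridet a \<rho> s (Suc (Suc k)) =
        [:- a (s + k + 2), 1:] * tridet a \<rho> s (Suc (Suc (Suc j))) - smult (\<rho> (s + k + 1)) (tridet a \<rho> s (Suc (Suc j)))"
      using 3 by simp
    also have "\<dots> = [:- a (s + k + 2), 1:] *
         ([:- a (Suc s), 1:] * tridet a \<rho> (Suc s) (Suc (Suc j)) - smult (\<rho> (Suc s)) (tridet a \<rho> (Suc (Suc s)) (Suc j)))
       - smult (\<rho> (s + k + 1))
         ([:- a (Suc s), 1:] * tridet a \<rho> (Suc s) (Suc j) - smult (\<rho> (Suc s)) (tridet a \<rho> (Suc (Suc s)) j))"
      using less.IH[of "Suc j"] less.IH[of j] 3 by (simp del: tridet.simps(3))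
    also have "\<dots> = [:- a (Suc s), 1:] *
         ([:- a (s + k + 2), 1:] * tridet a \<rho> (Suc s) (Suc (Suc j)) - smult (\<rho> (s + k + 1)) (tridet a \<rho> (Suc s) (Suc j)))
       - smult (\<rho> (Suc s))
         ([:- a (s + k + 2), 1:] * tridet a \<rho> (Suc (Suc s)) (Suc j) - smult (\<rho> (s + k + 1)) (tridet a \<rho> (Suc (Suc s)) j))"
      unfolding right_diff_distrib smult_diff_right mult_smult_right smult_smult
      by (simp only: diff_diff_eq add_diff_eq diff_add_eq diff_diff_eq2 ac_simps)
    also have "\<dots> = [:- a (Suc s), 1:] * tridet a \<rho> (Suc s) (Suc k) - smult (\<rho> (Suc s)) (tridet a \<rho> (Suc (Suc s)) k)"
      using 3 by simp
    finally show ?thesis .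
  qed
qed

lemma poly_tridet_right:
  "poly (tridet a \<rho> s (Suc (Suc k))) x =
     (x - a (s + k + 2)) * poly (tridet a \<rho> s (Suc k)) x - \<rho> (s + k + 1) * poly (tridet a \<rho> s k) x"
  by (simp add: algebra_simps)

lemma poly_tridet_left:
  "poly (tridet a \<rho> s (Suc (Suc k))) x =
     (x - a (Suc s)) * poly (tridet a \<rho> (Suc s) (Suc k)) x - \<rho> (Suc s) * poly (tridet a \<rho> (Suc (Suc s)) k) x"
  unfolding tridet_left by (simp add: algebra_simps)

text \<open>Both families obey the same three-term recursion in \<open>k\<close>, so their discrete
  Wronskian only picks up the factor \<open>\<rho> (s + k + 2)\<close> in each step. At a zero of
  the longest determinant it gives the product of the two cofactors.\<close>

lemma tridet_wronskian:
  "poly (tridet a \<rho> s (Suc (Suc k))) x * poly (tridet a \<rho> (Suc s) k) x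
     - poly (tridet a \<rho> s (Suc k)) x * poly (tridet a \<rho> (Suc s) (Suc k)) x
   = - (\<Prod>i = Suc s..s + k + 1. \<rho> i)"
proof (induction k)
  case 0
  then show ?case by (simp add: algebra_simps)
next
  case (Suc k)
  define c r where "c = x - a (s + k + 3)" and "r = \<rho> (s + k + 2)"
  have A: "poly (tridet a \<rho> s (Suc (Suc (Suc k)))) x
      = c * poly (tridet a \<rho> s (Suc (Suc k))) x - r * poly (tridet a \<rho> s (Suc k)) x"
    using poly_tridet_right[of a \<rho> s "Suc k" x] by (simp add: c_def r_def eval_nat_numeral del: tridet.simps)
  have B: "poly (tridet a \<rho> (Suc s) (Suc (Suc k))) x
      = c * poly (tridet a \<rho> (Suc s) (Suc k)) x - r * poly (tridet a \<rho> (Suc s) k) x"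
    using poly_tridet_right[of a \<rho> "Suc s" k x] by (simp add: c_def r_def eval_nat_numeral del: tridet.simps)
  have "poly (tridet a \<rho> s (Suc (Suc (Suc k)))) x * poly (tridet a \<rho> (Suc s) (Suc k)) x
     - poly (tridet a \<rho> s (Suc (Suc k))) x * poly (tridet a \<rho> (Suc s) (Suc (Suc k))) x
     = r * (poly (tridet a \<rho> s (Suc (Suc k))) x * poly (tridet a \<rho> (Suc s) k) x
       - poly (tridet a \<rho> s (Suc k)) x * poly (tridet a \<rho> (Suc s) (Suc k)) x)"
    unfolding A B by (simp only: algebra_simps)
  also have "\<dots> = - (\<Prod>i = Suc s..s + Suc k + 1. \<rho> i)"
    unfolding Suc r_def by (simp add: prod.nat_ivl_Suc')
  finally show ?case .
qed

text \<open>One step of Euclidean division, that is, of the continued fraction of the quotient of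
  the two determinants: the coefficient at degree \<open>Suc k\<close> yields
  \<open>a (Suc s)\<close>, the leading coefficient of the remainder yields
  \<open>\<rho> (Suc s)\<close>. That it is nonzero allows the next step.\<close>

lemma tridet_determines:
  assumes "tridet a \<rho> s (Suc k) = tridet a' \<rho>' s (Suc k)" "tridet a \<rho> (Suc s) k = tridet a' \<rho>' (Suc s) k"
    and "\<And>i. s < i \<Longrightarrow> i \<le> s + k \<Longrightarrow> \<rho> i \<noteq> 0"
  shows "(\<forall>i. s < i \<and> i \<le> s + k + 1 \<longrightarrow> a i = a' i) \<and> (\<forall>i. s < i \<and> i \<le> s + k \<longrightarrow> \<rho> i = \<rho>' i)"
  using assms
proof (induction k arbitrary: s)
  case 0
  then show ?case by (auto simp: le_Suc_eq)
next
  case (Suc k)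
  let ?p = "tridet a \<rho> (Suc s) (Suc k)" and ?r = "tridet a \<rho> (Suc (Suc s)) k" and ?r' = "tridet a' \<rho>' (Suc (Suc s)) k"
  have p': "tridet a' \<rho>' (Suc s) (Suc k) = ?p"
    using Suc.prems(2) by simp
  have eq: "[:- a (Suc s), 1:] * ?p - smult (\<rho> (Suc s)) ?r = [:- a' (Suc s), 1:] * ?p - smult (\<rho>' (Suc s)) ?r'"
    using Suc.prems(1) unfolding tridet_left p' .
  have "coeff ([:- a (Suc s), 1:] * ?p - smult (\<rho> (Suc s)) ?r) (Suc k)
      = coeff ([:- a' (Suc s), 1:] * ?p - smult (\<rho>' (Suc s)) ?r') (Suc k)"
    unfolding eq ..
  then have a: "a (Suc s) = a' (Suc s)"
    unfolding coeff_diff coeff_linear_mult coeff_smult by (simp add: coeff_tridet)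
  then have r: "smult (\<rho> (Suc s)) ?r = smult (\<rho>' (Suc s)) ?r'"
    using eq by simp
  then have "coeff (smult (\<rho> (Suc s)) ?r) k = coeff (smult (\<rho>' (Suc s)) ?r') k"
    by simp
  then have \<rho>: "\<rho> (Suc s) = \<rho>' (Suc s)"
    by (simp add: coeff_tridet)
  moreover have "\<rho> (Suc s) \<noteq> 0"
    using Suc.prems(3) by simp
  ultimately have "?r = ?r'"
    using r by (metis smult_1_left smult_smult left_inverse)
  then have IH: "(\<forall>i. Suc s < i \<and> i \<le> Suc s + k + 1 \<longrightarrow> a i = a' i) \<and> (\<forall>i. Suc s < i \<and> i \<le> Suc s + k \<longrightarrow> \<rho> i = \<rho>' i)"
    using Suc.IH[of "Suc s"] p' Suc.prems(3) by simp
  show ?case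
    using IH a \<rho> by (metis Suc_lessI add_Suc add_Suc_right)
qed

lemma continuous_on_poly_tridet [continuous_intros]:
  assumes "\<And>i. continuous_on S (\<lambda>u. a u i)" "\<And>i. continuous_on S (\<lambda>u. \<rho> u i)"
    and "continuous_on S x"
  shows "continuous_on S (\<lambda>u. poly (tridet (a u) (\<rho> u) s k) (x u))"
proof (induction k rule: less_induct)
  case (less k)
  consider "k = 0" | "k = Suc 0" | j where "k = Suc (Suc j)"
    by (cases k; cases "k - 1") auto
  then show ?case
  proof cases
    case 3
    show ?thesis unfolding 3 poly_tridet_right
      using less.IH[of "Suc j"] less.IH[of j] 3 by (auto intro!: continuous_intros assms simp del: tridet.simps)
  qed (auto intro!: continuous_intros assms)
qed

section \<open>Jacobi matrices from spectral data\<close>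

definition node_ip :: "(nat \<Rightarrow> real) \<Rightarrow> (nat \<Rightarrow> real) \<Rightarrow> nat \<Rightarrow> real poly \<Rightarrow> real poly \<Rightarrow> real" where
  "node_ip \<mu> w N p q = (\<Sum>j = 1..N. w j * poly p (\<mu> j) * poly q (\<mu> j))"

text \<open>The Stieltjes procedure for the monic orthogonal polynomials of the discrete measure
  with masses \<open>w j\<close> at \<open>\<mu> j\<close>.\<close>

fun opoly :: "(nat \<Rightarrow> real) \<Rightarrow> (nat \<Rightarrow> real) \<Rightarrow> nat \<Rightarrow> nat \<Rightarrow> real poly" where
  "opoly \<mu> w N 0 = 1"
| "opoly \<mu> w N (Suc 0) = [:- (node_ip \<mu> w N [:0, 1:] 1 / node_ip \<mu> w N 1 1), 1:]"
| "opoly \<mu> w N (Suc (Suc k)) =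
    (let p = opoly \<mu> w N (Suc k); q = opoly \<mu> w N k
     in [:- (node_ip \<mu> w N ([:0, 1:] * p) p / node_ip \<mu> w N p p), 1:] * p
        - smult (node_ip \<mu> w N p p / node_ip \<mu> w N q q) q)"

definition op_norm :: "(nat \<Rightarrow> real) \<Rightarrow> (nat \<Rightarrow> real) \<Rightarrow> nat \<Rightarrow> nat \<Rightarrow> real" where
  "op_norm \<mu> w N k = node_ip \<mu> w N (opoly \<mu> w N k) (opoly \<mu> w N k)"

definition jac_a :: "(nat \<Rightarrow> real) \<Rightarrow> (nat \<Rightarrow> real) \<Rightarrow> nat \<Rightarrow> nat \<Rightarrow> real" where
  "jac_a \<mu> w N i = node_ip \<mu> w N ([:0, 1:] * opoly \<mu> w N (i - 1)) (opoly \<mu> w N (i - 1)) / op_norm \<mu> w N (i - 1)"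

definition jac_rho :: "(nat \<Rightarrow> real) \<Rightarrow> (nat \<Rightarrow> real) \<Rightarrow> nat \<Rightarrow> nat \<Rightarrow> real" where
  "jac_rho \<mu> w N i = op_norm \<mu> w N i / op_norm \<mu> w N (i - 1)"

text \<open>The three-term recurrence of the orthogonal polynomials is the expansion of a
  tridiagonal determinant along its last row.\<close>

lemma opoly_eq_tridet: "opoly \<mu> w N k = tridet (jac_a \<mu> w N) (jac_rho \<mu> w N) 0 k"
proof (induction k rule: less_induct)
  case (less k)
  consider "k = 0" | "k = Suc 0" | j where "k = Suc (Suc j)"
    by (cases k; cases "k - 1") auto
  then show ?case
  proof cases
    case 3
    have "opoly \<mu> w N (Suc (Suc j)) = [:- jac_a \<mu> w N (j + 2), 1:] * opoly \<mu> w N (Suc j)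
       - smult (jac_rho \<mu> w N (j + 1)) (opoly \<mu> w N j)"
      by (simp add: jac_a_def jac_rho_def op_norm_def Let_def del: mult_pCons_left)
    also have "\<dots> = tridet (jac_a \<mu> w N) (jac_rho \<mu> w N) 0 (Suc (Suc j))"
      using less.IH[of "Suc j"] less.IH[of j] 3 by (simp del: mult_pCons_left)
    finally show ?thesis using 3 by simp
  qed (auto simp: jac_a_def op_norm_def one_pCons)
qed

lemma node_ip_linear [simp]:
  "node_ip \<mu> w N (p + p') q = node_ip \<mu> w N p q + node_ip \<mu> w N p' q"
  "node_ip \<mu> w N (p - p') q = node_ip \<mu> w N p q - node_ip \<mu> w N p' q"
  "node_ip \<mu> w N (smult c p) q = c * node_ip \<mu> w N p q"
  "node_ip \<mu> w N q (p + p') = node_ip \<mu> w N q p + node_ip \<mu> w N q p'"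
  "node_ip \<mu> w N q (p - p') = node_ip \<mu> w N q p - node_ip \<mu> w N q p'"
  "node_ip \<mu> w N q (smult c p) = c * node_ip \<mu> w N q p"
  "node_ip \<mu> w N 0 q = 0" "node_ip \<mu> w N q 0 = 0"
  by (auto simp: node_ip_def sum.distrib sum_subtractf sum_distrib_left algebra_simps)

lemma node_ip_commute: "node_ip \<mu> w N p q = node_ip \<mu> w N q p"
  by (simp add: node_ip_def mult.commute mult.left_commute)

lemma node_ip_shift: "node_ip \<mu> w N (pCons 0 p) q = node_ip \<mu> w N p (pCons 0 q)"
  by (simp add: node_ip_def algebra_simps)

text \<open>The degree bound is put in terms of coefficients, so that a difference of two monic
  polynomials of degree \<open>N\<close> qualifies without a computation of its degree.\<close>

lemma zero_on_nodes:
  fixes p :: "real poly" and \<mu> :: "nat \<Rightarrow> real"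
  assumes inj: "inj_on \<mu> {1..N}"
    and nodes: "\<And>j. j \<in> {1..N} \<Longrightarrow> poly p (\<mu> j) = 0" and coeffs: "\<And>i. i \<ge> N \<Longrightarrow> coeff p i = 0"
  shows "p = 0"
proof (rule ccontr)
  assume "p \<noteq> 0"
  then have "degree p < N"
    using coeffs by (metis leading_coeff_0_iff not_le)
  moreover have "card (\<mu> ` {1..N}) \<le> degree p"
    using nodes \<open>p \<noteq> 0\<close> by (intro order_trans[OF card_mono card_poly_roots_bound]) (auto intro: poly_roots_finite)
  ultimately show False
    using card_image[OF inj] by simp
qed

lemma monic_prod:
  fixes S :: "nat set" and f :: "nat \<Rightarrow> real"
  assumes "finite S"
  shows "coeff (\<Prod>i\<in>S. [:- f i, 1:]) (card S) = 1 \<and> (\<forall>i>card S. coeff (\<Prod>i\<in>S. [:- f i, 1:]) i = 0)"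
  using assms
  by (induction S rule: finite_induct) (auto simp: coeff_linear_mult simp del: mult_pCons_left)

section \<open>Orthogonality, norms and weights\<close>

locale node_weights =
  fixes \<mu> w :: "nat \<Rightarrow> real" and N :: nat
  assumes inj: "inj_on \<mu> {1..N}" and pos: "\<And>j. j \<in> {1..N} \<Longrightarrow> w j > 0" and N_pos: "N > 0"
begin

abbreviation "ip \<equiv> node_ip \<mu> w N"
abbreviation "P \<equiv> opoly \<mu> w N"
abbreviation "a \<equiv> jac_a \<mu> w N"
abbreviation "\<rho> \<equiv> jac_rho \<mu> w N"
abbreviation "h \<equiv> op_norm \<mu> w N"

lemma ip_self_eq_0:
  assumes "ip p p = 0" "j \<in> {1..N}"
  shows "poly p (\<mu> j) = 0"
proof -
  have "(\<Sum>j = 1..N. w j * poly p (\<mu> j) * poly p (\<mu> j)) = 0"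
    using assms(1) by (simp add: node_ip_def)
  then have "w j * poly p (\<mu> j) * poly p (\<mu> j) = 0"
    using pos assms(2) by (subst (asm) sum_nonneg_eq_0_iff) (auto simp: mult.assoc less_imp_le)
  then show ?thesis using pos[OF assms(2)] by auto
qed

lemma ip_self_nonneg: "ip p p \<ge> 0"
  unfolding node_ip_def using pos by (intro sum_nonneg) (auto simp: mult.assoc less_imp_le)

lemma coeff_P: "coeff (P k) k = 1" "k < i \<Longrightarrow> coeff (P k) i = 0"
  by (simp_all add: opoly_eq_tridet coeff_tridet)

lemma h_pos: "k < N \<Longrightarrow> h k > 0"
proof -
  assume k: "k < N"
  have "ip (P k) (P k) \<noteq> 0"
  proof
    assume "ip (P k) (P k) = 0"
    then have "P k = 0"
      using zero_on_nodes[OF inj, of "P k"] ip_self_eq_0[of "P k"] coeff_P(2)[of k] k by simp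
    then show False using coeff_P(1)[of k] by simp
  qed
  then show ?thesis
    using ip_self_nonneg[of "P k"] by (simp add: op_norm_def)
qed

lemma P_shift: "pCons 0 (P (Suc k)) = P (Suc (Suc k)) + smult (a (k + 2)) (P (Suc k)) + smult (\<rho> (k + 1)) (P k)"
  and P_shift_0: "pCons 0 (P 0) = P (Suc 0) + smult (a (Suc 0)) (P 0)"
  by (simp_all add: opoly_eq_tridet)

lemma a_ip: "k < N \<Longrightarrow> ip (pCons 0 (P k)) (P k) = a (Suc k) * h k"
  using h_pos[of k] by (simp add: jac_a_def)

lemma rho_h: "Suc k < N \<Longrightarrow> \<rho> (Suc k) * h k = h (Suc k)"
  using h_pos[of k] by (simp add: jac_rho_def)

text \<open>Multiplication by the variable is self-adjoint. For the two indices just below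
  \<open>k\<close> the recurrence coefficients are chosen to give zero; for smaller \<open>i\<close>
  the shift of \<open>P i\<close> has degree below \<open>k - 1\<close>. The case
  \<open>k = N\<close> is included, because the recurrence for \<open>P N\<close> divides only by
  norms of smaller index.\<close>

lemma P_orthogonal: "k \<le> N \<Longrightarrow> i < k \<Longrightarrow> ip (P k) (P i) = 0"
proof (induction k arbitrary: i rule: less_induct)
  case (less k)
  note [simp del] = opoly.simps
  show ?case
  proof (cases k)
    case 0
    with less show ?thesis by simp
  next
    case k: (Suc k')
    show ?thesis
    proof (cases k')
      case 0
      have "ip (pCons 0 (P 0)) (P 0) = ip (P 1 + smult (a 1) (P 0)) (P 0)"
        unfolding P_shift_0 by simp
      then show ?thesis
        using a_ip[of 0] less.prems k 0 by (simp add: op_norm_def)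
    next
      case k': (Suc m)
      have IH: "ip (P k') (P i) = 0" if "i < k'" for i
        using less.IH[of k'] less.prems k that by simp
      have IH': "ip (P m) (P i) = 0" if "i < m" for i
        using less.IH[of m] less.prems k k' that by simp
      have "ip (pCons 0 (P k')) (P i) = ip (P k + smult (a (m + 2)) (P k') + smult (\<rho> k') (P m)) (P i)"
        unfolding k k' P_shift by simp
      then have eq: "ip (P k) (P i) = ip (pCons 0 (P k')) (P i) - a (m + 2) * ip (P k') (P i) - \<rho> k' * ip (P m) (P i)"
        by simp
      consider "i = k'" | "i = m" | "i < m"
        using less.prems k k' by linarith
      then show ?thesis
      proof cases
        case 1
        then show ?thesis
          using eq a_ip[of k'] IH[of m] less.prems k k' by (simp add: op_norm_def node_ip_commute[of _ _ _ "P m"])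
      next
        case 2
        have "ip (P k') (pCons 0 (P m)) = ip (P k') (P k')"
        proof (cases m)
          case 0
          then show ?thesis
            using P_shift_0 IH[of 0] k' by simp
        next
          case (Suc l)
          then show ?thesis
            using P_shift[of l] IH[of m] IH[of l] k' by simp
        qed
        then have "ip (pCons 0 (P k')) (P i) = h k'"
          using 2 by (simp add: node_ip_shift op_norm_def)
        moreover have "\<rho> k' * h m = h k'"
          using rho_h[of m] less.prems k k' by simp
        ultimately show ?thesis
          using eq 2 IH[of m] k' by (simp add: op_norm_def)
      next
        case 3
        have "ip (P k') (pCons 0 (P i)) = 0"
        proof (cases i)
          case 0
          then show ?thesis
            using P_shift_0 IH[of 0] IH[of 1] k' 3 by simp
        next
          case (Suc l)
          then show ?thesis
            using P_shift[of l] IH[of l] IH[of "Suc l"] IH[of "Suc (Suc l)"] k' 3 by simp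
        qed
        then show ?thesis
          using eq IH[of i] IH'[of i] 3 k' by (simp add: node_ip_shift)
      qed
    qed
  qed
qed

lemma P_orthogonal_lower:
  assumes "k \<le> N" "\<And>i. i \<ge> k \<Longrightarrow> coeff q i = 0"
  shows "ip (P k) q = 0"
proof -
  have "\<forall>q. (\<forall>i\<ge>m. coeff q i = 0) \<longrightarrow> ip (P k) q = 0" if "m \<le> k" for m
    using that
  proof (induction m)
    case 0
    show ?case
    proof (intro allI impI)
      fix q :: "real poly" assume "\<forall>i\<ge>0. coeff q i = 0"
      then have "q = 0" by (simp add: poly_eq_iff)
      then show "ip (P k) q = 0" by simp
    qed
  next
    case (Suc m)
    show ?case
    proof (intro allI impI)
      fix q :: "real poly" assume q: "\<forall>i\<ge>Suc m. coeff q i = 0"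
      define q' where "q' = q - smult (coeff q m) (P m)"
      have "\<forall>i\<ge>m. coeff q' i = 0"
      proof (intro allI impI)
        fix i assume "m \<le> i"
        then show "coeff q' i = 0"
          using q coeff_P[of m] by (cases "i = m") (auto simp: q'_def)
      qed
      then have "ip (P k) q' = 0"
        using Suc by simp
      then show "ip (P k) q = 0"
        using P_orthogonal[of k m] assms(1) Suc.prems by (simp add: q'_def)
    qed
  qed
  from this[of k] show ?thesis using assms(2) by simp
qed

text \<open>\<open>P N\<close> is orthogonal to its difference with the nodal polynomial, which has
  lower degree, and to the nodal polynomial, which is zero on all nodes. So \<open>P N\<close> has
  norm zero and vanishes on the nodes.\<close>

lemma P_N: "P N = (\<Prod>j = 1..N. [:- \<mu> j, 1:])"
proof -
  let ?c = "\<Prod>j = 1..N. [:- \<mu> j, 1:]"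
  have c: "coeff ?c N = 1" "\<And>i. i > N \<Longrightarrow> coeff ?c i = 0"
    using monic_prod[of "{1..N}" \<mu>] by auto
  have c0: "poly ?c (\<mu> j) = 0" if "j \<in> {1..N}" for j
    using that by (auto simp: poly_prod)
  have d: "coeff (P N - ?c) i = 0" if "i \<ge> N" for i
    using that c coeff_P[of N] by (cases "i = N") auto
  have "ip (P N) (P N - ?c) = 0"
    by (rule P_orthogonal_lower) (use d in auto)
  moreover have "ip (P N) ?c = 0"
    unfolding node_ip_def by (rule sum.neutral) (use c0 in auto)
  ultimately have "ip (P N) (P N) = 0" by simp
  then have "P N - ?c = 0"
    by (intro zero_on_nodes[OF inj]) (use ip_self_eq_0[of "P N"] c0 d in auto)
  then show ?thesis by simp
qed

text \<open>Pair \<open>P (N - 1)\<close> with the monic polynomial of degree \<open>N - 1\<close>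
  that vanishes at all nodes but \<open>\<mu> j\<close>: orthogonality gives the squared norm, while
  the sum over the nodes has a single term.\<close>

lemma weight_formula:
  assumes j: "j \<in> {1..N}"
  shows "w j * poly (P (N - 1)) (\<mu> j) * (\<Prod>i\<in>{1..N} - {j}. \<mu> j - \<mu> i) = h (N - 1)"
proof -
  let ?c = "\<Prod>i\<in>{1..N} - {j}. [:- \<mu> i, 1:]"
  have c: "coeff ?c (N - 1) = 1" "\<And>i. i > N - 1 \<Longrightarrow> coeff ?c i = 0"
    using monic_prod[of "{1..N} - {j}" \<mu>] j by auto
  have d: "coeff (?c - P (N - 1)) i = 0" if "i \<ge> N - 1" for i
    using that c coeff_P[of "N - 1"] by (cases "i = N - 1") auto
  have "ip (P (N - 1)) (?c - P (N - 1)) = 0"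
    by (rule P_orthogonal_lower) (use d in auto)
  then have "h (N - 1) = ip (P (N - 1)) ?c"
    by (simp add: op_norm_def)
  also have "\<dots> = (\<Sum>i\<in>{j}. w i * poly (P (N - 1)) (\<mu> i) * poly ?c (\<mu> i))"
    unfolding node_ip_def
    by (rule sum.mono_neutral_right) (use j in \<open>auto simp: poly_prod\<close>)
  finally show ?thesis by (simp add: poly_prod)
qed

lemma rho_pos: "0 < i \<Longrightarrow> i < N \<Longrightarrow> \<rho> i > 0"
  using h_pos[of i] h_pos[of "i - 1"] by (simp add: jac_rho_def)

lemma h_eq_prod: "k < N \<Longrightarrow> h k = sum w {1..N} * (\<Prod>i = 1..k. \<rho> i)"
proof (induction k)
  case 0
  then show ?case by (simp add: op_norm_def node_ip_def)
next
  case (Suc k)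
  then show ?case using rho_h[of k] by (simp add: mult_ac)
qed

end

section \<open>Continuous dependence on nodes and weights\<close>

lemma continuous_on_node_ip:
  assumes "\<And>j. j \<in> {1..N} \<Longrightarrow> continuous_on S (\<lambda>u. \<mu> u j)" "\<And>j. j \<in> {1..N} \<Longrightarrow> continuous_on S (\<lambda>u. w u j)"
    and "\<And>j. j \<in> {1..N} \<Longrightarrow> continuous_on S (\<lambda>u. poly (p u) (\<mu> u j))"
    and "\<And>j. j \<in> {1..N} \<Longrightarrow> continuous_on S (\<lambda>u. poly (q u) (\<mu> u j))"
  shows "continuous_on S (\<lambda>u. node_ip (\<mu> u) (w u) N (p u) (q u))"
  unfolding node_ip_def by (intro continuous_intros assms)

text \<open>The evaluation point \<open>x\<close> may vary with \<open>u\<close>, since the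
  coefficients of the next polynomial contain values of the earlier ones at the moving
  nodes.\<close>

lemma continuous_on_opoly:
  assumes \<mu>: "\<And>j. j \<in> {1..N} \<Longrightarrow> continuous_on S (\<lambda>u. \<mu> u j)" and w: "\<And>j. j \<in> {1..N} \<Longrightarrow> continuous_on S (\<lambda>u. w u j)"
    and nw: "\<And>u. u \<in> S \<Longrightarrow> node_weights (\<mu> u) (w u) N"
    and k: "k \<le> N" and x: "continuous_on S x"
  shows "continuous_on S (\<lambda>u. poly (opoly (\<mu> u) (w u) N k) (x u))"
  using k x
proof (induction k arbitrary: x rule: less_induct)
  case (less k)
  have ip: "continuous_on S (\<lambda>u. node_ip (\<mu> u) (w u) N (opoly (\<mu> u) (w u) N i) (opoly (\<mu> u) (w u) N i))"
      and ip': "continuous_on S (\<lambda>u. node_ip (\<mu> u) (w u) N ([:0, 1:] * opoly (\<mu> u) (w u) N i) (opoly (\<mu> u) (w u) N i))"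
    if "i < k" for i
    using that less.prems \<mu> w less.IH[of i] by (auto intro!: continuous_on_node_ip continuous_intros)
  have nz: "node_ip (\<mu> u) (w u) N (opoly (\<mu> u) (w u) N i) (opoly (\<mu> u) (w u) N i) \<noteq> 0" if "i < k" "u \<in> S" for i u
    using node_weights.h_pos[OF nw[OF that(2)], of i] less.prems that by (simp add: op_norm_def)
  consider "k = 0" | "k = Suc 0" | j where "k = Suc (Suc j)"
    by (cases k; cases "k - 1") auto
  then show ?case
  proof cases
    case 2
    then show ?thesis
      using ip[of 0] ip'[of 0] nz[of 0] less.prems by (auto intro!: continuous_intros simp: one_pCons)
  next
    case 3
    have "continuous_on S (\<lambda>u. poly (opoly (\<mu> u) (w u) N (Suc j)) (x u))" "continuous_on S (\<lambda>u. poly (opoly (\<mu> u) (w u) N j) (x u))"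
      using less.IH[of "Suc j"] less.IH[of j] less.prems 3 by simp_all
    then show ?thesis
      using ip[of j] ip[of "Suc j"] ip'[of "Suc j"] nz[of j] nz[of "Suc j"] less.prems(2) 3
      by (auto intro!: continuous_intros simp: Let_def)
  qed simp
qed

lemma continuous_on_jac:
  assumes \<mu>: "\<And>j. j \<in> {1..N} \<Longrightarrow> continuous_on S (\<lambda>u. \<mu> u j)" and w: "\<And>j. j \<in> {1..N} \<Longrightarrow> continuous_on S (\<lambda>u. w u j)"
    and nw: "\<And>u. u \<in> S \<Longrightarrow> node_weights (\<mu> u) (w u) N"
  shows "i \<in> {1..N} \<Longrightarrow> continuous_on S (\<lambda>u. jac_a (\<mu> u) (w u) N i)"
    and "0 < i \<Longrightarrow> i < N \<Longrightarrow> continuous_on S (\<lambda>u. jac_rho (\<mu> u) (w u) N i)"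
proof -
  have op: "continuous_on S (\<lambda>u. poly (opoly (\<mu> u) (w u) N k) (\<mu> u j))" if "k \<le> N" "j \<in> {1..N}" for k j
    using continuous_on_opoly[where \<mu>=\<mu> and w=w and S=S and N=N and k=k] assms that by blast
  have h: "continuous_on S (\<lambda>u. op_norm (\<mu> u) (w u) N k)" if "k < N" for k
    unfolding op_norm_def using that by (intro continuous_on_node_ip assms op) auto
  have nz: "op_norm (\<mu> u) (w u) N k \<noteq> 0" if "k < N" "u \<in> S" for k u
    using node_weights.h_pos[OF nw[OF that(2)] that(1)] by simp
  show "continuous_on S (\<lambda>u. jac_a (\<mu> u) (w u) N i)" if i: "i \<in> {1..N}"
  proof -
    have "continuous_on S (\<lambda>u. node_ip (\<mu> u) (w u) N ([:0, 1:] * opoly (\<mu> u) (w u) N (i - 1)) (opoly (\<mu> u) (w u) N (i - 1)))"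
      using op[of "i - 1"] i \<mu> w by (auto intro!: continuous_on_node_ip continuous_intros)
    then show ?thesis
      unfolding jac_a_def using h[of "i - 1"] nz[of "i - 1"] i by (auto intro!: continuous_intros)
  qed
  show "continuous_on S (\<lambda>u. jac_rho (\<mu> u) (w u) N i)" if "0 < i" "i < N"
    unfolding jac_rho_def using h[of i] h[of "i - 1"] nz[of "i - 1"] that by (auto intro!: continuous_intros)
qed

section \<open>The spectrum of a periodic tridiagonal matrix\<close>

lemma sum_entry_inner:
  assumes "1 < i" "i < n"
  shows "(\<Sum>j = 1..n. periodic_tridiagonal_entry n a b i j * v j)
       = cnj (b (i - 1)) * v (i - 1) + a i * v i + b i * v (Suc i)"
proof -
  have "(\<Sum>j = 1..n. periodic_tridiagonal_entry n a b i j * v j)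
      = (\<Sum>j\<in>{i - 1, i, Suc i}. periodic_tridiagonal_entry n a b i j * v j)"
    using assms by (intro sum.mono_neutral_right) (auto simp: periodic_tridiagonal_entry_def)
  also have "\<dots> = cnj (b (i - 1)) * v (i - 1) + a i * v i + b i * v (Suc i)"
    using assms by (cases i) (auto simp: periodic_tridiagonal_entry_def)
  finally show ?thesis .
qed

lemma sum_entry_first:
  assumes "3 \<le> n"
  shows "(\<Sum>j = 1..n. periodic_tridiagonal_entry n a b 1 j * v j) = a 1 * v 1 + b 1 * v 2 + cnj (b n) * v n"
proof -
  have "(\<Sum>j = 1..n. periodic_tridiagonal_entry n a b 1 j * v j)
      = (\<Sum>j\<in>{1, 2, n}. periodic_tridiagonal_entry n a b 1 j * v j)"
    using assms by (intro sum.mono_neutral_right) (auto simp: periodic_tridiagonal_entry_def)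
  also have "\<dots> = a 1 * v 1 + b 1 * v 2 + cnj (b n) * v n"
    using assms by (auto simp: periodic_tridiagonal_entry_def)
  finally show ?thesis .
qed

lemma sum_entry_last:
  assumes "3 \<le> n"
  shows "(\<Sum>j = 1..n. periodic_tridiagonal_entry n a b n j * v j)
    = b n * v 1 + cnj (b (n - 1)) * v (n - 1) + a n * v n"
proof -
  have "(\<Sum>j = 1..n. periodic_tridiagonal_entry n a b n j * v j)
      = (\<Sum>j\<in>{1, n - 1, n}. periodic_tridiagonal_entry n a b n j * v j)"
    using assms by (intro sum.mono_neutral_right) (auto simp: periodic_tridiagonal_entry_def)
  also have "\<dots> = b n * v 1 + cnj (b (n - 1)) * v (n - 1) + a n * v n"
    using assms by (auto simp: periodic_tridiagonal_entry_def)
  finally show ?thesis .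
qed

lemma entry_hermitian:
  assumes "3 \<le> n"
  shows "periodic_tridiagonal_entry n a b j i = cnj (periodic_tridiagonal_entry n a b i j)"
  using assms by (auto simp: periodic_tridiagonal_entry_def)

lemma periodic_tridiagonal_carrier [simp]: "periodic_tridiagonal n a b \<in> carrier_mat n n"
  by (simp add: periodic_tridiagonal_def)

lemma eigenvalue_periodic_tridiagonal_iff:
  "eigenvalue (periodic_tridiagonal n a b) k \<longleftrightarrow>
     (\<exists>v. (\<exists>i\<in>{1..n}. v i \<noteq> 0) \<and>
       (\<forall>i\<in>{1..n}. (\<Sum>j = 1..n. periodic_tridiagonal_entry n a b i j * v j) = k * v i))"
    (is "?l \<longleftrightarrow> ?r")
proof -
  let ?L = "periodic_tridiagonal n a b"
  have row: "(?L *\<^sub>v x) $ i = (\<Sum>j = 1..n. periodic_tridiagonal_entry n a b (Suc i) j * v j)"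
    if "i < n" "dim_vec x = n" "\<And>j. j < n \<Longrightarrow> x $ j = v (Suc j)" for i x v
  proof -
    have "(?L *\<^sub>v x) $ i = (\<Sum>j<n. periodic_tridiagonal_entry n a b (Suc i) (Suc j) * v (Suc j))"
      using that by (auto simp: periodic_tridiagonal_def scalar_prod_def lessThan_atLeast0 intro!: sum.cong)
    also have "\<dots> = (\<Sum>j = 1..n. periodic_tridiagonal_entry n a b (Suc i) j * v j)"
      by (rule sum.reindex_bij_witness[of _ "\<lambda>j. j - 1" Suc]) auto
    finally show ?thesis .
  qed
  show ?thesis
  proof
    assume ?l
    then obtain x where x: "x \<in> carrier_vec n" "x \<noteq> 0\<^sub>v n" "?L *\<^sub>v x = k \<cdot>\<^sub>v x"
      by (auto simp: eigenvalue_def eigenvector_def periodic_tridiagonal_def)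
    let ?v = "\<lambda>i. x $ (i - 1)"
    obtain j where j: "j < n" "x $ j \<noteq> 0"
      using x(1,2) by (metis carrier_vecD eq_vecI index_zero_vec(1) index_zero_vec(2))
    show ?r
    proof (intro exI[of _ ?v] conjI ballI)
      show "\<exists>i\<in>{1..n}. ?v i \<noteq> 0"
        using j by (intro bexI[of _ "Suc j"]) auto
      fix i assume i: "i \<in> {1..n}"
      have "(\<Sum>j = 1..n. periodic_tridiagonal_entry n a b (Suc (i - 1)) j * ?v j) = (?L *\<^sub>v x) $ (i - 1)"
        using i x by (intro row[symmetric]) auto
      then show "(\<Sum>j = 1..n. periodic_tridiagonal_entry n a b i j * ?v j) = k * ?v i"
        using x i by auto
    qed
  next
    assume ?r
    then obtain v where v: "\<exists>i\<in>{1..n}. v i \<noteq> 0"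
      "\<And>i. i \<in> {1..n} \<Longrightarrow> (\<Sum>j = 1..n. periodic_tridiagonal_entry n a b i j * v j) = k * v i"
      by blast
    define x where "x = vec n (\<lambda>i. v (Suc i))"
    obtain i where i: "i \<in> {1..n}" "v i \<noteq> 0"
      using v(1) by blast
    have "x $ (i - 1) \<noteq> 0\<^sub>v n $ (i - 1)"
      using i by (auto simp: x_def)
    then have "x \<noteq> 0\<^sub>v n" by auto
    moreover have "?L *\<^sub>v x = k \<cdot>\<^sub>v x"
    proof (rule eq_vecI)
      fix j assume "j < dim_vec (k \<cdot>\<^sub>v x)"
      then have j: "j < n" by (simp add: x_def)
      have "(?L *\<^sub>v x) $ j = (\<Sum>l = 1..n. periodic_tridiagonal_entry n a b (Suc j) l * v l)"
        using j by (intro row) (auto simp: x_def)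
      then show "(?L *\<^sub>v x) $ j = (k \<cdot>\<^sub>v x) $ j"
        using v(2)[of "Suc j"] j by (simp add: x_def)
    qed (simp add: x_def periodic_tridiagonal_def)
    ultimately show ?l
      unfolding eigenvalue_def eigenvector_def
      by (intro exI[of _ x]) (simp add: x_def periodic_tridiagonal_def)
  qed
qed

section \<open>Characteristic polynomial and adjugate\<close>

definition sqmod :: "(nat \<Rightarrow> complex) \<Rightarrow> nat \<Rightarrow> real" where
  "sqmod b i = (cmod (b i))\<^sup>2"

lemma mult_cnj_sqmod: "b i * cnj (b i) = complex_of_real (sqmod b i)"
  by (simp add: sqmod_def complex_norm_square[symmetric])

text \<open>
  The characteristic polynomial of \<open>periodic_tridiagonal n a b\<close> (for \<open>n \<ge> 3\<close>), where \<open>\<rho> i = \<bar>b i\<bar>\<^sup>2\<close> and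
  \<open>c\<close> is the real part of \<open>\<Prod>i. b i\<close>.
\<close>
definition percharpoly :: "nat \<Rightarrow> (nat \<Rightarrow> real) \<Rightarrow> (nat \<Rightarrow> real) \<Rightarrow> real \<Rightarrow> real poly" where
  "percharpoly n a \<rho> c = tridet a \<rho> 0 n - smult (\<rho> n) (tridet a \<rho> 1 (n - 2)) - [:2 * c:]"

lemma coeff_percharpoly:
  assumes "2 \<le> n"
  shows "coeff (percharpoly n a \<rho> c) n = 1" "n < i \<Longrightarrow> coeff (percharpoly n a \<rho> c) i = 0"
  using assms by (auto simp: percharpoly_def coeff_tridet coeff_pCons split: nat.splits)

lemma poly_percharpoly:
  assumes "2 \<le> n"
  shows "poly (percharpoly n a \<rho> c) x = (x - a n) * poly (tridet a \<rho> 0 (n - 1)) x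
    - \<rho> (n - 1) * poly (tridet a \<rho> 0 (n - 2)) x - \<rho> n * poly (tridet a \<rho> 1 (n - 2)) x - 2 * c"
proof -
  obtain k where "n = Suc (Suc k)"
    using assms by (metis Suc_diff_Suc Suc_le_eq numeral_2_eq_2 le_Suc_ex add_Suc)
  then show ?thesis
    using poly_tridet_right[of a \<rho> 0 k x] by (simp add: percharpoly_def del: tridet.simps)
qed

context
  fixes n :: nat and a :: "nat \<Rightarrow> real" and b :: "nat \<Rightarrow> complex" and x :: real
  assumes n: "3 \<le> n"
begin

abbreviation (input) "D s k \<equiv> complex_of_real (poly (tridet a (sqmod b) s k) x)"

text \<open>The last column of the adjugate of \<open>x - L\<close>.\<close>
definition adj_col :: "nat \<Rightarrow> complex" where
  "adj_col i = (if i = n then D 0 (n - 1)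
     else b (n - 1) * (\<Prod>l = i..<n - 1. b l) * D 0 (i - 1)
        + cnj (b n) * (\<Prod>l = 1..<i. cnj (b l)) * D i (n - 1 - i))"

private lemma D_right: "D s (Suc (Suc k)) = (x - a (s + k + 2)) * D s (Suc k) - sqmod b (s + k + 1) * D s k"
  by (simp only: poly_tridet_right of_real_mult of_real_diff)

private lemma D_left: "D s (Suc (Suc k)) = (x - a (Suc s)) * D (Suc s) (Suc k) - sqmod b (Suc s) * D (Suc (Suc s)) k"
  by (simp only: poly_tridet_left of_real_mult of_real_diff)

text \<open>The last column of \<open>(x - L) adj (x - L) = det (x - L)\<close>. The two summands of
  \<open>adj_col i\<close> belong to the two ways round the cycle between \<open>i\<close> and
  \<open>n\<close>; \<open>G\<close> and \<open>H\<close> are their products of entries. The first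
  summand satisfies the row equations by the recursion at the last row, the second by that at the
  first row. In row \<open>n\<close> the two full circuits add up to \<open>2 * Re\<close> of the
  product of the entries.\<close>

lemma adj_col_rows:
  assumes i: "i \<in> {1..n}"
  shows "(\<Sum>j = 1..n. periodic_tridiagonal_entry n a b i j * adj_col j)
     = x * adj_col i - (if i = n then complex_of_real (poly (percharpoly n a (sqmod b) (Re (\<Prod>l = 1..n. b l))) x) else 0)"
proof -
  obtain N where N: "n = Suc N" "2 \<le> N"
    using n by (cases n) auto
  define G H where "G i = (\<Prod>l = i..<N. b l)" and "H i = (\<Prod>l = 1..<i. cnj (b l))" for i
  have G: "b i * G (Suc i) = G i" if "i < N" for i
    using that by (simp add: G_def prod.atLeast_Suc_lessThan)
  have H: "cnj (b i) * H i = H (Suc i)" if "1 \<le> i" for i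
    using that by (simp add: H_def)
  have Gb: "cnj (b i) * G i = sqmod b i * G (Suc i)" if "i < N" for i
    using G[OF that] mult_cnj_sqmod[of b i] by (metis mult.assoc mult.commute)
  have Hb: "b i * H (Suc i) = sqmod b i * H i" if "1 \<le> i" for i
    using H[OF that] mult_cnj_sqmod[of b i] by (metis mult.assoc mult.commute)
  have u: "adj_col i = b N * G i * D 0 (i - 1) + cnj (b n) * H i * D i (N - i)" if "i \<le> N" for i
    unfolding adj_col_def using that N by (simp add: G_def H_def)
  have un: "adj_col n = D 0 N"
    unfolding adj_col_def using N by simp
  note [simp del] = tridet.simps
  consider "i = 1" | "1 < i" "i < N" | "i = N" "1 < N" | "i = n"
    using i N by force
  then show ?thesis
  proof cases
    case 1
    obtain m where m: "N = Suc (Suc m)"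
      using N by (metis Suc_diff_Suc Suc_le_eq numeral_2_eq_2 le_Suc_ex add_Suc)
    have D1: "D 0 1 = x - a 1" by (simp add: tridet.simps)
    have DN: "D 0 N = (x - a 1) * D 1 (N - 1) - sqmod b 1 * D 2 (N - 2)"
      using D_left[of 0 m] m by (simp add: numeral_2_eq_2)
    have G1: "b 1 * G 2 = G 1" and H2: "b 1 * H 2 = sqmod b 1 * H 1"
      using G[of 1] Hb[of 1] N by (simp_all add: numeral_2_eq_2)
    have H1: "H 1 = 1" by (simp add: H_def)
    have "a 1 * adj_col 1 + b 1 * adj_col 2 + cnj (b n) * adj_col n
       = b N * (a 1 * G 1 + (b 1 * G 2) * D 0 1) + cnj (b n) * (a 1 * H 1 * D 1 (N - 1) + (b 1 * H 2) * D 2 (N - 2) + D 0 N)"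
      using u[of 1] u[of 2] N unfolding un by (simp add: algebra_simps tridet.simps(1))
    also have "\<dots> = x * (b N * G 1 + cnj (b n) * H 1 * D 1 (N - 1))"
      unfolding G1 H2 D1 DN H1 by (simp add: algebra_simps)
    also have "\<dots> = x * adj_col 1"
      using u[of 1] N by (simp add: tridet.simps(1))
    finally show ?thesis
      using 1 n sum_entry_first[OF n, of a b adj_col] by simp
  next
    case 2
    obtain m where m: "i = Suc (Suc m)"
      using 2 by (metis Suc_diff_Suc Suc_le_eq less_iff_Suc_add One_nat_def add_Suc)
    obtain r where r: "N = i + Suc r"
      using 2 by (metis less_iff_Suc_add add_Suc_right)
    have Di: "D 0 i = (x - a i) * D 0 (i - 1) - sqmod b (i - 1) * D 0 (i - 2)"
      using D_right[of 0 m] m by simp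
    have Di': "D (i - 1) (N - (i - 1)) = (x - a i) * D i (N - i) - sqmod b i * D (Suc i) (N - Suc i)"
      using D_left[of "i - 1" r] m r by (simp add: Suc_diff_le)
    have g: "cnj (b (i - 1)) * G (i - 1) = sqmod b (i - 1) * G i" "b i * G (Suc i) = G i"
      "cnj (b (i - 1)) * H (i - 1) = H i" "b i * H (Suc i) = sqmod b i * H i"
      using Gb[of "i - 1"] G[of i] H[of "i - 1"] Hb[of i] 2 by auto
    have "cnj (b (i - 1)) * adj_col (i - 1) + a i * adj_col i + b i * adj_col (Suc i)
      = b N * ((cnj (b (i - 1)) * G (i - 1)) * D 0 (i - 2) + a i * G i * D 0 (i - 1) + (b i * G (Suc i)) * D 0 i)
      + cnj (b n) * ((cnj (b (i - 1)) * H (i - 1)) * D (i - 1) (N - (i - 1)) + a i * H i * D i (N - i)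
          + (b i * H (Suc i)) * D (Suc i) (N - Suc i))"
      using u[of "i - 1"] u[of i] u[of "Suc i"] 2 by (simp add: algebra_simps numeral_2_eq_2)
    also have "\<dots> = x * (b N * G i * D 0 (i - 1) + cnj (b n) * H i * D i (N - i))"
      unfolding g Di Di' by (simp add: algebra_simps)
    also have "\<dots> = x * adj_col i"
      using u[of i] 2 by simp
    finally show ?thesis
      using 2 N sum_entry_inner[of i n a b adj_col] by simp
  next
    case 3
    obtain m where m: "N = Suc (Suc m)"
      using N by (metis Suc_diff_Suc Suc_le_eq numeral_2_eq_2 le_Suc_ex add_Suc)
    have DN: "D 0 N = (x - a N) * D 0 (N - 1) - sqmod b (N - 1) * D 0 (N - 2)"
      using D_right[of 0 m] m by simp
    have D1: "D (N - 1) (N - (N - 1)) = x - a N"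
      using m by (simp add: tridet.simps)
    have GN: "G N = 1" by (simp add: G_def)
    have g: "cnj (b (N - 1)) * G (N - 1) = sqmod b (N - 1) * G N" "cnj (b (N - 1)) * H (N - 1) = H N"
      using Gb[of "N - 1"] H[of "N - 1"] 3 by auto
    have "cnj (b (N - 1)) * adj_col (N - 1) + a N * adj_col N + b N * adj_col n
      = b N * ((cnj (b (N - 1)) * G (N - 1)) * D 0 (N - 2) + a N * G N * D 0 (N - 1) + D 0 N)
      + cnj (b n) * ((cnj (b (N - 1)) * H (N - 1)) * D (N - 1) (N - (N - 1)) + a N * H N)"
      using u[of "N - 1"] u[of N] unfolding un by (simp add: algebra_simps numeral_2_eq_2 tridet.simps(1))
    also have "\<dots> = x * (b N * G N * D 0 (N - 1) + cnj (b n) * H N)"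
      unfolding g DN D1 GN by (simp add: algebra_simps)
    also have "\<dots> = x * adj_col N"
      using u[of N] by (simp add: tridet.simps(1))
    finally show ?thesis
      using 3 N sum_entry_inner[of i n a b adj_col] by simp
  next
    case 4
    have G1: "b N * G 1 * b n = (\<Prod>l = 1..n. b l)"
    proof -
      have "(\<Prod>l = 1..n. b l) = (\<Prod>l = 1..<n. b l) * b n"
        using N by (simp add: atLeastLessThanSuc_atLeastAtMost)
      also have "(\<Prod>l = 1..<n. b l) = (\<Prod>l = 1..<N. b l) * b N"
        using N by simp
      finally show ?thesis by (simp add: G_def)
    qed
    have HN: "cnj (b N) * cnj (b n) * H N = cnj (\<Prod>l = 1..n. b l)"
      using arg_cong[OF G1, of cnj] by (simp add: G_def H_def mult_ac)
    have re: "(\<Prod>l = 1..n. b l) + cnj (\<Prod>l = 1..n. b l) = 2 * Re (\<Prod>l = 1..n. b l)"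
      by (rule complex_add_cnj)
    have "b n * adj_col 1 + cnj (b N) * adj_col N + a n * adj_col n
      = b N * G 1 * b n + (b n * cnj (b n)) * D 1 (N - 1) + (b N * cnj (b N)) * D 0 (N - 1)
        + cnj (b N) * cnj (b n) * H N + a n * D 0 N"
      using u[of 1] u[of N] N unfolding un by (simp add: algebra_simps tridet.simps(1) G_def H_def)
    also have "\<dots> = 2 * Re (\<Prod>l = 1..n. b l) + sqmod b n * D 1 (N - 1) + sqmod b N * D 0 (N - 1) + a n * D 0 N"
      unfolding G1 HN mult_cnj_sqmod re[symmetric] by simp
    also have "\<dots> = x * adj_col n - complex_of_real (poly (percharpoly n a (sqmod b) (Re (\<Prod>l = 1..n. b l))) x)"
      unfolding un using N by (simp add: poly_percharpoly algebra_simps numeral_2_eq_2)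
    finally show ?thesis
      using 4 N sum_entry_last[OF n, of a b adj_col] by simp
  qed
qed

lemma percharpoly_root_imp_eigenvalue:
  assumes "poly (percharpoly n a (sqmod b) (Re (\<Prod>l = 1..n. b l))) x = 0"
    and "poly (tridet a (sqmod b) 0 (n - 1)) x \<noteq> 0"
  shows "eigenvalue (periodic_tridiagonal n a b) (complex_of_real x)"
  unfolding eigenvalue_periodic_tridiagonal_iff
proof (intro exI[of _ adj_col] conjI ballI)
  show "\<exists>i\<in>{1..n}. adj_col i \<noteq> 0"
    using assms(2) n by (intro bexI[of _ n]) (auto simp: adj_col_def)
qed (use adj_col_rows assms(1) in auto)

text \<open>Pairing the rows of \<open>adj_col\<close> with an eigenvector \<open>v\<close> and
  using that the matrix is Hermitian leaves \<open>cnj (v n)\<close> times the characteristic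
  polynomial. If \<open>v n\<close> were zero, the remaining entries would solve the recursion of
  \<open>tridet\<close>, and the nonzero determinant of size \<open>n - 1\<close> would make
  \<open>v\<close> vanish.\<close>

lemma eigenvalue_imp_percharpoly_root:
  assumes ev: "eigenvalue (periodic_tridiagonal n a b) (complex_of_real x)"
    and D: "poly (tridet a (sqmod b) 0 (n - 1)) x \<noteq> 0" and b: "\<And>i. i \<in> {1..<n} \<Longrightarrow> b i \<noteq> 0"
  shows "poly (percharpoly n a (sqmod b) (Re (\<Prod>l = 1..n. b l))) x = 0"
proof -
  obtain v :: "nat \<Rightarrow> complex" where v: "\<exists>i\<in>{1..n}. v i \<noteq> 0"
    and rows: "\<And>i. i \<in> {1..n} \<Longrightarrow> (\<Sum>j = 1..n. periodic_tridiagonal_entry n a b i j * v j) = x * v i"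
    using ev unfolding eigenvalue_periodic_tridiagonal_iff by blast
  let ?Q = "complex_of_real (poly (percharpoly n a (sqmod b) (Re (\<Prod>l = 1..n. b l))) x)"
  obtain N where N: "n = Suc N" "2 \<le> N"
    using n by (cases n) auto
  have vn: "v n \<noteq> 0"
  proof
    assume vn: "v n = 0"
    \<comment> \<open>The factor clears the entries of \<open>b\<close> from the row equations, so
      that only squared moduli remain and the recursion is that of \<open>tridet\<close>.\<close>
    define w where "w i = (\<Prod>l = 1..<i. b l) * v i" for i
    have b': "b i * cnj (b i) = sqmod b i" for i
      by (rule mult_cnj_sqmod)
    have first: "w 2 = (x - a 1) * w 1"
    proof -
      have "a 1 * v 1 + b 1 * v 2 = x * v 1"
        using rows[of 1] sum_entry_first[OF n, of a b v] n vn by simp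
      then have "b 1 * v 2 = (x - a 1) * v 1"
        by (simp add: algebra_simps eq_diff_eq)
      moreover have "{1..<2} = {1::nat}" by auto
      ultimately show ?thesis by (simp add: w_def)
    qed
    have inner: "w (Suc (Suc (Suc k))) = (x - a (k + 2)) * w (Suc (Suc k)) - sqmod b (Suc k) * w (Suc k)" if "k + 2 < n" for k
    proof -
      let ?i = "Suc (Suc k)"
      have "cnj (b (Suc k)) * v (Suc k) + a ?i * v ?i + b ?i * v (Suc ?i) = x * v ?i"
        using rows[of ?i] sum_entry_inner[of ?i n a b v] that by simp
      then have "b ?i * v (Suc ?i) = x * v ?i - a ?i * v ?i - cnj (b (Suc k)) * v (Suc k)"
        by (simp add: algebra_simps)
      then have "w (Suc ?i) = (\<Prod>l = 1..<?i. b l) * (x * v ?i - a ?i * v ?i - cnj (b (Suc k)) * v (Suc k))"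
        by (simp add: w_def mult.assoc)
      also have "\<dots> = (x - a ?i) * w ?i - (b (Suc k) * cnj (b (Suc k))) * w (Suc k)"
        by (simp add: w_def algebra_simps)
      finally show ?thesis unfolding b' by simp
    qed
    have wD': "k + 1 < n \<longrightarrow> w (Suc k) = D 0 k * w 1 \<and> w (Suc (Suc k)) = D 0 (Suc k) * w 1" for k
    proof (induction k)
      case 0
      then show ?case using first by (simp add: numeral_2_eq_2)
    next
      case (Suc k)
      show ?case
      proof
        assume k: "Suc k + 1 < n"
        then have IH: "w (Suc k) = D 0 k * w 1" "w (Suc (Suc k)) = D 0 (Suc k) * w 1"
          using Suc by auto
        have "w (Suc (Suc (Suc k))) = D 0 (Suc (Suc k)) * w 1"
          using inner[of k] k D_right[of 0 k] unfolding IH by (simp add: left_diff_distrib mult.assoc del: tridet.simps)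
        with IH show "w (Suc (Suc k)) = D 0 (Suc k) * w 1 \<and> w (Suc (Suc (Suc k))) = D 0 (Suc (Suc k)) * w 1"
          by blast
      qed
    qed
    have wD: "w (Suc k) = D 0 k * w 1" if "k + 1 < n" for k
      using wD'[of k] that by blast
    have "w n = D 0 (n - 1) * w 1"
      using wD'[of "N - 1"] N by simp
    moreover have "w n = 0"
      using vn by (simp add: w_def)
    ultimately have "w 1 = 0"
      using D by simp
    then have "w i = 0" if "i \<in> {1..<n}" for i
      using wD[of "i - 1"] that by simp
    then have "v i = 0" if "i \<in> {1..<n}" for i
      using that b unfolding w_def by (auto simp: prod_zero_iff)
    then show False
      using v vn by (metis atLeastAtMost_iff atLeastLessThan_iff le_neq_implies_less)
  qed
  let ?e = "periodic_tridiagonal_entry n a b"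
  have "(\<Sum>i = 1..n. cnj (v i) * (\<Sum>j = 1..n. ?e i j * adj_col j)) = (\<Sum>i = 1..n. \<Sum>j = 1..n. cnj (v i) * (?e i j * adj_col j))"
    by (simp only: sum_distrib_left)
  also have "\<dots> = (\<Sum>j = 1..n. \<Sum>i = 1..n. cnj (v i) * (?e i j * adj_col j))"
    by (rule sum.swap)
  also have "\<dots> = (\<Sum>j = 1..n. adj_col j * cnj (\<Sum>i = 1..n. ?e j i * v i))"
    by (intro sum.cong refl) (simp only: cnj_sum sum_distrib_left complex_cnj_mult entry_hermitian[OF n, symmetric] mult_ac)
  also have "\<dots> = (\<Sum>j = 1..n. adj_col j * cnj (x * v j))"
    using rows by (intro sum.cong refl) simp
  finally have "(\<Sum>j = 1..n. adj_col j * cnj (x * v j)) = (\<Sum>i = 1..n. cnj (v i) * (\<Sum>j = 1..n. ?e i j * adj_col j))"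
    by simp
  also have "\<dots> = (\<Sum>i = 1..n. cnj (v i) * (x * adj_col i - (if i = n then ?Q else 0)))"
    using adj_col_rows by (intro sum.cong refl) simp
  also have "\<dots> = (\<Sum>i = 1..n. cnj (v i) * (x * adj_col i)) - (\<Sum>i = 1..n. cnj (v i) * (if i = n then ?Q else 0))"
    by (simp only: right_diff_distrib sum_subtractf)
  also have "(\<Sum>i = 1..n. cnj (v i) * (x * adj_col i)) = (\<Sum>i = 1..n. adj_col i * cnj (x * v i))"
    by (intro sum.cong refl) simp
  also have "(\<Sum>i = 1..n. cnj (v i) * (if i = n then ?Q else 0)) = (\<Sum>i = 1..n. if i = n then cnj (v i) * ?Q else 0)"
    by (intro sum.cong refl) simp
  also have "\<dots> = cnj (v n) * ?Q"
    using n by (subst sum.delta) auto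
  finally have "cnj (v n) * ?Q = 0"
    by simp
  then show ?thesis
    using vn by simp
qed

end

text \<open>Each \<open>lam i\<close> is an eigenvalue by the adjugate column, and \<open>n\<close>
  distinct ones exhaust the spectrum.\<close>

lemma spectrum_periodic_tridiagonal:
  fixes lam :: "nat \<Rightarrow> real"
  assumes n: "3 \<le> n" and inj: "inj_on lam {1..n}"
    and Q: "percharpoly n a (sqmod b) (Re (\<Prod>l = 1..n. b l)) = (\<Prod>i = 1..n. [:- lam i, 1:])"
    and D: "\<And>i. i \<in> {1..n} \<Longrightarrow> poly (tridet a (sqmod b) 0 (n - 1)) (lam i) \<noteq> 0"
  shows "spectrum (periodic_tridiagonal n a b) = (\<lambda>i. complex_of_real (lam i)) ` {1..n}"
proof -
  let ?L = "periodic_tridiagonal n a b" and ?S = "(\<lambda>i. complex_of_real (lam i)) ` {1..n}"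
  have "?S \<subseteq> spectrum ?L"
  proof
    fix z assume "z \<in> ?S"
    then obtain i where i: "i \<in> {1..n}" "z = complex_of_real (lam i)" by blast
    then have "eigenvalue ?L (complex_of_real (lam i))"
      unfolding i(2) by (intro percharpoly_root_imp_eigenvalue n D) (auto simp: Q[unfolded One_nat_def] poly_prod)
    then show "z \<in> spectrum ?L"
      using i by (simp add: spectrum_def)
  qed
  moreover have "inj_on (\<lambda>i. complex_of_real (lam i)) {1..n}"
    using inj by (intro inj_onI) (metis inj_onD of_real_eq_iff)
  then have "card ?S = n"
    by (simp add: card_image)
  ultimately show ?thesis
    using card_finite_spectrum[OF periodic_tridiagonal_carrier] card_seteq by metis
qed

lemma percharpoly_eq_prod:
  fixes lam :: "nat \<Rightarrow> real"
  assumes n: "3 \<le> n" and inj: "inj_on lam {1..n}"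
    and spec: "spectrum (periodic_tridiagonal n a b) = (\<lambda>i. complex_of_real (lam i)) ` {1..n}"
    and D: "\<And>i. i \<in> {1..n} \<Longrightarrow> poly (tridet a (sqmod b) 0 (n - 1)) (lam i) \<noteq> 0"
    and b: "\<And>i. i \<in> {1..<n} \<Longrightarrow> b i \<noteq> 0"
  shows "percharpoly n a (sqmod b) (Re (\<Prod>l = 1..n. b l)) = (\<Prod>i = 1..n. [:- lam i, 1:])"
    (is "?Q = ?F")
proof -
  have F: "coeff ?F n = 1" "\<And>i. i > n \<Longrightarrow> coeff ?F i = 0"
    using monic_prod[of "{1..n}" lam] by auto
  have "?Q - ?F = 0"
  proof (rule zero_on_nodes[OF inj])
    fix j assume j: "j \<in> {1..n}"
    then have "eigenvalue (periodic_tridiagonal n a b) (complex_of_real (lam j))"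
      using spec unfolding spectrum_def by blast
    then have "poly ?Q (lam j) = 0"
      by (intro eigenvalue_imp_percharpoly_root n D b j)
    then show "poly (?Q - ?F) (lam j) = 0"
      using j by (auto simp: poly_prod)
  next
    fix i assume "n \<le> i"
    then show "coeff (?Q - ?F) i = 0"
      using coeff_percharpoly[of n] F n by (cases "i = n") auto
  qed
  then show ?thesis by simp
qed

section \<open>The topology of the isospectral space\<close>

lemma topspace_matrix_topology [simp]: "topspace (matrix_topology n) = carrier_mat n n"
  by (auto simp: matrix_topology_def topspace_pullback_topology)

lemma continuous_map_into_matrix_topology:
  assumes "\<And>x. x \<in> topspace Z \<Longrightarrow> f x \<in> carrier_mat n n"
    and "\<And>i j. i < n \<Longrightarrow> j < n \<Longrightarrow> continuous_map Z euclidean (\<lambda>x. f x $$ (i, j))"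
  shows "continuous_map Z (matrix_topology n) f"
  unfolding matrix_topology_def
proof (rule continuous_map_pullback')
  have "continuous_map Z (product_topology (\<lambda>_. euclidean) ({..<n} \<times> {..<n}))
      (\<lambda>x. \<lambda>ij\<in>{..<n} \<times> {..<n}. f x $$ ij)"
    using assms(2) by (subst continuous_map_componentwise) auto
  then show "continuous_map Z (product_topology (\<lambda>_. euclidean) ({..<n} \<times> {..<n}))
      ((\<lambda>A. \<lambda>ij\<in>{..<n} \<times> {..<n}. A $$ ij) \<circ> f)"
    by (simp add: o_def)
  show "topspace Z \<subseteq> f -` carrier_mat n n"
    using assms(1) by auto
qed

lemma continuous_map_matrix_entry:
  assumes "i < n" "j < n"
  shows "continuous_map (matrix_topology n) euclidean (\<lambda>A. A $$ (i, j))"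
proof -
  have "continuous_map (product_topology (\<lambda>_. euclidean) ({..<n} \<times> {..<n})) euclidean (\<lambda>x. x (i, j) :: complex)"
    using assms by (intro continuous_map_product_projection) auto
  from continuous_map_pullback[OF this, of "carrier_mat n n" "\<lambda>A. \<lambda>ij\<in>{..<n} \<times> {..<n}. A $$ ij"]
  show ?thesis
    using assms by (simp add: matrix_topology_def o_def)
qed

lemma topspace_isospectral:
  "topspace (isospectral_space n lam) =
     {L. (\<exists>a b. L = periodic_tridiagonal n a b) \<and> spectrum L = (\<lambda>i. complex_of_real (lam i)) ` {1..n}}"
  by (auto simp: isospectral_space_def)

lemma closedin_isospectral_singleton:
  assumes "L \<in> topspace (isospectral_space n lam)" "n > 0"
  shows "closedin (isospectral_space n lam) {L}"
proof -
  let ?X = "isospectral_space n lam"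
  let ?C = "\<lambda>ij. {A \<in> topspace ?X. A $$ ij \<in> {L $$ ij}}"
  have carr: "A \<in> carrier_mat n n" if "A \<in> topspace ?X" for A
    using that by (auto simp: topspace_isospectral)
  have "closedin ?X (\<Inter>ij\<in>{..<n} \<times> {..<n}. ?C ij)"
  proof (rule closedin_Inter)
    fix S assume "S \<in> ?C ` ({..<n} \<times> {..<n})"
    then obtain i j where ij: "i < n" "j < n" "S = ?C (i, j)" by auto
    have "continuous_map ?X euclidean (\<lambda>A. A $$ (i, j))"
      using ij unfolding isospectral_space_def
      by (intro continuous_map_from_subtopology continuous_map_matrix_entry)
    then show "closedin ?X S"
      unfolding ij by (rule closedin_continuous_map_preimage) auto
  qed (use assms(2) in auto)
  also have "(\<Inter>ij\<in>{..<n} \<times> {..<n}. ?C ij) = {L}"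
  proof
    show "(\<Inter>ij\<in>{..<n} \<times> {..<n}. ?C ij) \<subseteq> {L}"
    proof
      fix A assume A: "A \<in> (\<Inter>ij\<in>{..<n} \<times> {..<n}. ?C ij)"
      then have "A \<in> topspace ?X" "\<And>i j. i < n \<Longrightarrow> j < n \<Longrightarrow> A $$ (i, j) = L $$ (i, j)"
        using assms(2) by auto
      then show "A \<in> {L}"
        using carr[of A] carr[OF assms(1)] by auto
    qed
  qed (use assms in auto)
  finally show ?thesis .
qed

section \<open>Critical points of the characteristic polynomial\<close>

locale simple_spectrum =
  fixes n :: nat and lam :: "nat \<Rightarrow> real"
  assumes n: "n \<ge> 3" and mono: "strict_mono_on {1..n} lam"
begin

text \<open>The sign of \<open>F\<close> on \<open>gap j\<close>, where exactly the last
  \<open>n - j\<close> factors are negative.\<close>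

definition gap_sign :: "nat \<Rightarrow> real" where
  "gap_sign j = (-1) ^ (n - j)"

definition gap :: "nat \<Rightarrow> real set" where
  "gap j = {lam j<..<lam (Suc j)}"

abbreviation "F \<equiv> F_poly n lam"

definition Fp :: "real poly" where
  "Fp = (\<Prod>i = 1..n. [:- lam i, 1:])"

lemma poly_Fp [simp]: "poly Fp x = F x"
  by (simp add: Fp_def F_poly_def poly_prod)

lemma lam_less: "i \<in> {1..n} \<Longrightarrow> j \<in> {1..n} \<Longrightarrow> i < j \<Longrightarrow> lam i < lam j"
  using mono by (auto simp: strict_mono_on_def)

lemma lam_le: "i \<in> {1..n} \<Longrightarrow> j \<in> {1..n} \<Longrightarrow> i \<le> j \<Longrightarrow> lam i \<le> lam j"
  using lam_less[of i j] by (cases "i = j") auto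

lemma inj_lam: "inj_on lam {1..n}"
  using mono strict_mono_on_imp_inj_on by blast

lemma gap_sign_cases: "gap_sign j = 1 \<or> gap_sign j = -1"
  by (simp add: gap_sign_def minus_one_power_iff)

lemma gap_sign_sq [simp]: "gap_sign j * gap_sign j = 1"
  using gap_sign_cases[of j] by auto

lemma gap_above:
  assumes "y \<in> gap j" "i \<le> j" "i \<in> {1..n}" "j < n"
  shows "lam i < y"
  using lam_le[of i j] assms by (auto simp: gap_def)

lemma gap_below:
  assumes "y \<in> gap j" "j < i" "i \<in> {1..n}" "1 \<le> j"
  shows "y < lam i"
  using lam_le[of "Suc j" i] assms by (auto simp: gap_def)

lemma gap_disjoint:
  assumes "x \<in> gap i" "y \<in> gap j" "i < j" "1 \<le> i" "j < n"
  shows "x < y"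
proof -
  have "x < lam j"
    using gap_below[OF assms(1), of j] assms by auto
  also have "lam j < y"
    using assms(2) by (simp add: gap_def)
  finally show ?thesis .
qed

lemma prod_sign:
  fixes f :: "nat \<Rightarrow> real"
  assumes "finite S" "finite T" "S \<inter> T = {}" "\<And>i. i \<in> S \<Longrightarrow> f i > 0" "\<And>i. i \<in> T \<Longrightarrow> f i < 0"
  shows "(-1) ^ card T * (\<Prod>i\<in>S \<union> T. f i) > 0"
proof -
  have "(\<Prod>i\<in>T. - f i) = (-1) ^ card T * (\<Prod>i\<in>T. f i)"
    using assms(2) by (simp add: prod_uminus)
  then have "(-1) ^ card T * (\<Prod>i\<in>S \<union> T. f i) = (\<Prod>i\<in>S. f i) * (\<Prod>i\<in>T. - f i)"
    using assms by (simp add: prod.union_disjoint mult_ac)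
  also have "\<dots> > 0"
    using assms by (intro mult_pos_pos prod_pos) auto
  finally show ?thesis .
qed

lemma F_sign:
  assumes "y \<in> gap j" "j \<in> {1..<n}"
  shows "gap_sign j * F y > 0"
proof -
  have "(-1) ^ card {Suc j..n} * (\<Prod>i\<in>{1..j} \<union> {Suc j..n}. y - lam i) > 0"
    using assms gap_above[OF assms(1)] gap_below[OF assms(1)] by (intro prod_sign) auto
  moreover have "{1..j} \<union> {Suc j..n} = {1..n}"
    using assms(2) by auto
  ultimately show ?thesis
    by (simp add: gap_sign_def F_poly_def)
qed

lemma F_lam: "i \<in> {1..n} \<Longrightarrow> F (lam i) = 0"
  by (auto simp: F_poly_def)

lemma continuous_on_F [continuous_intros]: "continuous_on S g \<Longrightarrow> continuous_on S (\<lambda>u. F (g u))"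
  by (simp flip: poly_Fp add: continuous_on_poly)

section \<open>One critical point in each gap\<close>

lemma gap_maximizer:
  assumes j: "j \<in> {1..<n}"
  shows "\<exists>x\<in>gap j. \<forall>y\<in>gap j. gap_sign j * F y \<le> gap_sign j * F x"
proof -
  let ?I = "{lam j..lam (Suc j)}"
  have less: "lam j < lam (Suc j)"
    using j by (intro lam_less) auto
  have "compact ?I" "?I \<noteq> {}" "continuous_on ?I (\<lambda>y. gap_sign j * F y)"
    using less by (auto intro!: continuous_intros)
  then obtain x where x: "x \<in> ?I" "\<And>y. y \<in> ?I \<Longrightarrow> gap_sign j * F y \<le> gap_sign j * F x"
    by (metis continuous_attains_sup)
  define m where "m = (lam j + lam (Suc j)) / 2"
  have m: "m \<in> gap j" "m \<in> ?I"
    using less by (auto simp: m_def gap_def)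
  have "0 < gap_sign j * F x"
    using F_sign[OF m(1) j] x(2)[OF m(2)] by simp
  then have "x \<noteq> lam j" "x \<noteq> lam (Suc j)"
    using F_lam[of j] F_lam[of "Suc j"] j by auto
  then have "x \<in> gap j"
    using x(1) by (auto simp: gap_def)
  then show ?thesis
    using x(2) by (intro bexI[of _ x]) (auto simp: gap_def)
qed

definition gap_crit :: "nat \<Rightarrow> real" where
  "gap_crit j = (SOME x. x \<in> gap j \<and> (\<forall>y\<in>gap j. gap_sign j * F y \<le> gap_sign j * F x))"

lemma gap_crit:
  assumes "j \<in> {1..<n}"
  shows "gap_crit j \<in> gap j" "y \<in> gap j \<Longrightarrow> gap_sign j * F y \<le> gap_sign j * F (gap_crit j)"
  using someI_ex[of "\<lambda>x. x \<in> gap j \<and> (\<forall>y\<in>gap j. gap_sign j * F y \<le> gap_sign j * F x)"]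
    gap_maximizer[OF assms] unfolding gap_crit_def by blast+

lemma F_deriv: "(F has_real_derivative poly (pderiv Fp) x) (at x)"
  using poly_DERIV[of Fp x] by simp

lemma local_max_deriv:
  assumes "eventually (\<lambda>y. c * F y \<le> c * F x) (nhds x)" "c \<noteq> 0"
  shows "poly (pderiv Fp) x = 0"
proof -
  obtain d where d: "d > 0" "\<And>y. dist y x < d \<Longrightarrow> c * F y \<le> c * F x"
    using assms(1) by (auto simp: eventually_nhds_metric)
  have "((\<lambda>y. c * F y) has_real_derivative c * poly (pderiv Fp) x) (at x)"
    using F_deriv by (rule DERIV_cmult)
  from DERIV_local_max[OF this d(1)] show ?thesis
    using d(2) assms(2) by (auto simp: dist_real_def abs_minus_commute)
qed

lemma gap_max_deriv:
  assumes "j \<in> {1..<n}" "x \<in> gap j" "\<And>y. y \<in> gap j \<Longrightarrow> gap_sign j * F y \<le> gap_sign j * F x"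
  shows "poly (pderiv Fp) x = 0"
proof (rule local_max_deriv)
  have "open (gap j)" by (simp add: gap_def)
  then have "eventually (\<lambda>y. y \<in> gap j) (nhds x)"
    using assms(2) by (rule eventually_nhds_in_open)
  then show "eventually (\<lambda>y. gap_sign j * F y \<le> gap_sign j * F x) (nhds x)"
    by eventually_elim (rule assms(3))
qed (use gap_sign_cases[of j] in auto)

lemma crit_less: "i \<in> {1..<n} \<Longrightarrow> j \<in> {1..<n} \<Longrightarrow> i < j \<Longrightarrow> gap_crit i < gap_crit j"
  using gap_disjoint[OF gap_crit(1) gap_crit(1), of i j] by auto

lemma inj_crit: "inj_on gap_crit {1..<n}"
  using crit_less by (intro linorder_inj_onI) (auto, metis order_less_irrefl)

text \<open>The derivative has degree \<open>n - 1\<close>, and each of the \<open>n - 1\<close>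
  disjoint gaps already contributes a root.\<close>

lemma crit_set: "{x. (F has_real_derivative 0) (at x)} = gap_crit ` {1..<n}"
proof -
  have eq: "{x. (F has_real_derivative 0) (at x)} = {x. poly (pderiv Fp) x = 0}"
    using F_deriv DERIV_unique by (metis (no_types, lifting))
  have deg: "degree Fp = n"
    using monic_prod[of "{1..n}" lam] unfolding Fp_def
    by (metis card_atLeastAtMost degree_le diff_Suc_1 finite_atLeastAtMost le_antisym le_degree zero_neq_one)
  then have "degree (pderiv Fp) = n - 1"
    by (simp add: degree_pderiv)
  moreover from this have nz: "pderiv Fp \<noteq> 0"
    using n by auto
  ultimately have fin: "finite {x. poly (pderiv Fp) x = 0}" "card {x. poly (pderiv Fp) x = 0} \<le> n - 1"
    using poly_roots_finite card_poly_roots_bound[OF nz] by auto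
  have "gap_crit ` {1..<n} \<subseteq> {x. poly (pderiv Fp) x = 0}"
    using gap_max_deriv gap_crit by auto
  moreover have "card (gap_crit ` {1..<n}) = n - 1"
    using card_image[OF inj_crit] by simp
  ultimately show ?thesis
    unfolding eq using fin card_seteq by metis
qed

text \<open>A second maximizer in the gap would be critical, hence equal to the chosen point of
  another gap, but the gaps are disjoint.\<close>

lemma gap_crit_unique:
  assumes j: "j \<in> {1..<n}" and y: "y \<in> gap j" "y \<noteq> gap_crit j"
  shows "gap_sign j * F y < gap_sign j * F (gap_crit j)"
proof (rule ccontr)
  assume "\<not> ?thesis"
  then have "poly (pderiv Fp) y = 0"
    using gap_crit[OF j] by (intro gap_max_deriv[OF j y(1)]) force
  then have "(F has_real_derivative 0) (at y)"
    using F_deriv[of y] by simp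
  then have "y \<in> gap_crit ` {1..<n}"
    using crit_set by blast
  then obtain i where i: "i \<in> {1..<n}" "y = gap_crit i"
    by blast
  then have "i \<noteq> j"
    using y by auto
  then show False
    using gap_disjoint[OF gap_crit(1)[OF i(1)] y(1)] gap_disjoint[OF y(1) gap_crit(1)[OF i(1)]] i j
    by (cases "i < j") auto
qed

lemma crit_point_eq:
  assumes "j \<in> {1..<n}"
  shows "crit_point n lam j = gap_crit j"
proof -
  have "sorted_list_of_set (gap_crit ` {1..<n}) = map gap_crit [1..<n]"
  proof (rule sorted_distinct_set_unique)
    show "sorted (map gap_crit [1..<n])"
      unfolding sorted_iff_nth_mono_less by (auto intro!: less_imp_le crit_less)
    show "distinct (map gap_crit [1..<n])"
      unfolding distinct_map using inj_crit by simp
  qed auto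
  moreover have "map gap_crit [1..<n] ! (j - 1) = gap_crit j"
    using assms by (subst nth_map) (auto simp del: One_nat_def)
  ultimately show ?thesis
    unfolding crit_point_def crit_set by simp
qed

lemma local_extremum_crit:
  assumes "local_max_at F x \<or> local_min_at F x"
  shows "x \<in> gap_crit ` {1..<n}"
proof -
  have "poly (pderiv Fp) x = 0"
    using assms local_max_deriv[of 1 x] local_max_deriv[of "-1" x] by (auto simp: local_max_at_def local_min_at_def)
  then have "(F has_real_derivative 0) (at x)"
    using F_deriv[of x] by simp
  then show ?thesis
    using crit_set by blast
qed

definition level :: "real \<Rightarrow> real" where
  "level \<sigma> = Min ((\<lambda>j. \<sigma> * F (gap_crit j)) ` {j \<in> {1..<n}. gap_sign j = \<sigma>})"

text \<open>The index \<open>i\<close> counts critical points from the right. After the change to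
  \<open>j = n - i\<close> the parity of \<open>i\<close> is the sign of the gap.\<close>

lemma reflect_image:
  "(\<lambda>i. f (crit_point n lam (n - i))) ` {i \<in> {1..n-1}. P i} = (\<lambda>j. f (gap_crit j)) ` {j \<in> {1..<n}. P (n - j)}"
  (is "?l = ?r")
proof
  show "?l \<subseteq> ?r"
  proof
    fix y assume "y \<in> ?l"
    then obtain i where i: "i \<in> {1..n-1}" "P i" "y = f (crit_point n lam (n - i))" by blast
    then have "y = f (gap_crit (n - i))" "n - i \<in> {1..<n}" "P (n - (n - i))"
      using crit_point_eq[of "n - i"] n by auto
    then show "y \<in> ?r" by blast
  qed
  show "?r \<subseteq> ?l"
  proof
    fix y assume "y \<in> ?r"
    then obtain j where j: "j \<in> {1..<n}" "P (n - j)" "y = f (gap_crit j)" by blast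
    then have "y = f (crit_point n lam (n - (n - j)))" "n - j \<in> {1..n-1}"
      using crit_point_eq[of j] by auto
    then show "y \<in> ?l" using j by blast
  qed
qed

lemma M_upper_eq: "M_upper n lam = level 1"
  unfolding M_upper_def level_def reflect_image[of F even]
  by (intro arg_cong[where f = Min] image_cong) (auto simp: gap_sign_def minus_one_power_iff)

lemma m_lower_eq: "m_lower n lam = level (-1)"
  unfolding m_lower_def level_def reflect_image[of "\<lambda>x. - F x" odd]
  by (intro arg_cong[where f = Min] image_cong) (auto simp: gap_sign_def minus_one_power_iff)

lemma level_le: "j \<in> {1..<n} \<Longrightarrow> gap_sign j = \<sigma> \<Longrightarrow> level \<sigma> \<le> \<sigma> * F (gap_crit j)"
  unfolding level_def by (intro Min_le) auto

lemma level_pos: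
  assumes "\<sigma> = 1 \<or> \<sigma> = -1"
  shows "level \<sigma> > 0"
proof -
  let ?S = "{j \<in> {1..<n}. gap_sign j = \<sigma>}"
  \<comment> \<open>The last gap has sign -1 and the last but one has sign 1; both exist as
    \<open>n \<ge> 3\<close>.\<close>
  have "(if \<sigma> = 1 then n - 2 else n - 1) \<in> ?S"
    using assms n by (auto simp: gap_sign_def)
  then have "?S \<noteq> {}" by blast
  then have "level \<sigma> \<in> (\<lambda>j. \<sigma> * F (gap_crit j)) ` ?S"
    unfolding level_def by (intro Min_in) auto
  then show ?thesis
    using F_sign[OF gap_crit(1)] by auto
qed

text \<open>A local extremum is the critical point of some gap. As \<open>level \<sigma>\<close> is
  positive, the value attained there determines the sign of the gap, so two extrema give two gaps of
  sign \<sigma>.\<close>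

lemma two_collapsing_gaps:
  assumes "n_plus n lam > 1 \<or> n_minus n lam > 1"
  obtains \<sigma> p q where "\<sigma> = 1 \<or> \<sigma> = -1" "p \<in> {1..<n}" "q \<in> {1..<n}" "p \<noteq> q"
    "gap_sign p = \<sigma>" "gap_sign q = \<sigma>" "\<sigma> * F (gap_crit p) = level \<sigma>" "\<sigma> * F (gap_crit q) = level \<sigma>"
proof -
  note main = that
  have *: thesis if "card S > 1" "\<sigma> = 1 \<or> \<sigma> = -1"
    and S: "\<And>x. x \<in> S \<Longrightarrow> (local_max_at F x \<or> local_min_at F x) \<and> \<sigma> * F x = level \<sigma>" for S and \<sigma> :: real
  proof -
    have "\<not> card S \<le> Suc 0" "finite S"
      using that(1) by (auto intro: card_ge_0_finite)
    then obtain x y where xy: "x \<in> S" "y \<in> S" "x \<noteq> y"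
      using card_le_Suc0_iff_eq by blast
    have "\<exists>j\<in>{1..<n}. z = gap_crit j \<and> gap_sign j = \<sigma> \<and> \<sigma> * F (gap_crit j) = level \<sigma>" if "z \<in> S" for z
    proof -
      obtain j where j: "j \<in> {1..<n}" "z = gap_crit j"
        using local_extremum_crit S[OF \<open>z \<in> S\<close>] by blast
      have "gap_sign j * F z > 0"
        using F_sign gap_crit j by blast
      moreover have "\<sigma> * F z = level \<sigma>" "level \<sigma> > 0"
        using S[OF \<open>z \<in> S\<close>] level_pos[OF \<open>\<sigma> = 1 \<or> \<sigma> = -1\<close>] by auto
      ultimately have "gap_sign j = \<sigma>"
        using gap_sign_cases[of j] \<open>\<sigma> = 1 \<or> \<sigma> = -1\<close> by auto
      then show ?thesis
        using j S[OF \<open>z \<in> S\<close>] by blast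
    qed
    from this[OF xy(1)] this[OF xy(2)] xy(3)
    obtain p q where "p \<in> {1..<n}" "q \<in> {1..<n}" "p \<noteq> q" "gap_sign p = \<sigma>" "gap_sign q = \<sigma>"
      "\<sigma> * F (gap_crit p) = level \<sigma>" "\<sigma> * F (gap_crit q) = level \<sigma>"
      by blast
    then show thesis
      by (intro main[OF that(2)])
  qed
  show thesis
    using assms
  proof
    assume "n_plus n lam > 1"
    then show thesis
      by (intro *[of "{x. local_max_at F x \<and> F x = M_upper n lam}" 1]) (auto simp: n_plus_def M_upper_eq)
  next
    assume "n_minus n lam > 1"
    then show thesis
      by (intro *[of "{x. local_min_at F x \<and> F x = - m_lower n lam}" "-1"]) (auto simp: n_minus_def m_lower_eq)
  qed
qed

end

section \<open>Reconstruction of a matrix from its spectral data\<close>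

lemma tridet_cong:
  assumes "\<And>i. s < i \<Longrightarrow> i \<le> s + k \<Longrightarrow> a i = a' i" "\<And>i. s < i \<Longrightarrow> i < s + k \<Longrightarrow> \<rho> i = \<rho>' i"
  shows "tridet a \<rho> s k = tridet a' \<rho>' s k"
  using assms
proof (induction k rule: less_induct)
  case (less k)
  consider "k = 0" | "k = Suc 0" | j where "k = Suc (Suc j)"
    by (cases k; cases "k - 1") auto
  then show ?case
  proof cases
    case 3
    have "tridet a \<rho> s (Suc j) = tridet a' \<rho>' s (Suc j)" "tridet a \<rho> s j = tridet a' \<rho>' s j"
      using less 3 by auto
    then show ?thesis
      using 3 less.prems by simp
  qed (use less.prems in auto)
qed

lemma continuous_on_If_const:
  "(P \<Longrightarrow> continuous_on S f) \<Longrightarrow> (\<not> P \<Longrightarrow> continuous_on S g) \<Longrightarrow> continuous_on S (\<lambda>u. if P then f u else g u)"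
  by (cases P) simp_all

text \<open>A coordinate on the right half of the unit circle for which the imaginary part has the
  sign of \<open>t\<close>.\<close>

definition phase :: "real \<Rightarrow> complex" where
  "phase t = Complex 1 t / complex_of_real (sqrt (1 + t\<^sup>2))"

lemma phase_simps [simp]: "cmod (phase t) = 1" "phase t \<noteq> 0" "phase 0 = 1"
  and Re_phase: "Re (phase t) = 1 / sqrt (1 + t\<^sup>2)" and Im_phase: "Im (phase t) = t / sqrt (1 + t\<^sup>2)"
proof -
  have pos: "sqrt (1 + t\<^sup>2) > 0"
    by (simp add: add_pos_nonneg)
  show 1: "cmod (phase t) = 1"
  proof -
    have "cmod (Complex 1 t) = sqrt (1 + t\<^sup>2)"
      by (simp add: cmod_def)
    then show ?thesis
      using pos by (simp only: phase_def norm_divide norm_of_real) simp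
  qed
  then show "phase t \<noteq> 0" by auto
  show "phase 0 = 1" by (simp add: phase_def complex_eq_iff)
  show "Re (phase t) = 1 / sqrt (1 + t\<^sup>2)" "Im (phase t) = t / sqrt (1 + t\<^sup>2)"
    by (simp_all add: phase_def Re_divide_of_real Im_divide_of_real)
qed

lemma continuous_on_phase [continuous_intros]:
  assumes "continuous_on S f"
  shows "continuous_on S (\<lambda>u. phase (f u))"
proof -
  have "sqrt (1 + (f u)\<^sup>2) > 0" for u
    by (simp add: add_pos_nonneg)
  then have "complex_of_real (sqrt (1 + (f u)\<^sup>2)) \<noteq> 0" for u
    by (metis less_irrefl of_real_eq_0_iff)
  then show ?thesis
    unfolding phase_def Complex_eq by (auto intro!: continuous_intros assms)
qed

definition node_deriv :: "nat \<Rightarrow> (nat \<Rightarrow> real) \<Rightarrow> nat \<Rightarrow> real" where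
  "node_deriv N \<mu> j = (\<Prod>i\<in>{1..N} - {j}. \<mu> j - \<mu> i)"

text \<open>The residue at \<open>\<mu> j\<close> of \<open>Q / (\<Prod>i. y - \<mu> i)\<close>,
  where \<open>Q\<close> has degree below \<open>N\<close> and takes the values \<open>p j\<close>
  at the nodes. In the finished matrix \<open>Q\<close> is \<open>|b n|\<^sup>2\<close> times the
  determinant of rows 2 to \<open>N\<close>, so the sum of the weights, the leading coefficient of
  \<open>Q\<close>, is \<open>|b n|\<^sup>2\<close>.\<close>

definition node_weight :: "nat \<Rightarrow> (nat \<Rightarrow> real) \<Rightarrow> (nat \<Rightarrow> real) \<Rightarrow> nat \<Rightarrow> real" where
  "node_weight N \<mu> p j = p j / node_deriv N \<mu> j"

definition rec_rho :: "nat \<Rightarrow> (nat \<Rightarrow> real) \<Rightarrow> (nat \<Rightarrow> real) \<Rightarrow> nat \<Rightarrow> real" where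
  "rec_rho N \<mu> p i = jac_rho \<mu> (node_weight N \<mu> p) N i"

definition rec_sum :: "nat \<Rightarrow> (nat \<Rightarrow> real) \<Rightarrow> (nat \<Rightarrow> real) \<Rightarrow> real" where
  "rec_sum N \<mu> p = sum (node_weight N \<mu> p) {1..N}"

text \<open>The modulus at \<open>i = N\<close> is forced: all \<open>n\<close> moduli must multiply
  to \<open>|B|\<close>, and that of \<open>b n\<close> is to be the square root of
  \<open>rec_sum\<close>.\<close>

definition rec_r :: "nat \<Rightarrow> (nat \<Rightarrow> real) \<Rightarrow> (nat \<Rightarrow> real) \<Rightarrow> complex \<Rightarrow> nat \<Rightarrow> real" where
  "rec_r N \<mu> p B i = (if i < N then sqrt (rec_rho N \<mu> p i)
     else cmod B / (sqrt (rec_sum N \<mu> p) * (\<Prod>i = 1..<N. sqrt (rec_rho N \<mu> p i))))"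

text \<open>The first \<open>N\<close> phases are free and the last entry is forced by the product
  \<open>B\<close>. The value 0 outside \<open>{1..n}\<close> makes the sequence recoverable from
  its matrix.\<close>

definition rec_b :: "nat \<Rightarrow> (nat \<Rightarrow> real) \<Rightarrow> (nat \<Rightarrow> real) \<Rightarrow> complex \<Rightarrow> (nat \<Rightarrow> real) \<Rightarrow> nat \<Rightarrow> complex" where
  "rec_b N \<mu> p B \<phi> i =
     (if i \<in> {1..N} then rec_r N \<mu> p B i * phase (\<phi> i)
      else if i = Suc N then B / (\<Prod>i = 1..N. rec_r N \<mu> p B i * phase (\<phi> i)) else 0)"

text \<open>The last diagonal entry is chosen such that the characteristic polynomial vanishes at \<open>y\<close>.\<close>
definition rec_a :: "nat \<Rightarrow> real \<Rightarrow> (nat \<Rightarrow> real) \<Rightarrow> (nat \<Rightarrow> real) \<Rightarrow> complex \<Rightarrow> nat \<Rightarrow> real" where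
  "rec_a N y \<mu> p B i =
     (if i \<in> {1..N} then jac_a \<mu> (node_weight N \<mu> p) N i
      else if i = Suc N then y - ((rec_r N \<mu> p B N)\<^sup>2 * poly (tridet (jac_a \<mu> (node_weight N \<mu> p) N) (rec_rho N \<mu> p) 0 (N - 1)) y
         + rec_sum N \<mu> p * poly (tridet (jac_a \<mu> (node_weight N \<mu> p) N) (rec_rho N \<mu> p) 1 (N - 1)) y
         + 2 * Re B) / (\<Prod>j = 1..N. y - \<mu> j)
      else 0)"

section \<open>Isospectrality of the reconstructed matrix\<close>

locale spectral_data = simple_spectrum +
  fixes N :: nat and \<mu> p :: "nat \<Rightarrow> real" and B :: complex and \<phi> :: "nat \<Rightarrow> real"
  assumes N: "n = Suc N" and mu_gap: "\<And>j. j \<in> {1..N} \<Longrightarrow> \<mu> j \<in> gap j"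
    and p_sign: "\<And>j. j \<in> {1..N} \<Longrightarrow> - gap_sign j * p j > 0" and B_nz: "B \<noteq> 0"
    and p_eq: "\<And>j. j \<in> {1..N} \<Longrightarrow> p j + (cmod B)\<^sup>2 / p j = - (F (\<mu> j) + 2 * Re B)"
begin

lemma N2: "2 \<le> N"
  using n N by simp

lemma p_nz: "j \<in> {1..N} \<Longrightarrow> p j \<noteq> 0"
  using p_sign[of j] by auto

lemma mu_less: "i \<in> {1..N} \<Longrightarrow> j \<in> {1..N} \<Longrightarrow> i < j \<Longrightarrow> \<mu> i < \<mu> j"
  using gap_disjoint[OF mu_gap mu_gap, of i j] N by auto

text \<open>Stated for every \<open>y\<close> in the gap, because it serves at the node, for the
  positivity of the weights, and later at the critical point.\<close>

lemma gap_prod_sign: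
  assumes j: "j \<in> {1..N}" and y: "y \<in> gap j"
  shows "- gap_sign j * (\<Prod>i\<in>{1..N} - {j}. y - \<mu> i) > 0"
proof -
  have "(-1) ^ card {Suc j..N} * (\<Prod>i\<in>{1..<j} \<union> {Suc j..N}. y - \<mu> i) > 0"
  proof (intro prod_sign)
    fix i assume "i \<in> {1..<j}"
    then show "0 < y - \<mu> i"
      using gap_disjoint[OF mu_gap y, of i] j N by auto
  next
    fix i assume "i \<in> {Suc j..N}"
    then show "y - \<mu> i < 0"
      using gap_disjoint[OF y mu_gap, of i] j N by auto
  qed auto
  moreover have "{1..<j} \<union> {Suc j..N} = {1..N} - {j}"
    using j by auto
  moreover have "(-1) ^ card {Suc j..N} = - gap_sign j"
    unfolding gap_sign_def using j N by (simp add: Suc_diff_le)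
  ultimately show ?thesis by simp
qed

abbreviation "w \<equiv> node_weight N \<mu> p"

lemma node_deriv_sign: "j \<in> {1..N} \<Longrightarrow> - gap_sign j * node_deriv N \<mu> j > 0"
  unfolding node_deriv_def using gap_prod_sign mu_gap by blast

lemma w_pos:
  assumes j: "j \<in> {1..N}"
  shows "w j > 0"
  using gap_sign_cases[of j] p_sign[OF j] node_deriv_sign[OF j]
  by (auto simp: node_weight_def intro: divide_pos_pos divide_neg_neg)

sublocale node_weights \<mu> w N
proof
  show "inj_on \<mu> {1..N}"
    using mu_less by (intro linorder_inj_onI) (auto, metis order_less_irrefl)
  show "N > 0" using N2 by simp
qed (rule w_pos)

lemma node_weights_rec: "node_weights \<mu> w N" ..

abbreviation "S \<equiv> rec_sum N \<mu> p"
abbreviation "r \<equiv> rec_r N \<mu> p B"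
abbreviation "bb \<equiv> rec_b N \<mu> p B \<phi>"
abbreviation "aa \<equiv> rec_a N (lam 1) \<mu> p B"

lemma rec_rho_eq: "rec_rho N \<mu> p = \<rho>"
  by (rule ext) (simp add: rec_rho_def)

lemma S_pos: "S > 0"
  unfolding rec_sum_def using w_pos N2 by (intro sum_pos) auto

lemma r_pos:
  assumes "i \<in> {1..N}"
  shows "r i > 0"
proof (cases "i < N")
  case True
  then show ?thesis
    using assms rho_pos[of i] by (simp add: rec_r_def rec_rho_eq)
next
  case False
  have "(\<Prod>i = 1..<N. sqrt (\<rho> i)) > 0"
    using rho_pos by (intro prod_pos) auto
  then show ?thesis
    using False S_pos B_nz by (simp add: rec_r_def rec_rho_eq)
qed

lemma bb_simps:
  "i \<in> {1..N} \<Longrightarrow> bb i = r i * phase (\<phi> i)" "bb n = B / (\<Prod>i = 1..N. bb i)"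
  by (auto simp: rec_b_def N intro: prod.cong)

lemma bb_nz: "i \<in> {1..N} \<Longrightarrow> bb i \<noteq> 0"
  using r_pos[of i] by (simp add: bb_simps)

lemma prod_bb: "(\<Prod>i = 1..n. bb i) = B"
proof -
  have "(\<Prod>i = 1..n. bb i) = (\<Prod>i = 1..N. bb i) * bb n"
    using N by simp
  then show ?thesis
    using bb_nz unfolding bb_simps(2) by simp
qed

lemma cmod_bb: "i \<in> {1..N} \<Longrightarrow> cmod (bb i) = r i"
  using r_pos[of i] by (simp add: bb_simps norm_mult)

lemma sqmod_bb: "0 < i \<Longrightarrow> i < N \<Longrightarrow> sqmod bb i = \<rho> i"
  using cmod_bb[of i] rho_pos[of i] by (simp add: sqmod_def rec_r_def rec_rho_eq)

lemma prod_rho_pos: "(\<Prod>i = 1..<N. \<rho> i) > 0"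
  using rho_pos by (intro prod_pos) auto

lemma r_N: "(r N)\<^sup>2 * (S * (\<Prod>i = 1..<N. \<rho> i)) = (cmod B)\<^sup>2"
proof -
  have "(\<Prod>i = 1..<N. sqrt (\<rho> i))\<^sup>2 = (\<Prod>i = 1..<N. \<rho> i)"
    using rho_pos unfolding prod_power_distrib by (intro prod.cong) (auto intro: less_imp_le)
  moreover have "r N = cmod B / (sqrt S * (\<Prod>i = 1..<N. sqrt (\<rho> i)))"
    by (simp add: rec_r_def rec_rho_eq)
  ultimately have "(r N)\<^sup>2 = (cmod B)\<^sup>2 / (S * (\<Prod>i = 1..<N. \<rho> i))"
    using S_pos by (simp only: power_divide power_mult_distrib real_sqrt_pow2 less_imp_le)
  moreover have "S * (\<Prod>i = 1..<N. \<rho> i) \<noteq> 0"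
    using mult_pos_pos[OF S_pos prod_rho_pos] by linarith
  ultimately show ?thesis
    by (metis nonzero_eq_divide_eq)
qed

lemma sqmod_bb_N: "sqmod bb N = (r N)\<^sup>2"
  using cmod_bb[of N] N2 by (simp add: sqmod_def)

lemma sqmod_bb_n: "sqmod bb n = S"
proof -
  have prod: "(\<Prod>i = 1..N. r i) = (\<Prod>i = 1..<N. r i) * r N"
  proof -
    have "{1..N} = insert N {1..<N}"
      using N2 by auto
    then show ?thesis by simp
  qed
  have "(\<Prod>i = 1..N. cmod (bb i)) = (\<Prod>i = 1..N. r i)"
    using cmod_bb by (intro prod.cong) auto
  then have "sqmod bb n = (cmod B)\<^sup>2 / (\<Prod>i = 1..N. r i)\<^sup>2"
    unfolding sqmod_def bb_simps(2) by (simp add: norm_divide prod_norm[symmetric] power_divide)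
  also have "(\<Prod>i = 1..N. r i)\<^sup>2 = (r N)\<^sup>2 * (\<Prod>i = 1..<N. (r i)\<^sup>2)"
    unfolding prod by (simp add: power_mult_distrib prod_power_distrib mult.commute)
  also have "(\<Prod>i = 1..<N. (r i)\<^sup>2) = (\<Prod>i = 1..<N. \<rho> i)"
    using rho_pos by (intro prod.cong) (auto simp: rec_r_def rec_rho_eq intro: less_imp_le)
  also have "(cmod B)\<^sup>2 / ((r N)\<^sup>2 * (\<Prod>i = 1..<N. \<rho> i)) = S"
  proof -
    have "(r N)\<^sup>2 * (\<Prod>i = 1..<N. \<rho> i) > 0"
      using r_pos[of N] N2 by (intro mult_pos_pos prod_rho_pos) auto
    moreover have "(r N)\<^sup>2 * (S * (\<Prod>i = 1..<N. \<rho> i)) = S * ((r N)\<^sup>2 * (\<Prod>i = 1..<N. \<rho> i))"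
      by (simp only: mult_ac)
    ultimately show ?thesis
      unfolding r_N[symmetric] by (metis less_irrefl nonzero_mult_div_cancel_right)
  qed
  finally show ?thesis .
qed

lemma tridet_rec: "s + k \<le> N \<Longrightarrow> tridet aa (sqmod bb) s k = tridet a \<rho> s k"
  by (rule tridet_cong) (auto simp: rec_a_def sqmod_bb)

lemma tridet_0_N: "tridet aa (sqmod bb) 0 N = (\<Prod>j = 1..N. [:- \<mu> j, 1:])"
  using tridet_rec[of 0 N] P_N by (simp add: opoly_eq_tridet)

text \<open>For these weights \<open>weight_formula\<close> says that \<open>p j\<close> times the
  determinant is \<open>S * (\<Prod>i = 1..<N. \<rho> i)\<close>, and \<open>rec_r\<close> at
  \<open>N\<close> is chosen so that the factor \<open>(r N)\<^sup>2\<close> turns this into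
  \<open>|B|\<^sup>2\<close>.\<close>

lemma cofactor_right:
  assumes j: "j \<in> {1..N}"
  shows "(r N)\<^sup>2 * poly (tridet a \<rho> 0 (N - 1)) (\<mu> j) = (cmod B)\<^sup>2 / p j"
proof -
  have d: "node_deriv N \<mu> j \<noteq> 0"
    using node_deriv_sign[OF j] by auto
  have "h (N - 1) = S * (\<Prod>i = 1..N - 1. \<rho> i)"
    using h_eq_prod[of "N - 1"] N2 by (simp add: rec_sum_def)
  also have "{1..N - 1} = {1..<N}"
    using N2 by auto
  finally have h: "h (N - 1) = S * (\<Prod>i = 1..<N. \<rho> i)" .
  have "w j * poly (tridet a \<rho> 0 (N - 1)) (\<mu> j) * node_deriv N \<mu> j = S * (\<Prod>i = 1..<N. \<rho> i)"
    using weight_formula[OF j] unfolding h opoly_eq_tridet node_deriv_def by simp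
  then have "p j * poly (tridet a \<rho> 0 (N - 1)) (\<mu> j) = S * (\<Prod>i = 1..<N. \<rho> i)"
    using d by (simp add: node_weight_def)
  then have "(r N)\<^sup>2 * (p j * poly (tridet a \<rho> 0 (N - 1)) (\<mu> j)) = (cmod B)\<^sup>2"
    by (simp only: r_N)
  then show ?thesis
    using p_nz[OF j] by (simp add: field_simps)
qed

text \<open>Since \<open>\<mu> j\<close> is a zero of the determinant of size \<open>N\<close>, the
  Wronskian identity gives the product of the two cofactors, one of which is already known.\<close>

lemma cofactor_left:
  assumes j: "j \<in> {1..N}"
  shows "S * poly (tridet a \<rho> 1 (N - 1)) (\<mu> j) = p j"
proof -
  obtain k where k: "N = Suc (Suc k)"
    using N2 by (metis Suc_diff_Suc Suc_le_eq numeral_2_eq_2 le_Suc_ex add_Suc)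
  have "poly (tridet a \<rho> 0 N) (\<mu> j) = 0"
    using P_N j by (auto simp: opoly_eq_tridet[symmetric] poly_prod)
  moreover have "{Suc 0..0 + k + 1} = {1..<N}"
    using k by auto
  ultimately have "poly (tridet a \<rho> 0 (N - 1)) (\<mu> j) * poly (tridet a \<rho> 1 (N - 1)) (\<mu> j) = (\<Prod>i = 1..<N. \<rho> i)"
    using tridet_wronskian[of a \<rho> 0 k "\<mu> j"] k by simp
  then have "((r N)\<^sup>2 * poly (tridet a \<rho> 0 (N - 1)) (\<mu> j)) * (S * poly (tridet a \<rho> 1 (N - 1)) (\<mu> j))
      = (r N)\<^sup>2 * (S * (\<Prod>i = 1..<N. \<rho> i))"
    by (simp add: mult_ac)
  then have "(cmod B)\<^sup>2 / p j * (S * poly (tridet a \<rho> 1 (N - 1)) (\<mu> j)) = (cmod B)\<^sup>2"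
    unfolding cofactor_right[OF j] r_N .
  then show ?thesis
    using p_nz[OF j] B_nz by (simp add: field_simps)
qed

lemma lam1_below: "j \<in> {1..N} \<Longrightarrow> lam 1 < \<mu> j"
  using gap_above[OF mu_gap, of j 1] N by auto

lemma node_poly_lam_nz:
  assumes "i \<in> {1..n}"
  shows "(\<Prod>j = 1..N. lam i - \<mu> j) \<noteq> 0"
proof -
  have "lam i \<noteq> \<mu> j" if "j \<in> {1..N}" for j
    using gap_above[OF mu_gap[OF that], of i] gap_below[OF mu_gap[OF that], of i] that assms N
    by (cases "i \<le> j") auto
  then show ?thesis by simp
qed

text \<open>Two monic polynomials of degree \<open>n\<close> agree at \<open>n\<close> points: at
  the nodes by \<open>p_eq\<close>, and at \<open>lam 1\<close>, which lies below all nodes, by the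
  choice of the last diagonal entry.\<close>

lemma percharpoly_rec: "percharpoly n aa (sqmod bb) (Re (\<Prod>i = 1..n. bb i)) = Fp"
proof -
  let ?Q = "percharpoly n aa (sqmod bb) (Re B)"
  have poly_Q: "poly ?Q y = (y - aa n) * (\<Prod>j = 1..N. y - \<mu> j)
      - (r N)\<^sup>2 * poly (tridet a \<rho> 0 (N - 1)) y - S * poly (tridet a \<rho> 1 (N - 1)) y - 2 * Re B" for y
    using tridet_rec[of 0 "N - 1"] tridet_rec[of 1 "N - 1"] tridet_0_N sqmod_bb_N sqmod_bb_n N2
    by (simp add: poly_percharpoly N poly_prod numeral_2_eq_2)
  define \<nu> where "\<nu> i = (if i = n then lam 1 else \<mu> i)" for i
  have "inj_on \<nu> {1..n}"
  proof (intro linorder_inj_onI)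
    fix i j assume "i < j" "i \<in> {1..n}" "j \<in> {1..n}"
    then show "\<nu> i \<noteq> \<nu> j"
      using mu_less[of i j] lam1_below[of i] N by (auto simp: \<nu>_def)
  qed auto
  then have "?Q - Fp = 0"
  proof (rule zero_on_nodes)
    fix j assume j: "j \<in> {1..n}"
    show "poly (?Q - Fp) (\<nu> j) = 0"
    proof (cases "j = n")
      case True
      have "poly ?Q (lam 1) = 0"
        unfolding poly_Q using node_poly_lam_nz[of 1] N
        by (simp add: rec_a_def rec_rho_eq)
      then show ?thesis
        using True F_lam[of 1] n by (simp add: \<nu>_def)
    next
      case False
      then have j': "j \<in> {1..N}" using j N by auto
      then have "(\<Prod>i = 1..N. \<mu> j - \<mu> i) = 0" by auto
      then have "poly ?Q (\<mu> j) = - ((cmod B)\<^sup>2 / p j) - p j - 2 * Re B"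
        unfolding poly_Q cofactor_right[OF j'] cofactor_left[OF j'] by simp
      also have "\<dots> = F (\<mu> j)"
        using p_eq[OF j'] by simp
      finally show ?thesis
        using False by (simp add: \<nu>_def)
    qed
  next
    fix i assume "n \<le> i"
    moreover have "coeff Fp n = 1" "\<And>i. i > n \<Longrightarrow> coeff Fp i = 0"
      using monic_prod[of "{1..n}" lam] by (auto simp: Fp_def)
    ultimately show "coeff (?Q - Fp) i = 0"
      using coeff_percharpoly[of n] n by (cases "i = n") auto
  qed
  then show ?thesis
    unfolding prod_bb by simp
qed

lemma rec_in_isospectral: "periodic_tridiagonal n aa bb \<in> topspace (isospectral_space n lam)"
  unfolding topspace_isospectral
proof (intro CollectI conjI)
  show "spectrum (periodic_tridiagonal n aa bb) = (\<lambda>i. complex_of_real (lam i)) ` {1..n}"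
    using n inj_lam percharpoly_rec unfolding Fp_def
    by (rule spectrum_periodic_tridiagonal)
      (use tridet_0_N node_poly_lam_nz in \<open>simp add: N poly_prod\<close>)
qed blast

end

lemma continuous_on_rec:
  fixes \<mu> p \<phi> :: "'a::topological_space \<Rightarrow> nat \<Rightarrow> real" and B :: "'a \<Rightarrow> complex"
  assumes data: "\<And>u. u \<in> W \<Longrightarrow> spectral_data n lam N (\<mu> u) (p u) (B u)"
    and \<mu>: "\<And>j. j \<in> {1..N} \<Longrightarrow> continuous_on W (\<lambda>u. \<mu> u j)" and p: "\<And>j. j \<in> {1..N} \<Longrightarrow> continuous_on W (\<lambda>u. p u j)"
    and B: "continuous_on W B" and \<phi>: "\<And>j. j \<in> {1..N} \<Longrightarrow> continuous_on W (\<lambda>u. \<phi> u j)"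
  shows "continuous_on W (\<lambda>u. rec_b N (\<mu> u) (p u) (B u) (\<phi> u) i)"
    and "continuous_on W (\<lambda>u. rec_a N (lam 1) (\<mu> u) (p u) (B u) i)"
proof -
  define w where "w u = node_weight N (\<mu> u) (p u)" for u
  have w: "continuous_on W (\<lambda>u. w u j)" if j: "j \<in> {1..N}" for j
  proof -
    have "node_deriv N (\<mu> u) j \<noteq> 0" if "u \<in> W" for u
      using spectral_data.node_deriv_sign[OF data[OF that] j] by auto
    then show ?thesis
      unfolding w_def node_weight_def using j
      by (intro continuous_on_divide p) (auto simp: node_deriv_def intro!: continuous_intros \<mu>)
  qed
  have nw: "node_weights (\<mu> u) (w u) N" if "u \<in> W" for u
    unfolding w_def using data[OF that] by (rule spectral_data.node_weights_rec)
  note jac = continuous_on_jac[of N W \<mu> w, OF \<mu> w nw]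
  have a: "continuous_on W (\<lambda>u. jac_a (\<mu> u) (w u) N i)" if "i \<in> {1..N}" for i
    using jac(1)[of i] that by blast
  have rho: "continuous_on W (\<lambda>u. rec_rho N (\<mu> u) (p u) i)" if "0 < i" "i < N" for i
    using jac(2)[of i] that unfolding rec_rho_def w_def by blast
  have S: "continuous_on W (\<lambda>u. rec_sum N (\<mu> u) (p u))"
    using w unfolding rec_sum_def w_def by (intro continuous_on_sum) auto
  have r: "continuous_on W (\<lambda>u. rec_r N (\<mu> u) (p u) (B u) i)" if i: "i \<in> {1..N}" for i
  proof (cases "i < N")
    case True
    then show ?thesis
      using rho[of i] i by (simp add: rec_r_def continuous_on_real_sqrt)
  next
    case False
    have "sqrt (rec_sum N (\<mu> u) (p u)) * (\<Prod>i = 1..<N. sqrt (rec_rho N (\<mu> u) (p u) i)) \<noteq> 0" if "u \<in> W" for u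
    proof
      assume "sqrt (rec_sum N (\<mu> u) (p u)) * (\<Prod>i = 1..<N. sqrt (rec_rho N (\<mu> u) (p u) i)) = 0"
      then have "rec_r N (\<mu> u) (p u) (B u) N = 0"
        by (simp only: rec_r_def) simp
      then show False
        using spectral_data.r_pos[OF data[OF that], of N] i by simp
    qed
    moreover have "continuous_on W (\<lambda>u. \<Prod>i = 1..<N. sqrt (rec_rho N (\<mu> u) (p u) i))"
      by (intro continuous_on_prod continuous_on_real_sqrt rho) auto
    ultimately show ?thesis
      using False unfolding rec_r_def
      by (simp only: if_False) (intro continuous_on_divide continuous_on_mult continuous_on_norm
          continuous_on_real_sqrt B S; blast)
  qed
  show "continuous_on W (\<lambda>u. rec_b N (\<mu> u) (p u) (B u) (\<phi> u) i)"
  proof -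
    have rp: "continuous_on W (\<lambda>u. complex_of_real (rec_r N (\<mu> u) (p u) (B u) j) * phase (\<phi> u j))" if "j \<in> {1..N}" for j
      using that by (intro continuous_intros r \<phi>)
    moreover have "(\<Prod>j = 1..N. complex_of_real (rec_r N (\<mu> u) (p u) (B u) j) * phase (\<phi> u j)) \<noteq> 0" if "u \<in> W" for u
      using spectral_data.r_pos[OF data[OF that]] by (auto simp: less_imp_neq[symmetric])
    ultimately have "continuous_on W (\<lambda>u. B u / (\<Prod>j = 1..N. complex_of_real (rec_r N (\<mu> u) (p u) (B u) j) * phase (\<phi> u j)))"
      by (intro continuous_on_divide continuous_on_prod B) auto
    then show ?thesis
      unfolding rec_b_def by (intro continuous_on_If_const rp continuous_on_const)
  qed
  show "continuous_on W (\<lambda>u. rec_a N (lam 1) (\<mu> u) (p u) (B u) i)"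
  proof -
    \<comment> \<open>Continuity of the Jacobi data is known only for the indices that occur in the
      matrix; the sequences are cut off so that it holds for every index, as
      \<open>continuous_on_poly_tridet\<close> requires.\<close>
    define a' \<rho>' where "a' u i = (if i \<in> {1..N} then jac_a (\<mu> u) (w u) N i else 0)"
      and "\<rho>' u i = (if 0 < i \<and> i < N then rec_rho N (\<mu> u) (p u) i else 0)" for u i
    have a': "continuous_on W (\<lambda>u. a' u i)" and \<rho>': "continuous_on W (\<lambda>u. \<rho>' u i)" for i
      unfolding a'_def \<rho>'_def using a[of i] rho[of i]
      by (intro continuous_on_If_const continuous_on_const; simp add: w_def)+
    have eq: "tridet (jac_a (\<mu> u) (node_weight N (\<mu> u) (p u)) N) (rec_rho N (\<mu> u) (p u)) s (N - 1)
        = tridet (a' u) (\<rho>' u) s (N - 1)" if "s \<le> 1" for u s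
      using that by (intro tridet_cong) (auto simp: a'_def \<rho>'_def w_def)
    have td: "continuous_on W (\<lambda>u. poly (tridet (a' u) (\<rho>' u) s (N - 1)) (lam 1))" for s
      by (intro continuous_on_poly_tridet a' \<rho>' continuous_on_const)
    have nz: "(\<Prod>j = 1..N. lam 1 - \<mu> u j) \<noteq> 0" if "u \<in> W" for u
      using spectral_data.node_poly_lam_nz[OF data[OF that], of 1] spectral_data.N[OF data[OF that]] by simp
    have N: "N \<in> {1..N}" if "u \<in> W" for u
      using spectral_data.N2[OF data[OF that]] by simp
    show ?thesis
    proof (cases "W = {}")
      case False
      then have rN: "continuous_on W (\<lambda>u. rec_r N (\<mu> u) (p u) (B u) N)"
        using N r by blast
      have "continuous_on W (\<lambda>u. lam 1 - ((rec_r N (\<mu> u) (p u) (B u) N)\<^sup>2 * poly (tridet (a' u) (\<rho>' u) 0 (N - 1)) (lam 1)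
         + rec_sum N (\<mu> u) (p u) * poly (tridet (a' u) (\<rho>' u) 1 (N - 1)) (lam 1)
         + 2 * Re (B u)) / (\<Prod>j = 1..N. lam 1 - \<mu> u j))"
        using nz by (intro continuous_intros rN td S B \<mu>) auto
      moreover have "continuous_on W (\<lambda>u. jac_a (\<mu> u) (node_weight N (\<mu> u) (p u)) N i)" if "i \<in> {1..N}"
        using a[OF that] by (simp add: w_def)
      ultimately show ?thesis
        unfolding rec_a_def eq[OF le_refl] eq[OF zero_le_one] by (intro continuous_on_If_const continuous_on_const)
    qed simp
  qed
qed

section \<open>Coordinates near the singular point\<close>

lemma continuous_on_coordinate [continuous_intros]: "continuous_on S (\<lambda>u. u i)"
  by (rule continuous_on_subset[OF continuous_on_product_coordinates]) simp

lemma open_Collect_finite_ball: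
  assumes "finite A" "\<And>j. j \<in> A \<Longrightarrow> open {u. P j u}"
  shows "open {u. \<forall>j\<in>A. P j u}"
proof -
  have "{u. \<forall>j\<in>A. P j u} = (\<Inter>j\<in>A. {u. P j u})" by auto
  then show ?thesis using assms by (simp add: open_INT)
qed

lemma open_Collect_imp_const: "(P \<Longrightarrow> open {u. Q u}) \<Longrightarrow> open {u. P \<longrightarrow> Q u}"
  by (cases P) auto

text \<open>The numbers \<open>(c + s) / 2\<close> and \<open>(c - s) / 2\<close> are the roots of
  \<open>q\<^sup>2 - c * q + b\<^sup>2\<close>. The sign of \<open>s\<close> is left free, so that
  \<open>q\<close> can pass from one root to the other along a circle.\<close>

lemma quadratic_root:
  fixes b c s :: real
  assumes "b > 0" "c \<ge> 2 * b" "s\<^sup>2 = c\<^sup>2 - 4 * b\<^sup>2"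
  shows "(c + s) / 2 > 0" "(c + s) / 2 + b\<^sup>2 / ((c + s) / 2) = c" "(c + s) / 2 - b\<^sup>2 / ((c + s) / 2) = s"
proof -
  have "\<bar>s\<bar> < c"
  proof (rule power2_less_imp_less)
    show "\<bar>s\<bar>\<^sup>2 < c\<^sup>2"
      using assms by simp
  qed (use assms in linarith)
  then have "0 < c + s"
    by (auto simp: abs_less_iff)
  then show q: "(c + s) / 2 > 0" by simp
  have "b\<^sup>2 = (c - s) / 2 * ((c + s) / 2)"
    using assms(3) by (simp add: field_simps power2_eq_square)
  then have "b\<^sup>2 / ((c + s) / 2) = (c - s) / 2"
    using q by (metis less_irrefl nonzero_mult_div_cancel_right)
  then show "(c + s) / 2 + b\<^sup>2 / ((c + s) / 2) = c" "(c + s) / 2 - b\<^sup>2 / ((c + s) / 2) = s"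
    by (simp_all only:) (simp_all add: field_simps)
qed

section \<open>Parametrisation of the discs\<close>

locale collapsing = simple_spectrum +
  fixes \<sigma> :: real
  assumes sigma: "\<sigma> = 1 \<or> \<sigma> = -1"
begin

abbreviation "X \<equiv> isospectral_space n lam"
abbreviation "x \<equiv> gap_crit"
abbreviation "s \<equiv> gap_sign"
abbreviation "M \<equiv> level \<sigma>"

definition K :: "nat set" where
  "K = {j \<in> {1..<n}. s j = \<sigma> \<and> \<sigma> * F (x j) = M}"

definition J :: "nat set" where
  "J = {1..<n} - K"

lemma finite_J: "finite J"
  by (simp add: J_def)

definition enum :: "nat \<Rightarrow> nat" where
  "enum = (SOME e. bij_betw e {0..<card J} J)"

definition slot :: "nat \<Rightarrow> nat" where
  "slot j = n + 2 + the_inv_into {0..<card J} enum j"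

text \<open>Equal to \<open>2 * n + 1 - card K\<close>: the disc loses one dimension for every gap
  of \<open>K\<close> other than its own.\<close>

definition dim :: nat where
  "dim = n + 2 + card J"

lemma enum: "bij_betw enum {0..<card J} J"
  unfolding enum_def using ex_bij_betw_nat_finite[OF finite_J] by (rule someI_ex)

lemma slot_enum: "l < card J \<Longrightarrow> slot (enum l) = n + 2 + l"
  using enum by (auto simp: slot_def bij_betw_def the_inv_into_f_f)

lemma enum_J: "l < card J \<Longrightarrow> enum l \<in> J"
  using enum by (auto simp: bij_betw_def)

lemma enum_slot:
  assumes "j \<in> J"
  obtains l where "l < card J" "slot j = n + 2 + l" "enum l = j"
proof -
  obtain l where "l < card J" "enum l = j"
    using enum assms unfolding bij_betw_def by force
  then show ?thesis
    using slot_enum that by blast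
qed

lemma sigma_sq [simp]: "\<sigma> * \<sigma> = 1" "\<sigma> * (\<sigma> * y) = y"
  using sigma by auto

lemma M_pos: "M > 0"
  using level_pos sigma by blast

lemma KD: "k \<in> K \<Longrightarrow> k \<in> {1..<n}" "k \<in> K \<Longrightarrow> s k = \<sigma>" "k \<in> K \<Longrightarrow> \<sigma> * F (x k) = M"
  by (auto simp: K_def)

lemma JD: "j \<in> J \<Longrightarrow> j \<in> {1..<n}" "j \<in> J \<Longrightarrow> j \<notin> K"
  by (auto simp: J_def)

lemma crit_gap: "j \<in> {1..<n} \<Longrightarrow> x j \<in> gap j"
  by (rule gap_crit)

lemma F_K_le:
  assumes "k \<in> K" "y \<in> gap k"
  shows "\<sigma> * F y \<le> M" "\<sigma> * F y = M \<Longrightarrow> y = x k"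
  using gap_crit_unique[OF KD(1)[OF assms(1)] assms(2)] KD(2,3)[OF assms(1)] by (cases "y = x k"; fastforce)+

lemma F_J_gt:
  assumes "j \<in> J" "s j = \<sigma>"
  shows "\<sigma> * F (x j) > M"
  using level_le[of j \<sigma>] assms by (auto simp: J_def K_def)

text \<open>
  The coordinates \<open>u i\<close> of the disc belonging to the gap \<open>k \<in> K\<close>: phases of the entries \<open>b (i + 1)\<close> for
  \<open>i < n - 1\<close>, the imaginary part of \<open>\<Prod>i. b i\<close> for \<open>i = n - 1\<close>, the displacement of the node in the gap \<open>k\<close>
  for \<open>i = n\<close>, the normalised difference of the two roots \<open>p k\<close> and \<open>\<bar>B\<bar>\<^sup>2 / p k\<close> for \<open>i = n + 1\<close>, and
  the displacement of the node in the gap \<open>j \<in> J\<close> for \<open>i = slot j\<close>.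
\<close>
definition mu :: "nat \<Rightarrow> (nat \<Rightarrow> real) \<Rightarrow> nat \<Rightarrow> real" where
  "mu k u j = x j + (if j = k then u n else if j \<in> J then u (slot j) else 0)"

text \<open>Node and root difference of gap \<open>k\<close> are free coordinates, and
  \<open>B\<close> has to follow them: this is the value of \<open>2 |B| - 2 \<sigma> Re B\<close>
  for which \<open>cc k u k\<close> exceeds \<open>2 |B|\<close> by exactly
  \<open>(u (n + 1))\<^sup>2\<close>.\<close>

definition gg :: "nat \<Rightarrow> (nat \<Rightarrow> real) \<Rightarrow> real" where
  "gg k u = \<sigma> * F (mu k u k) - (u (n + 1))\<^sup>2"

abbreviation (input) "tau u \<equiv> u (n - 1)"

text \<open>Here \<open>Bre\<close> is \<open>\<sigma> Re B\<close> and \<open>Bmod\<close> is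
  \<open>|B|\<close>. Their difference is prescribed as \<open>Bmod - Bre = gg / 2\<close>, and
  \<open>(Bmod - Bre) * (Bmod + Bre) = (Im B)\<^sup>2\<close> then gives the sum.\<close>

definition Bre :: "nat \<Rightarrow> (nat \<Rightarrow> real) \<Rightarrow> real" where
  "Bre k u = (tau u)\<^sup>2 / gg k u - gg k u / 4"

definition Bmod :: "nat \<Rightarrow> (nat \<Rightarrow> real) \<Rightarrow> real" where
  "Bmod k u = (tau u)\<^sup>2 / gg k u + gg k u / 4"

text \<open>
  \<open>prodB k u\<close> lies on the parabola \<open>2 \<bar>B\<bar> - 2 \<sigma> Re B = gg k u\<close>. The values \<open>gg k u \<le> M\<close> fill the
  admissible region, and \<open>gg k u = M\<close> is the boundary on which the gaps in \<open>K\<close> are collapsed.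
\<close>
definition prodB :: "nat \<Rightarrow> (nat \<Rightarrow> real) \<Rightarrow> complex" where
  "prodB k u = Complex (\<sigma> * Bre k u) (tau u)"

definition cc :: "nat \<Rightarrow> (nat \<Rightarrow> real) \<Rightarrow> nat \<Rightarrow> real" where
  "cc k u j = s j * (F (mu k u j) + 2 * (\<sigma> * Bre k u))"

text \<open>A square root of the discriminant \<open>cc\<^sup>2 - 4 * Bmod\<^sup>2\<close>. In gap
  \<open>k\<close> the discriminant is \<open>u (n + 1)\<close> squared times a positive factor, so
  a continuous signed root exists and reaches both roots; elsewhere the nonnegative root selects one
  of them.\<close>

definition root_diff :: "nat \<Rightarrow> (nat \<Rightarrow> real) \<Rightarrow> nat \<Rightarrow> real" where
  "root_diff k u j = (if j = k then u (n + 1) * sqrt ((u (n + 1))\<^sup>2 + 4 * Bmod k u)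
     else sqrt ((cc k u j)\<^sup>2 - 4 * (Bmod k u)\<^sup>2))"

definition qq :: "nat \<Rightarrow> (nat \<Rightarrow> real) \<Rightarrow> nat \<Rightarrow> real" where
  "qq k u j = (cc k u j + root_diff k u j) / 2"

definition pp :: "nat \<Rightarrow> (nat \<Rightarrow> real) \<Rightarrow> nat \<Rightarrow> real" where
  "pp k u j = - s j * qq k u j"

text \<open>The last two inequalities are \<open>cc k u j > 2 * Bmod k u\<close> for the two signs
  of gaps in \<open>J\<close>, cleared of denominators. In \<open>K\<close> the weak inequality is
  automatic.\<close>

definition W :: "nat \<Rightarrow> (nat \<Rightarrow> real) set" where
  "W k = topspace (Euclidean_space dim) \<inter>
     {u. (\<forall>j\<in>{1..<n}. lam j < mu k u j \<and> mu k u j < lam (Suc j)) \<and> 0 < gg k u \<and>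
       (\<forall>j\<in>J. (s j = \<sigma> \<longrightarrow> gg k u < \<sigma> * F (mu k u j)) \<and>
              (s j \<noteq> \<sigma> \<longrightarrow> 4 * (tau u)\<^sup>2 < s j * F (mu k u j) * gg k u))}"

lemma continuous_on_mu: "continuous_on S (\<lambda>u. mu k u j)"
  unfolding mu_def by (intro continuous_intros continuous_on_If_const)

lemma continuous_on_gg: "continuous_on S (gg k)"
  unfolding gg_def by (intro continuous_intros continuous_on_mu)

lemma openin_W: "openin (Euclidean_space dim) (W k)"
proof -
  have "open {u. (\<forall>j\<in>{1..<n}. lam j < mu k u j \<and> mu k u j < lam (Suc j)) \<and> 0 < gg k u \<and>
       (\<forall>j\<in>J. (s j = \<sigma> \<longrightarrow> gg k u < \<sigma> * F (mu k u j)) \<and>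
              (s j \<noteq> \<sigma> \<longrightarrow> 4 * (tau u)\<^sup>2 < s j * F (mu k u j) * gg k u))}"
    by (intro open_Collect_conj open_Collect_finite_ball open_Collect_imp_const open_Collect_less finite_J
        finite_atLeastLessThan continuous_intros continuous_on_mu continuous_on_gg)
  then show ?thesis
    unfolding W_def Euclidean_space_def by (simp add: euclidean_product_topology openin_open_Int)
qed

lemma mu_0 [simp]: "mu k (\<lambda>_. 0) j = x j"
  by (simp add: mu_def)

lemma gg_0: "k \<in> K \<Longrightarrow> gg k (\<lambda>_. 0) = M"
  using KD(3) by (simp add: gg_def)

lemma zero_in_W:
  assumes "k \<in> K"
  shows "(\<lambda>_. 0) \<in> W k"
  using gap_crit(1) F_J_gt F_sign[OF gap_crit(1)] JD(1) M_pos
  by (auto simp: W_def topspace_Euclidean_space gg_0[OF assms] gap_def)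

lemma mu_gap: "u \<in> W k \<Longrightarrow> j \<in> {1..<n} \<Longrightarrow> mu k u j \<in> gap j"
  by (simp add: W_def gap_def)

lemma gg_pos: "u \<in> W k \<Longrightarrow> gg k u > 0"
  by (simp add: W_def)

lemma gg_le:
  assumes "k \<in> K" "u \<in> W k"
  shows "gg k u \<le> M" "gg k u = M \<Longrightarrow> mu k u k = x k \<and> u (n + 1) = 0"
proof -
  have *: "\<sigma> * F (mu k u k) \<le> M" "\<sigma> * F (mu k u k) = M \<Longrightarrow> mu k u k = x k"
    using F_K_le[OF assms(1)] mu_gap[OF assms(2)] KD(1)[OF assms(1)] by auto
  have z: "(u (n + 1))\<^sup>2 \<ge> 0" by simp
  show "gg k u \<le> M"
    using *(1) z unfolding gg_def by linarith
  assume "gg k u = M"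
  then have "(u (n + 1))\<^sup>2 = 0" "\<sigma> * F (mu k u k) = M"
    using *(1) z unfolding gg_def by linarith+
  then show "mu k u k = x k \<and> u (n + 1) = 0"
    using * by simp
qed

lemma Bmod_pos: "u \<in> W k \<Longrightarrow> Bmod k u > 0"
  using gg_pos[of u k] by (simp add: Bmod_def add_nonneg_pos)

lemma Bre_Bmod: "2 * Bre k u = 2 * Bmod k u - gg k u"
  by (simp add: Bre_def Bmod_def)

lemma cmod_prodB:
  assumes "u \<in> W k"
  shows "cmod (prodB k u) = Bmod k u"
proof -
  have "(cmod (prodB k u))\<^sup>2 = (Bre k u)\<^sup>2 + (tau u)\<^sup>2"
    using sigma by (auto simp: prodB_def cmod_power2)
  also have "\<dots> = (Bmod k u)\<^sup>2"
    using gg_pos[OF assms] by (simp add: Bre_def Bmod_def field_simps power2_eq_square)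
  finally show ?thesis
    using Bmod_pos[OF assms] by (metis less_imp_le norm_ge_zero power2_eq_iff_nonneg)
qed

lemma cc_k: "k \<in> K \<Longrightarrow> cc k u k = 2 * Bmod k u + (u (n + 1))\<^sup>2"
  using Bre_Bmod[of k u] by (simp add: cc_def KD gg_def algebra_simps)

text \<open>All other gaps of \<open>K\<close> share the excess \<open>M - gg k u\<close> over
  \<open>2 * Bmod k u\<close>, which is nonnegative and vanishes only where gap \<open>k\<close>
  collapses as well.\<close>

lemma cc_K:
  assumes "k \<in> K" "j \<in> K" "j \<noteq> k"
  shows "cc k u j = 2 * Bmod k u + (M - gg k u)"
proof -
  have "mu k u j = x j"
    using assms by (simp add: mu_def J_def)
  then have "cc k u j = \<sigma> * F (x j) + 2 * Bre k u"
    using KD(2)[OF assms(2)] by (simp add: cc_def algebra_simps)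
  then show ?thesis
    using Bre_Bmod[of k u] KD(3)[OF assms(2)] by simp
qed

lemma cc_J:
  assumes u: "u \<in> W k" and j: "j \<in> J"
  shows "cc k u j > 2 * Bmod k u"
proof (cases "s j = \<sigma>")
  case True
  then have "cc k u j = \<sigma> * F (mu k u j) + 2 * Bre k u"
    by (simp add: cc_def algebra_simps)
  moreover have "gg k u < \<sigma> * F (mu k u j)"
    using u j True by (simp add: W_def)
  ultimately show ?thesis
    using Bre_Bmod[of k u] by simp
next
  case False
  then have "s j = - \<sigma>"
    using sigma gap_sign_cases[of j] by auto
  then have "cc k u j = s j * F (mu k u j) - 2 * Bre k u"
    by (simp add: cc_def algebra_simps)
  moreover have "4 * (tau u)\<^sup>2 < s j * F (mu k u j) * gg k u"
    using u j False by (simp add: W_def)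
  then have "4 * (tau u)\<^sup>2 / gg k u < s j * F (mu k u j)"
    using gg_pos[OF u] by (simp add: pos_divide_less_eq)
  ultimately show ?thesis
    by (simp add: Bre_def Bmod_def)
qed

lemma cc_ge:
  assumes "k \<in> K" "u \<in> W k" "j \<in> {1..<n}"
  shows "cc k u j \<ge> 2 * Bmod k u"
proof -
  consider "j = k" | "j \<in> K" "j \<noteq> k" | "j \<in> J"
    using assms by (auto simp: J_def)
  then show ?thesis
  proof cases
    case 1
    then show ?thesis using cc_k[OF assms(1)] by simp
  next
    case 2
    then show ?thesis using cc_K[OF assms(1) 2] gg_le(1)[OF assms(1,2)] by simp
  next
    case 3
    then show ?thesis using cc_J[OF assms(2)] less_imp_le by blast
  qed
qed

lemma root_diff_sq:
  assumes "k \<in> K" "u \<in> W k" "j \<in> {1..<n}"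
  shows "(root_diff k u j)\<^sup>2 = (cc k u j)\<^sup>2 - 4 * (Bmod k u)\<^sup>2"
proof (cases "j = k")
  case True
  then show ?thesis
    using Bmod_pos[OF assms(2)] cc_k[OF assms(1), of u]
    by (simp add: root_diff_def power_mult_distrib add_nonneg_nonneg) (simp add: power2_eq_square algebra_simps)
next
  case False
  have "(2 * Bmod k u)\<^sup>2 \<le> (cc k u j)\<^sup>2"
    using cc_ge[OF assms] Bmod_pos[OF assms(2)] by (intro power_mono) auto
  then show ?thesis
    using False by (simp add: root_diff_def power_mult_distrib)
qed

lemma qq:
  assumes "k \<in> K" "u \<in> W k" "j \<in> {1..<n}"
  shows "qq k u j > 0" "qq k u j + (Bmod k u)\<^sup>2 / qq k u j = cc k u j"
    "qq k u j - (Bmod k u)\<^sup>2 / qq k u j = root_diff k u j"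
  unfolding qq_def using quadratic_root[OF Bmod_pos cc_ge root_diff_sq] assms by blast+

lemma inverse_gap_sign: "y / (- s j * q) = - s j * (y / q)"
  using gap_sign_cases[of j] by auto

lemma pp_sum:
  assumes "k \<in> K" "u \<in> W k" "j \<in> {1..<n}"
  shows "pp k u j + (Bmod k u)\<^sup>2 / pp k u j = - s j * cc k u j"
    "- s j * (pp k u j - (Bmod k u)\<^sup>2 / pp k u j) = root_diff k u j"
proof -
  show "pp k u j + (Bmod k u)\<^sup>2 / pp k u j = - s j * cc k u j"
    unfolding pp_def inverse_gap_sign qq(2)[OF assms, symmetric] by (simp add: algebra_simps)
  have "- s j * (pp k u j - (Bmod k u)\<^sup>2 / pp k u j) = (s j * s j) * (qq k u j - (Bmod k u)\<^sup>2 / qq k u j)"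
    unfolding pp_def inverse_gap_sign by (simp only: algebra_simps minus_mult_minus)
  then show "- s j * (pp k u j - (Bmod k u)\<^sup>2 / pp k u j) = root_diff k u j"
    unfolding qq(3)[OF assms] by simp
qed

lemma nodes_eq: "{1..n - 1} = {1..<n}"
  using n by auto

lemma spectral_data_W:
  assumes "k \<in> K" "u \<in> W k"
  shows "spectral_data n lam (n - 1) (mu k u) (pp k u) (prodB k u)"
proof (intro spectral_data.intro simple_spectrum_axioms spectral_data_axioms.intro)
  show "n = Suc (n - 1)"
    using n by simp
  show "prodB k u \<noteq> 0"
    using cmod_prodB[OF assms(2)] Bmod_pos[OF assms(2)] by auto
  fix j assume "j \<in> {1..n - 1}"
  then have j: "j \<in> {1..<n}" by (simp only: nodes_eq)
  show "mu k u j \<in> gap j"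
    using mu_gap[OF assms(2) j] .
  have "- s j * pp k u j = (s j * s j) * qq k u j"
    unfolding pp_def by (simp only: mult.assoc mult_minus_left mult_minus_right minus_minus)
  then show "- s j * pp k u j > 0"
    using qq(1)[OF assms j] by simp
  have "- s j * cc k u j = - ((s j * s j) * (F (mu k u j) + 2 * (\<sigma> * Bre k u)))"
    unfolding cc_def by (simp only: mult.assoc mult_minus_left)
  then show "pp k u j + (cmod (prodB k u))\<^sup>2 / pp k u j = - (F (mu k u j) + 2 * Re (prodB k u))"
    unfolding cmod_prodB[OF assms(2)] pp_sum(1)[OF assms j] by (simp add: prodB_def)
qed

definition phi :: "(nat \<Rightarrow> real) \<Rightarrow> nat \<Rightarrow> real" where
  "phi u j = u (j - 1)"

definition alp_a :: "nat \<Rightarrow> (nat \<Rightarrow> real) \<Rightarrow> nat \<Rightarrow> real" where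
  "alp_a k u = rec_a (n - 1) (lam 1) (mu k u) (pp k u) (prodB k u)"

definition alp_b :: "nat \<Rightarrow> (nat \<Rightarrow> real) \<Rightarrow> nat \<Rightarrow> complex" where
  "alp_b k u = rec_b (n - 1) (mu k u) (pp k u) (prodB k u) (phi u)"

definition alp :: "nat \<Rightarrow> (nat \<Rightarrow> real) \<Rightarrow> complex mat" where
  "alp k u = periodic_tridiagonal n (alp_a k u) (alp_b k u)"

lemma alp_in_X: "k \<in> K \<Longrightarrow> u \<in> W k \<Longrightarrow> alp k u \<in> topspace X"
  unfolding alp_def alp_a_def alp_b_def by (rule spectral_data.rec_in_isospectral[OF spectral_data_W])

lemma continuous_alp:
  assumes k: "k \<in> K"
  shows "continuous_map (subtopology (Euclidean_space dim) (W k)) X (alp k)"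
proof -
  have g0: "gg k u \<noteq> 0" if "u \<in> W k" for u
    using gg_pos[OF that] by simp
  have Bre: "continuous_on (W k) (Bre k)" and Bmod: "continuous_on (W k) (Bmod k)"
    unfolding Bre_def Bmod_def using g0 by (intro continuous_intros continuous_on_gg; simp)+
  have cc: "continuous_on (W k) (\<lambda>u. cc k u j)" for j
    unfolding cc_def by (intro continuous_intros continuous_on_mu Bre)
  have pp: "continuous_on (W k) (\<lambda>u. pp k u j)" for j
    unfolding pp_def qq_def root_diff_def
    by (intro continuous_intros continuous_on_If_const cc Bmod) auto
  have B: "continuous_on (W k) (prodB k)"
    unfolding prodB_def Complex_eq by (intro continuous_intros Bre)
  have phi: "continuous_on (W k) (\<lambda>u. phi u j)" for j
    unfolding phi_def by (intro continuous_intros)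
  have ab: "continuous_on (W k) (\<lambda>u. alp_b k u i)" "continuous_on (W k) (\<lambda>u. alp_a k u i)" for i
    unfolding alp_a_def alp_b_def
    by (rule continuous_on_rec[OF spectral_data_W[OF k]], (assumption | rule continuous_on_mu pp B phi)+)+
  have sub: "subtopology (Euclidean_space dim) (W k) = top_of_set (W k)"
    unfolding Euclidean_space_def euclidean_product_topology subtopology_subtopology
    using openin_subset[OF openin_W, of k] by (simp add: topspace_Euclidean_space inf.absorb2)
  have "continuous_map (top_of_set (W k)) (matrix_topology n) (alp k)"
  proof (rule continuous_map_into_matrix_topology)
    fix i j assume ij: "i < n" "j < n"
    have "continuous_on (W k) (\<lambda>u. periodic_tridiagonal_entry n (alp_a k u) (alp_b k u) (Suc i) (Suc j))"
      unfolding periodic_tridiagonal_entry_def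
      by (intro continuous_on_If_const continuous_intros ab)
    then show "continuous_map (top_of_set (W k)) euclidean (\<lambda>u. alp k u $$ (i, j))"
      using ij by (simp add: alp_def periodic_tridiagonal_def)
  qed (simp add: alp_def)
  then show ?thesis
    unfolding sub isospectral_space_def continuous_map_in_subtopology
    using alp_in_X[OF k] by (auto simp: topspace_isospectral)
qed

end

section \<open>Functions of the matrix entries\<close>

text \<open>Extended by zero to all index pairs, the entries lie in a type with a topology, where
  open conditions and continuous functions can be handled and then pulled back.\<close>

definition ent :: "nat \<Rightarrow> complex mat \<Rightarrow> nat \<times> nat \<Rightarrow> complex" where
  "ent n L = (\<lambda>(i, j). if i < n \<and> j < n then L $$ (i, j) else 0)"

definition Ea :: "nat \<Rightarrow> (nat \<times> nat \<Rightarrow> complex) \<Rightarrow> nat \<Rightarrow> real" where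
  "Ea n E i = (if i \<in> {1..n} then Re (E (i - 1, i - 1)) else 0)"

definition Eb :: "nat \<Rightarrow> (nat \<times> nat \<Rightarrow> complex) \<Rightarrow> nat \<Rightarrow> complex" where
  "Eb n E i = (if i \<in> {1..<n} then E (i - 1, i) else if i = n then E (n - 1, 0) else 0)"

definition EA :: "nat \<Rightarrow> (nat \<times> nat \<Rightarrow> complex) \<Rightarrow> real \<Rightarrow> real" where
  "EA n E y = poly (tridet (Ea n E) (sqmod (Eb n E)) 0 (n - 1)) y"

text \<open>At a node \<open>\<mu> j\<close> this is \<open>p j\<close>, and \<open>Ec\<close> is
  \<open>|B|\<^sup>2 / p j\<close>. Unlike the node itself, both are visibly continuous in the
  matrix at any fixed \<open>y\<close>.\<close>

definition Ep :: "nat \<Rightarrow> (nat \<times> nat \<Rightarrow> complex) \<Rightarrow> real \<Rightarrow> real" where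
  "Ep n E y = sqmod (Eb n E) n * poly (tridet (Ea n E) (sqmod (Eb n E)) 1 (n - 2)) y"

definition Ec :: "nat \<Rightarrow> (nat \<times> nat \<Rightarrow> complex) \<Rightarrow> real \<Rightarrow> real" where
  "Ec n E y = sqmod (Eb n E) (n - 1) * poly (tridet (Ea n E) (sqmod (Eb n E)) 0 (n - 2)) y"

lemma continuous_on_Ea: "continuous_on S (\<lambda>E. Ea n E i)"
  unfolding Ea_def by (intro continuous_on_If_const continuous_intros
      continuous_on_subset[OF continuous_on_product_coordinates] subset_UNIV)

lemma continuous_on_Eb: "continuous_on S (\<lambda>E. Eb n E i)"
  unfolding Eb_def by (intro continuous_on_If_const continuous_intros
      continuous_on_subset[OF continuous_on_product_coordinates] subset_UNIV)

lemma continuous_on_sqmod_Eb: "continuous_on S (\<lambda>E. sqmod (Eb n E) i)"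
  unfolding sqmod_def by (intro continuous_intros continuous_on_Eb)

lemma continuous_on_EA: "continuous_on S (\<lambda>E. EA n E y)"
  and continuous_on_Ep: "continuous_on S (\<lambda>E. Ep n E y)"
  and continuous_on_Ec: "continuous_on S (\<lambda>E. Ec n E y)"
  unfolding EA_def Ep_def Ec_def
  by (intro continuous_on_mult continuous_on_poly_tridet continuous_on_Ea continuous_on_sqmod_Eb continuous_on_const)+

lemma ent_periodic_tridiagonal:
  assumes "3 \<le> n" "\<And>i. i \<notin> {1..n} \<Longrightarrow> a i = 0" "\<And>i. i \<notin> {1..n} \<Longrightarrow> b i = 0"
  shows "Ea n (ent n (periodic_tridiagonal n a b)) = a" "Eb n (ent n (periodic_tridiagonal n a b)) = b"
proof -
  show "Ea n (ent n (periodic_tridiagonal n a b)) = a"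
  proof
    fix i
    show "Ea n (ent n (periodic_tridiagonal n a b)) i = a i"
      using assms(2)[of i] by (cases "i \<in> {1..n}") (auto simp: Ea_def ent_def periodic_tridiagonal_def periodic_tridiagonal_entry_def)
  qed
  show "Eb n (ent n (periodic_tridiagonal n a b)) = b"
  proof
    fix i
    show "Eb n (ent n (periodic_tridiagonal n a b)) i = b i"
      using assms(1) assms(3)[of i] by (cases "i = n"; cases "i \<in> {1..n}") (auto simp: Eb_def ent_def periodic_tridiagonal_def periodic_tridiagonal_entry_def)
  qed
qed

lemma periodic_tridiagonal_cong:
  assumes "3 \<le> n" "\<And>i. i \<in> {1..n} \<Longrightarrow> a i = a' i" "\<And>i. i \<in> {1..n} \<Longrightarrow> b i = b' i"
  shows "periodic_tridiagonal n a b = periodic_tridiagonal n a' b'"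
  by (rule eq_matI) (use assms in \<open>auto simp: periodic_tridiagonal_def periodic_tridiagonal_entry_def\<close>)

lemma isospectral_eq_periodic:
  assumes "3 \<le> n" "L \<in> topspace (isospectral_space n lam)"
  shows "L = periodic_tridiagonal n (Ea n (ent n L)) (Eb n (ent n L))"
proof -
  obtain a b where L: "L = periodic_tridiagonal n a b"
    using assms(2) by (auto simp: topspace_isospectral)
  define a' b' where "a' i = (if i \<in> {1..n} then a i else 0)" and "b' i = (if i \<in> {1..n} then b i else 0)" for i
  have L': "L = periodic_tridiagonal n a' b'"
    unfolding L by (rule periodic_tridiagonal_cong) (auto simp: assms a'_def b'_def)
  have z: "a' i = 0" "b' i = 0" if "i \<notin> {1..n}" for i
    unfolding a'_def b'_def using that by presburger+
  have "Ea n (ent n L) = a'" "Eb n (ent n L) = b'"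
    unfolding L' using ent_periodic_tridiagonal[of n a' b'] assms(1) z by blast+
  with L' show ?thesis by simp
qed

lemma continuous_map_ent: "continuous_map (isospectral_space n lam) euclidean (ent n)"
proof -
  have "continuous_map (isospectral_space n lam) euclidean (\<lambda>L. ent n L (i, j))" for i j
    unfolding isospectral_space_def
    by (cases "i < n \<and> j < n")
      (auto simp: ent_def intro!: continuous_map_from_subtopology continuous_map_matrix_entry)
  then have "continuous_map (isospectral_space n lam) (product_topology (\<lambda>_. euclidean) UNIV) (ent n)"
    unfolding continuous_map_componentwise_UNIV by (metis surj_pair)
  then show ?thesis
    by (simp add: euclidean_product_topology)
qed

lemma continuous_map_ent_compose:
  assumes "continuous_on UNIV f"
  shows "continuous_map (isospectral_space n lam) euclidean (\<lambda>L. f (ent n L))"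
  using continuous_map_compose[OF continuous_map_ent, of euclidean f] assms by (simp add: o_def)

section \<open>The local structure at the singular point\<close>

context collapsing
begin

text \<open>Open conditions, valid at the singular point, that remove the discrete ambiguities: the
  first makes \<open>EA\<close> change sign in every gap and be nonzero at the eigenvalues, the next
  two fix the signs of the entries once these are real, and the last singles out the larger root in
  the gaps of \<open>J\<close>.\<close>

definition nbhd :: "complex mat set" where
  "nbhd = {L \<in> topspace X. ent n L \<in>
     {E. (\<forall>i\<in>{1..n}. 0 < EA n E (lam i) * (\<Prod>j = 1..n - 1. lam i - x j)) \<and>
         (\<forall>i\<in>{1..<n}. 0 < Re (Eb n E i)) \<and> \<sigma> * Re (Eb n E n) < 0 \<and>
         (\<forall>j\<in>J. - s j * Ec n E (x j) < - s j * Ep n E (x j))}}"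

lemma openin_nbhd: "openin X nbhd"
  unfolding nbhd_def
proof (rule openin_continuous_map_preimage[OF continuous_map_ent])
  have "open {E. (\<forall>i\<in>{1..n}. 0 < EA n E (lam i) * (\<Prod>j = 1..n - 1. lam i - x j)) \<and>
         (\<forall>i\<in>{1..<n}. 0 < Re (Eb n E i)) \<and> \<sigma> * Re (Eb n E n) < 0 \<and>
         (\<forall>j\<in>J. - s j * Ec n E (x j) < - s j * Ep n E (x j))}"
    by (intro open_Collect_conj open_Collect_finite_ball open_Collect_less finite_J
        finite_atLeastLessThan finite_atLeastAtMost continuous_on_mult continuous_on_const
        continuous_on_EA continuous_on_Ep continuous_on_Ec continuous_on_Re continuous_on_Eb)
  then show "openin euclidean {E. (\<forall>i\<in>{1..n}. 0 < EA n E (lam i) * (\<Prod>j = 1..n - 1. lam i - x j)) \<and>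
         (\<forall>i\<in>{1..<n}. 0 < Re (Eb n E i)) \<and> \<sigma> * Re (Eb n E n) < 0 \<and>
         (\<forall>j\<in>J. - s j * Ec n E (x j) < - s j * Ep n E (x j))}"
    by simp
qed

text \<open>A substitute for the inverse of \<open>alp k\<close>: a component only needs the sign of
  the corresponding coordinate once earlier ones vanish, so values at the critical points can
  replace the displacements of the nodes. The gaps of \<open>K\<close> other than \<open>k\<close>
  have no component.\<close>

definition bet :: "nat \<Rightarrow> complex mat \<Rightarrow> nat \<Rightarrow> real" where
  "bet k L i =
     (if i < dim then
        if i < n then Im (Eb n (ent n L) (Suc i))
        else if i = n then s k * EA n (ent n L) (x k)
        else if i = n + 1 then - \<sigma> * (Ep n (ent n L) (x k) - Ec n (ent n L) (x k))
        else s (enum (i - (n + 2))) * EA n (ent n L) (x (enum (i - (n + 2))))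
      else 0)"

lemma continuous_bet: "continuous_map X (Euclidean_space dim) (bet k)"
proof -
  have *: "continuous_on UNIV (\<lambda>E. if i < n then Im (Eb n E (Suc i))
        else if i = n then s k * EA n E (x k)
        else if i = n + 1 then - \<sigma> * (Ep n E (x k) - Ec n E (x k))
        else s (enum (i - (n + 2))) * EA n E (x (enum (i - (n + 2)))))" for i
    by (intro continuous_on_If_const continuous_intros continuous_on_EA continuous_on_Ep continuous_on_Ec continuous_on_Eb)
  show ?thesis
    unfolding bet_def continuous_map_componentwise_Euclidean_space
    using continuous_map_ent_compose[OF *] by blast
qed

lemma bet_eq_0_iff:
  "bet k L = (\<lambda>_. 0) \<longleftrightarrow>
     (\<forall>i\<in>{1..n}. Im (Eb n (ent n L) i) = 0) \<and> EA n (ent n L) (x k) = 0 \<and>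
     Ep n (ent n L) (x k) = Ec n (ent n L) (x k) \<and> (\<forall>j\<in>J. EA n (ent n L) (x j) = 0)"
    (is "?l \<longleftrightarrow> ?r")
proof
  have s0: "s j \<noteq> 0" for j
    using gap_sign_cases[of j] by auto
  {
    assume ?l
    then have b: "bet k L i = 0" for i by simp
    show ?r
    proof (intro conjI ballI)
      fix i assume "i \<in> {1..n}"
      then obtain l where "i = Suc l" "l < n"
        by (cases i) auto
      then show "Im (Eb n (ent n L) i) = 0"
        using b[of l] by (simp add: bet_def dim_def)
    next
      show "EA n (ent n L) (x k) = 0"
        using b[of n] s0[of k] by (simp add: bet_def dim_def)
    next
      show "Ep n (ent n L) (x k) = Ec n (ent n L) (x k)"
        using b[of "n + 1"] sigma by (auto simp: bet_def dim_def)
    next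
      fix j assume "j \<in> J"
      then obtain l where "l < card J" "enum l = j"
        using enum_slot by metis
      then show "EA n (ent n L) (x j) = 0"
        using b[of "n + 2 + l"] s0[of j] by (simp add: bet_def dim_def)
    qed
  }
  {
    assume ?r
    then show ?l
      using enum_J by (auto simp: bet_def dim_def fun_eq_iff)
  }
qed

section \<open>The common zero of the projections\<close>

lemma nbhdD:
  assumes "L \<in> nbhd"
  shows "L \<in> topspace X" "\<And>i. i \<in> {1..n} \<Longrightarrow> 0 < EA n (ent n L) (lam i) * (\<Prod>j = 1..n - 1. lam i - x j)"
    "\<And>i. i \<in> {1..<n} \<Longrightarrow> 0 < Re (Eb n (ent n L) i)" "\<sigma> * Re (Eb n (ent n L) n) < 0"
    "\<And>j. j \<in> J \<Longrightarrow> - s j * Ec n (ent n L) (x j) < - s j * Ep n (ent n L) (x j)"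
  using assms by (auto simp: nbhd_def)

abbreviation "prodb L \<equiv> (\<Prod>i = 1..n. Eb n (ent n L) i)"

lemma nbhd_percharpoly:
  assumes L: "L \<in> nbhd"
  shows "percharpoly n (Ea n (ent n L)) (sqmod (Eb n (ent n L))) (Re (prodb L)) = Fp"
  unfolding Fp_def
proof (rule percharpoly_eq_prod[OF n inj_lam])
  show "spectrum (periodic_tridiagonal n (Ea n (ent n L)) (Eb n (ent n L))) = (\<lambda>i. complex_of_real (lam i)) ` {1..n}"
    using isospectral_eq_periodic[OF n nbhdD(1)[OF L]] nbhdD(1)[OF L] by (simp add: topspace_isospectral)
  show "poly (tridet (Ea n (ent n L)) (sqmod (Eb n (ent n L))) 0 (n - 1)) (lam i) \<noteq> 0" if "i \<in> {1..n}" for i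
    using nbhdD(2)[OF L that] by (auto simp: EA_def)
  show "Eb n (ent n L) i \<noteq> 0" if "i \<in> {1..<n}" for i
    using nbhdD(3)[OF L that] by auto
qed

lemma nbhd_b_nz:
  assumes "L \<in> nbhd" "i \<in> {1..n}"
  shows "Eb n (ent n L) i \<noteq> 0"
proof (cases "i = n")
  case True
  then show ?thesis
    using nbhdD(4)[OF assms(1)] by auto
next
  case False
  then show ?thesis
    using nbhdD(3)[OF assms(1), of i] assms(2) by auto
qed

lemma cmod_prodb: "(cmod (prodb L))\<^sup>2 = (\<Prod>i = 1..n. sqmod (Eb n (ent n L)) i)"
  by (simp add: sqmod_def prod_norm[symmetric] prod_power_distrib)

text \<open>The decoupled quadratic equation in terms of matrix entries: the product comes from the
  Wronskian identity, the sum from the characteristic polynomial at a zero of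
  \<open>EA\<close>.\<close>

lemma cofactors_at_root:
  assumes L: "L \<in> nbhd" and y: "EA n (ent n L) y = 0"
  shows "Ep n (ent n L) y * Ec n (ent n L) y = (cmod (prodb L))\<^sup>2"
    "Ep n (ent n L) y + Ec n (ent n L) y = - (F y + 2 * Re (prodb L))"
proof -
  let ?a = "Ea n (ent n L)" and ?r = "sqmod (Eb n (ent n L))"
  obtain k where k: "n = Suc (Suc (Suc k))"
    using n by (metis Suc_diff_Suc Suc_le_eq numeral_3_eq_3 le_Suc_ex add_Suc)
  then have idx: "n - 1 = Suc (Suc k)" "n - 2 = Suc k"
    by simp_all
  have "poly (tridet ?a ?r 0 (Suc (Suc k))) y = 0"
    using y unfolding EA_def idx .
  then have w: "poly (tridet ?a ?r 0 (Suc k)) y * poly (tridet ?a ?r (Suc 0) (Suc k)) y = (\<Prod>i = Suc 0..Suc k. ?r i)"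
    using tridet_wronskian[of ?a ?r 0 k y] by (simp del: tridet.simps)
  have prod3: "(\<Prod>i = Suc 0..Suc (Suc (Suc k)). f i) = f (Suc (Suc (Suc k))) * f (Suc (Suc k)) * (\<Prod>i = Suc 0..Suc k. f i)"
    for f :: "nat \<Rightarrow> real"
    by (simp add: prod.nat_ivl_Suc' mult_ac)
  have "Ep n (ent n L) y * Ec n (ent n L) y
      = ?r n * ?r (n - 1) * (poly (tridet ?a ?r 0 (Suc k)) y * poly (tridet ?a ?r (Suc 0) (Suc k)) y)"
    unfolding Ep_def Ec_def idx One_nat_def by (simp only: mult_ac)
  also have "\<dots> = (\<Prod>i = 1..n. ?r i)"
  proof -
    define r where "r = ?r"
    show ?thesis
      unfolding w unfolding r_def[symmetric] using prod3[of r] by (simp add: k)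
  qed
  finally show "Ep n (ent n L) y * Ec n (ent n L) y = (cmod (prodb L))\<^sup>2"
    unfolding cmod_prodb .
  have "F y = poly (percharpoly n ?a ?r (Re (prodb L))) y"
    unfolding nbhd_percharpoly[OF L] by simp
  also have "\<dots> = - Ec n (ent n L) y - Ep n (ent n L) y - 2 * Re (prodb L)"
    using n y by (simp add: poly_percharpoly EA_def Ep_def Ec_def)
  finally show "Ep n (ent n L) y + Ec n (ent n L) y = - (F y + 2 * Re (prodb L))"
    by simp
qed

text \<open>Only the critical point between \<open>lam j\<close> and \<open>lam (Suc j)\<close>
  contributes a negative factor.\<close>

lemma prod_less_sign:
  assumes "j \<in> {1..<n}"
  shows "(\<Prod>i = 1..n - 1. lam j - x i) * (\<Prod>i = 1..n - 1. lam (Suc j) - x i) < 0"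
proof -
  have "(\<Prod>i = 1..n - 1. lam j - x i) * (\<Prod>i = 1..n - 1. lam (Suc j) - x i)
      = (\<Prod>i\<in>{1..<n}. (lam j - x i) * (lam (Suc j) - x i))"
    unfolding nodes_eq by (simp add: prod.distrib)
  also have "\<dots> = ((lam j - x j) * (lam (Suc j) - x j)) * (\<Prod>i\<in>{1..<n} - {j}. (lam j - x i) * (lam (Suc j) - x i))"
    using assms by (subst prod.remove[of _ j]) auto
  also have "\<dots> < 0"
  proof (rule mult_neg_pos)
    show "(lam j - x j) * (lam (Suc j) - x j) < 0"
      using crit_gap[OF assms] by (intro mult_neg_pos) (auto simp: gap_def)
    show "(\<Prod>i\<in>{1..<n} - {j}. (lam j - x i) * (lam (Suc j) - x i)) > 0"
    proof (intro prod_pos)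
      fix i assume i: "i \<in> {1..<n} - {j}"
      have "x i < lam j \<and> x i < lam (Suc j) \<or> lam j < x i \<and> lam (Suc j) < x i"
        using gap_above[OF crit_gap, of i j] gap_above[OF crit_gap, of i "Suc j"]
          gap_below[OF crit_gap, of i j] gap_below[OF crit_gap, of i "Suc j"] i assms
        by (cases "i < j") auto
      then show "0 < (lam j - x i) * (lam (Suc j) - x i)"
        by (auto intro: mult_pos_pos mult_neg_neg)
    qed
  qed
  finally show ?thesis .
qed

lemma root_in_gap:
  assumes L: "L \<in> nbhd" and j: "j \<in> {1..<n}"
  obtains y where "y \<in> gap j" "EA n (ent n L) y = 0"
proof -
  let ?A = "EA n (ent n L)"
  have less: "lam j < lam (Suc j)"
    using j by (intro lam_less) auto
  have cont: "continuous_on {lam j..lam (Suc j)} ?A"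
    unfolding EA_def by (intro continuous_intros)
  have nz: "?A (lam j) \<noteq> 0" "?A (lam (Suc j)) \<noteq> 0"
    using nbhdD(2)[OF L, of j] nbhdD(2)[OF L, of "Suc j"] j by auto
  have "?A (lam j) * ?A (lam (Suc j)) < 0"
    using nbhdD(2)[OF L, of j] nbhdD(2)[OF L, of "Suc j"] prod_less_sign[OF j] j
    by (auto simp: zero_less_mult_iff mult_less_0_iff)
  then have "\<exists>y. lam j \<le> y \<and> y \<le> lam (Suc j) \<and> ?A y = 0"
    using IVT'[of ?A "lam j" 0 "lam (Suc j)"] IVT2'[of ?A "lam (Suc j)" 0 "lam j"] cont less
    by (auto simp: mult_less_0_iff)
  then obtain y where y: "lam j \<le> y" "y \<le> lam (Suc j)" "?A y = 0"
    by blast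
  then have "y \<noteq> lam j" "y \<noteq> lam (Suc j)"
    using nz by auto
  then show thesis
    using y that[of y] by (auto simp: gap_def)
qed

text \<open>These conditions do not mention \<open>k\<close>, and they determine the matrix; so the
  zeros of all the projections coincide.\<close>

definition central :: "complex mat \<Rightarrow> bool" where
  "central L \<longleftrightarrow> L \<in> nbhd \<and> (\<forall>i\<in>{1..n}. Im (Eb n (ent n L) i) = 0) \<and> prodb L = complex_of_real (- \<sigma> * M / 4) \<and>
     (\<forall>j\<in>{1..<n}. EA n (ent n L) (x j) = 0) \<and> (\<forall>j\<in>K. Ep n (ent n L) (x j) = - \<sigma> * M / 4)"

lemma centralD:
  assumes "central L"
  shows "L \<in> nbhd" "\<And>i. i \<in> {1..n} \<Longrightarrow> Im (Eb n (ent n L) i) = 0" "prodb L = complex_of_real (- \<sigma> * M / 4)"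
    "\<And>j. j \<in> {1..<n} \<Longrightarrow> EA n (ent n L) (x j) = 0" "\<And>j. j \<in> K \<Longrightarrow> Ep n (ent n L) (x j) = - \<sigma> * M / 4"
  using assms unfolding central_def by blast+

lemma real_prodb:
  assumes L: "L \<in> nbhd" and im: "\<forall>i\<in>{1..n}. Im (Eb n (ent n L) i) = 0"
  shows "prodb L = complex_of_real (- \<sigma> * cmod (prodb L))"
proof -
  let ?b = "Eb n (ent n L)"
  have "prodb L = (\<Prod>i = 1..n. complex_of_real (Re (?b i)))"
    using im by (intro prod.cong refl) (simp add: complex_eq_iff)
  then have eq: "prodb L = complex_of_real (\<Prod>i = 1..n. Re (?b i))"
    by simp
  have "(\<Prod>i = 1..n. Re (?b i)) = (\<Prod>i\<in>{1..<n}. Re (?b i)) * Re (?b n)"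
  proof -
    have "{1..n} = insert n {1..<n}" using n by auto
    then show ?thesis by simp
  qed
  then have "\<sigma> * (\<Prod>i = 1..n. Re (?b i)) = (\<Prod>i\<in>{1..<n}. Re (?b i)) * (\<sigma> * Re (?b n))"
    by (simp only: mult.left_commute)
  also have "\<dots> < 0"
  proof (rule mult_pos_neg)
    show "(\<Prod>i\<in>{1..<n}. Re (?b i)) > 0"
      using nbhdD(3)[OF L] by (intro prod_pos) auto
  qed (rule nbhdD(4)[OF L])
  finally have neg: "\<sigma> * (\<Prod>i = 1..n. Re (?b i)) < 0" .
  have "y = - \<sigma> * \<bar>y\<bar>" if "\<sigma> * y < 0" for y
    using that sigma by auto
  from this[OF neg] show ?thesis
    unfolding eq norm_of_real by (simp only: of_real_mult[symmetric] of_real_eq_iff)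
qed

text \<open>The double root at \<open>x k\<close> forces \<open>|B| = M / 4\<close>. In any gap of
  \<open>K\<close>, at a zero \<open>y\<close> of \<open>EA\<close>, the discriminant of the
  quadratic is then \<open>\<sigma> F y * (\<sigma> F y - M)\<close>. It is a square, while
  \<open>\<sigma> F y\<close> is positive and at most \<open>M\<close>; hence \<open>y\<close> is
  the critical point and the root is double there too.\<close>

lemma zero_imp_central:
  assumes L: "L \<in> nbhd" and k: "k \<in> K" and zero: "bet k L = (\<lambda>_. 0)"
  shows "central L"
proof -
  let ?E = "ent n L"
  note z = zero[unfolded bet_eq_0_iff]
  define \<beta> where "\<beta> = cmod (prodb L)"
  have B: "prodb L = complex_of_real (- \<sigma> * \<beta>)"
    using real_prodb[OF L] z unfolding \<beta>_def by blast
  have \<beta>: "\<beta> > 0"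
    using nbhd_b_nz[OF L] by (simp add: \<beta>_def)
  have root: "(\<sigma> * Ep n ?E y) * (\<sigma> * Ec n ?E y) = \<beta>\<^sup>2" "\<sigma> * Ep n ?E y + \<sigma> * Ec n ?E y = 2 * \<beta> - \<sigma> * F y"
    if "EA n ?E y = 0" for y
  proof -
    have "(\<sigma> * Ep n ?E y) * (\<sigma> * Ec n ?E y) = Ep n ?E y * Ec n ?E y"
      using sigma by auto
    then show "(\<sigma> * Ep n ?E y) * (\<sigma> * Ec n ?E y) = \<beta>\<^sup>2"
      using cofactors_at_root(1)[OF L that] by (simp add: \<beta>_def)
    have "\<sigma> * Ep n ?E y + \<sigma> * Ec n ?E y = \<sigma> * (- (F y + 2 * Re (prodb L)))"
      unfolding cofactors_at_root(2)[OF L that, symmetric] by (simp add: algebra_simps)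
    then show "\<sigma> * Ep n ?E y + \<sigma> * Ec n ?E y = 2 * \<beta> - \<sigma> * F y"
      unfolding B by (simp add: algebra_simps)
  qed
  \<comment> \<open>The two cofactors agree at \<open>x k\<close>. With \<open>p\<close> for
    \<sigma> times their value, \<open>p\<^sup>2 = \<beta>\<^sup>2\<close> and
    \<open>2 * p = 2 * \<beta> - M\<close>; here \<open>p = \<beta>\<close> would give
    \<open>M = 0\<close>, so \<open>p = - \<beta>\<close>.\<close>
  have \<beta>_eq: "\<beta> = M / 4"
  proof -
    have "(\<sigma> * Ep n ?E (x k))\<^sup>2 = \<beta>\<^sup>2" "2 * (\<sigma> * Ep n ?E (x k)) = 2 * \<beta> - M"
      using root[of "x k"] z KD(3)[OF k] by (simp_all add: power2_eq_square)
    then show ?thesis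
      using \<beta> M_pos by (auto simp: power2_eq_iff)
  qed
  have xK: "EA n ?E (x j) = 0 \<and> \<sigma> * Ep n ?E (x j) = - M / 4" if j: "j \<in> K" for j
  proof -
    obtain y where y: "y \<in> gap j" "EA n ?E y = 0"
      using root_in_gap[OF L KD(1)[OF j]] .
    define p c where "p = \<sigma> * Ep n ?E y" and "c = \<sigma> * Ec n ?E y"
    have pc: "p * c = (M / 4)\<^sup>2" "p + c = M / 2 - \<sigma> * F y"
      using root[OF y(2)] by (simp_all add: p_def c_def \<beta>_eq)
    have pos: "\<sigma> * F y > 0"
      using F_sign[OF y(1) KD(1)[OF j]] KD(2)[OF j] by simp
    have le: "\<sigma> * F y \<le> M"
      using F_K_le(1)[OF j y(1)] .
    have "(p - c)\<^sup>2 = (p + c)\<^sup>2 - 4 * (p * c)"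
      by (simp add: power2_eq_square algebra_simps)
    also have "\<dots> = (\<sigma> * F y) * (\<sigma> * F y - M)"
      unfolding pc by (simp add: power2_eq_square field_simps)
    finally have d: "(p - c)\<^sup>2 = (\<sigma> * F y) * (\<sigma> * F y - M)" .
    have "\<sigma> * F y \<ge> M"
    proof (rule ccontr)
      assume "\<not> \<sigma> * F y \<ge> M"
      then have "(\<sigma> * F y) * (\<sigma> * F y - M) < 0"
        using pos by (intro mult_pos_neg) auto
      then show False
        using d zero_le_power2[of "p - c"] by linarith
    qed
    then have M: "\<sigma> * F y = M"
      using le by simp
    then have "p = c"
      using d by simp
    then have "p = - M / 4"
      using pc(2) M by simp
    then show ?thesis
      using F_K_le(2)[OF j y(1) M] y(2) by (simp add: p_def)
  qed
  show ?thesis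
    unfolding central_def
  proof (intro conjI ballI)
    show "prodb L = complex_of_real (- \<sigma> * M / 4)"
      unfolding B \<beta>_eq by simp
    fix j assume "j \<in> {1..<n}"
    then show "EA n ?E (x j) = 0"
      using xK z by (cases "j \<in> K") (auto simp: J_def)
  next
    fix j assume "j \<in> K"
    then have "\<sigma> * (\<sigma> * Ep n ?E (x j)) = \<sigma> * (- M / 4)"
      using xK by simp
    then show "Ep n ?E (x j) = - \<sigma> * M / 4"
      by simp
  qed (use L z in auto)
qed

lemma poly_eq_on_crit:
  fixes f g :: "real poly"
  assumes "\<And>j. j \<in> {1..<n} \<Longrightarrow> poly f (x j) = poly g (x j)" "\<And>i. i \<ge> n - 1 \<Longrightarrow> coeff f i = coeff g i"
  shows "f = g"
proof -
  have "f - g = 0"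
  proof (rule zero_on_nodes)
    show "inj_on x {1..n - 1}"
      unfolding nodes_eq by (rule inj_crit)
  qed (use assms nodes_eq in auto)
  then show ?thesis by simp
qed

lemma larger_root_unique:
  fixes p c p' c' :: real
  assumes "p * c = p' * c'" "p + c = p' + c'" "c < p" "c' < p'"
  shows "p = p'"
proof -
  have "(p - c)\<^sup>2 = (p' - c')\<^sup>2"
  proof -
    have "(p - c)\<^sup>2 = (p + c)\<^sup>2 - 4 * (p * c)" "(p' - c')\<^sup>2 = (p' + c')\<^sup>2 - 4 * (p' * c')"
      by (simp_all add: power2_eq_square algebra_simps)
    then show ?thesis using assms by simp
  qed
  then have "p - c = p' - c'"
    using assms(3,4) by (auto simp: power2_eq_iff)
  then show ?thesis
    using assms(2) by simp
qed

text \<open>Both matrices give the same quadratic equation at \<open>x j\<close>. In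
  \<open>K\<close> its root is prescribed, and in \<open>J\<close> the order built into
  \<open>nbhd\<close> selects the larger one.\<close>

lemma central_cofactor_eq:
  assumes L: "central L" and L': "central L'" and j: "j \<in> {1..<n}"
  shows "Ep n (ent n L) (x j) = Ep n (ent n L') (x j)"
proof (cases "j \<in> K")
  case True
  then show ?thesis
    using centralD(5)[OF L] centralD(5)[OF L'] by simp
next
  case False
  then have jJ: "j \<in> J" using j by (simp add: J_def)
  have c: "central L \<Longrightarrow> L \<in> nbhd" "central L \<Longrightarrow> EA n (ent n L) (x j) = 0"
    "central L \<Longrightarrow> prodb L = complex_of_real (- \<sigma> * M / 4)" for L
    using j centralD by blast+
  have sq: "(- s j * a) * (- s j * b) = a * b" for a b
    using gap_sign_cases[of j] by auto
  have "- s j * Ep n (ent n L) (x j) = - s j * Ep n (ent n L') (x j)"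
  proof (rule larger_root_unique)
    show "(- s j * Ep n (ent n L) (x j)) * (- s j * Ec n (ent n L) (x j)) = (- s j * Ep n (ent n L') (x j)) * (- s j * Ec n (ent n L') (x j))"
      unfolding sq using cofactors_at_root(1)[OF c(1,2)] L L' c(3) by metis
    show "- s j * Ep n (ent n L) (x j) + - s j * Ec n (ent n L) (x j) = - s j * Ep n (ent n L') (x j) + - s j * Ec n (ent n L') (x j)"
      unfolding distrib_left[symmetric] using cofactors_at_root(2)[OF c(1,2)] L L' c(3) by metis
  qed (use nbhdD(5)[OF c(1) jJ] L L' in auto)
  then show ?thesis
    using gap_sign_cases[of j] by auto
qed

text \<open>\<open>EA\<close> is monic of degree \<open>n - 1\<close> and \<open>Ep\<close> has
  degree \<open>n - 2\<close>, so their values at the \<open>n - 1\<close> critical points determine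
  both. The leading coefficient of \<open>Ep\<close> is \<open>|b n|\<^sup>2\<close>, and the two
  determinants determine the other entries they contain. Signs of the real entries are fixed by
  \<open>nbhd\<close>.\<close>

lemma central_unique:
  assumes L: "central L" and L': "central L'"
  shows "L = L'"
proof -
  let ?a = "Ea n (ent n L)" and ?b = "Eb n (ent n L)" and ?a' = "Ea n (ent n L')" and ?b' = "Eb n (ent n L')"
  have nb: "L \<in> nbhd" "L' \<in> nbhd"
    using centralD(1)[OF L] centralD(1)[OF L'] .
  have A: "tridet ?a (sqmod ?b) 0 (n - 1) = tridet ?a' (sqmod ?b') 0 (n - 1)"
  proof (rule poly_eq_on_crit)
    show "poly (tridet ?a (sqmod ?b) 0 (n - 1)) (x j) = poly (tridet ?a' (sqmod ?b') 0 (n - 1)) (x j)" if "j \<in> {1..<n}" for j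
      using centralD(4)[OF L that] centralD(4)[OF L' that] by (simp add: EA_def)
    show "coeff (tridet ?a (sqmod ?b) 0 (n - 1)) i = coeff (tridet ?a' (sqmod ?b') 0 (n - 1)) i" if "n - 1 \<le> i" for i
      using that by (cases "i = n - 1") (simp_all add: coeff_tridet)
  qed
  have P: "smult (sqmod ?b n) (tridet ?a (sqmod ?b) 1 (n - 2)) = smult (sqmod ?b' n) (tridet ?a' (sqmod ?b') 1 (n - 2))"
  proof (rule poly_eq_on_crit)
    show "poly (smult (sqmod ?b n) (tridet ?a (sqmod ?b) 1 (n - 2))) (x j) = poly (smult (sqmod ?b' n) (tridet ?a' (sqmod ?b') 1 (n - 2))) (x j)"
      if "j \<in> {1..<n}" for j
      using central_cofactor_eq[OF L L' that] by (simp add: Ep_def)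
    show "coeff (smult (sqmod ?b n) (tridet ?a (sqmod ?b) 1 (n - 2))) i = coeff (smult (sqmod ?b' n) (tridet ?a' (sqmod ?b') 1 (n - 2))) i"
      if "n - 1 \<le> i" for i
      using that n by (simp add: coeff_tridet)
  qed
  have sq_nz: "sqmod (Eb n (ent n L)) i \<noteq> 0" if "L \<in> nbhd" "i \<in> {1..n}" for L i
    using nbhd_b_nz[OF that] by (simp add: sqmod_def)
  have \<rho>n: "sqmod ?b n = sqmod ?b' n"
    using arg_cong[OF P, of "\<lambda>f. coeff f (n - 2)"] by (simp add: coeff_tridet)
  moreover have "sqmod ?b n \<noteq> 0"
    using sq_nz[OF nb(1), of n] n by simp
  ultimately have D: "tridet ?a (sqmod ?b) 1 (n - 2) = tridet ?a' (sqmod ?b') 1 (n - 2)"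
    using P by (simp add: poly_eq_iff)
  have n2: "n - 1 = Suc (n - 2)"
    using n by simp
  have "(\<forall>i. 0 < i \<and> i \<le> 0 + (n - 2) + 1 \<longrightarrow> ?a i = ?a' i) \<and> (\<forall>i. 0 < i \<and> i \<le> 0 + (n - 2) \<longrightarrow> sqmod ?b i = sqmod ?b' i)"
  proof (rule tridet_determines)
    show "tridet ?a (sqmod ?b) 0 (Suc (n - 2)) = tridet ?a' (sqmod ?b') 0 (Suc (n - 2))"
      using A n2 by simp
    show "tridet ?a (sqmod ?b) (Suc 0) (n - 2) = tridet ?a' (sqmod ?b') (Suc 0) (n - 2)"
      using D by simp
  qed (use sq_nz[OF nb(1)] in auto)
  note determined = this
  have a: "?a i = ?a' i" if "i \<in> {1..<n}" for i
  proof -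
    have "0 < i \<and> i \<le> 0 + (n - 2) + 1"
      using that by (simp, arith)
    then show ?thesis
      using determined by blast
  qed
  have \<rho>: "sqmod ?b i = sqmod ?b' i" if "i \<in> {1..n - 2}" for i
    using conjunct2[OF determined, rule_format, of i] that by simp
  \<comment> \<open>The entry \<open>b (n - 1)\<close> occurs in neither determinant; its modulus is
    recovered from the product of all entries.\<close>
  have split: "(\<Prod>i = 1..n. sqmod b i) = (\<Prod>i = 1..n - 2. sqmod b i) * (sqmod b (n - 1) * sqmod b n)" for b
  proof -
    have "{1..n} = insert n (insert (n - 1) {1..n - 2})"
      using n by auto
    moreover have "n \<notin> insert (n - 1) {1..n - 2}" "n - 1 \<notin> {1..n - 2}"
      using n by auto
    ultimately show ?thesis by (simp add: mult_ac)
  qed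
  have "(\<Prod>i = 1..n. sqmod ?b i) = (\<Prod>i = 1..n. sqmod ?b' i)"
    unfolding cmod_prodb[symmetric] centralD(3)[OF L] centralD(3)[OF L'] ..
  moreover have "(\<Prod>i = 1..n - 2. sqmod ?b i) = (\<Prod>i = 1..n - 2. sqmod ?b' i)"
    using \<rho> by (intro prod.cong) auto
  moreover have "(\<Prod>i = 1..n - 2. sqmod ?b' i) \<noteq> 0"
    using sq_nz[OF nb(2)] by (subst prod_zero_iff) auto
  ultimately have \<rho>n1: "sqmod ?b (n - 1) = sqmod ?b' (n - 1)"
    unfolding split using \<rho>n \<open>sqmod ?b n \<noteq> 0\<close> by simp
  have \<rho>_all: "sqmod ?b i = sqmod ?b' i" if "i \<in> {1..n}" for i
  proof -
    have "i = n \<or> i = n - 1 \<or> i \<in> {1..n - 2}"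
      using that by (simp, arith)
    then show ?thesis
      using \<rho>n \<rho>n1 \<rho> by blast
  qed
  have re: "\<bar>Re (Eb n (ent n L) i)\<bar> = sqrt (sqmod (Eb n (ent n L)) i)" if "central L" "i \<in> {1..n}" for L i
    using centralD(2)[OF that] by (simp add: sqmod_def cmod_def)
  have b: "?b i = ?b' i" if i: "i \<in> {1..n}" for i
  proof -
    have abs: "\<bar>Re (?b i)\<bar> = \<bar>Re (?b' i)\<bar>"
      using re[OF L i] re[OF L' i] \<rho>_all[OF i] by simp
    have "Re (?b i) = Re (?b' i)"
    proof (cases "i = n")
      case True
      then show ?thesis
        using abs nbhdD(4)[OF nb(1)] nbhdD(4)[OF nb(2)] sigma by auto
    next
      case False
      then show ?thesis
        using abs nbhdD(3)[OF nb(1), of i] nbhdD(3)[OF nb(2), of i] i by auto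
    qed
    then show ?thesis
      using centralD(2)[OF L i] centralD(2)[OF L' i] by (simp add: complex_eq_iff)
  qed
  \<comment> \<open>At \<open>lam 1\<close> the characteristic polynomial is an affine function of
    \<open>a n\<close> with nonzero slope.\<close>
  have an: "?a n = ?a' n"
  proof -
    have n1: "1 \<in> {1..n}" using n by simp
    let ?c = "poly (tridet ?a (sqmod ?b) 0 (n - 1)) (lam 1)"
    have c: "?c \<noteq> 0"
      using nbhdD(2)[OF nb(1) n1] by (auto simp: EA_def)
    have "poly (percharpoly n ?a (sqmod ?b) (Re (prodb L))) (lam 1) = poly (percharpoly n ?a' (sqmod ?b') (Re (prodb L'))) (lam 1)"
      using nbhd_percharpoly[OF nb(1)] nbhd_percharpoly[OF nb(2)] by simp
    moreover have "tridet ?a (sqmod ?b) 0 (n - 2) = tridet ?a' (sqmod ?b') 0 (n - 2)"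
      by (rule tridet_cong) (use a \<rho> n in auto)
    moreover have "prodb L = prodb L'"
      unfolding centralD(3)[OF L] centralD(3)[OF L'] ..
    ultimately have "(lam 1 - ?a n) * ?c = (lam 1 - ?a' n) * ?c"
      using n \<rho>n \<rho>n1 A D by (simp add: poly_percharpoly)
    then show ?thesis
      using c by simp
  qed
  have "?a i = ?a' i" if "i \<in> {1..n}" for i
    using a[of i] an that by (cases "i = n") auto
  then have "periodic_tridiagonal n ?a ?b = periodic_tridiagonal n ?a' ?b'"
    using b by (rule periodic_tridiagonal_cong[OF n])
  with isospectral_eq_periodic[OF n nbhdD(1)[OF nb(1)]] show ?thesis
    using isospectral_eq_periodic[OF n nbhdD(1)[OF nb(2)]] by (metis (no_types))
qed

end

section \<open>Composites of discs and projections\<close>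

context collapsing
begin

context
  fixes k :: nat and u :: "nat \<Rightarrow> real"
  assumes k: "k \<in> K" and u: "u \<in> W k"
begin

lemmas data = spectral_data_W[OF k u]

lemma alp_entries:
  "Ea n (ent n (alp k u)) = alp_a k u" "Eb n (ent n (alp k u)) = alp_b k u"
proof -
  have "alp_a k u i = 0" "alp_b k u i = 0" if "i \<notin> {1..n}" for i
    using that n by (auto simp: alp_a_def alp_b_def rec_a_def rec_b_def)
  then show "Ea n (ent n (alp k u)) = alp_a k u" "Eb n (ent n (alp k u)) = alp_b k u"
    unfolding alp_def by (intro ent_periodic_tridiagonal n; blast)+
qed

lemma EA_alp: "EA n (ent n (alp k u)) y = (\<Prod>j = 1..n - 1. y - mu k u j)"
  unfolding EA_def alp_entries alp_a_def alp_b_def spectral_data.tridet_0_N[OF data] by (simp add: poly_prod)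

lemma Ep_alp:
  assumes "j \<in> {1..<n}"
  shows "Ep n (ent n (alp k u)) (mu k u j) = pp k u j"
proof -
  have j: "j \<in> {1..n - 1}" using assms nodes_eq by blast
  have "n - 2 = n - 1 - 1" "1 + (n - 2) \<le> n - 1"
    using n by auto
  then show ?thesis
    unfolding Ep_def alp_entries alp_a_def alp_b_def spectral_data.sqmod_bb_n[OF data]
    using spectral_data.tridet_rec[OF data, of 1 "n - 2"] spectral_data.cofactor_left[OF data j] by simp
qed

lemma Ec_alp:
  assumes "j \<in> {1..<n}"
  shows "Ec n (ent n (alp k u)) (mu k u j) = (Bmod k u)\<^sup>2 / pp k u j"
proof -
  have j: "j \<in> {1..n - 1}" using assms nodes_eq by blast
  have "n - 2 = n - 1 - 1" "0 + (n - 2) \<le> n - 1"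
    using n by auto
  then show ?thesis
    unfolding Ec_def alp_entries alp_a_def alp_b_def spectral_data.sqmod_bb_N[OF data] cmod_prodB[OF u, symmetric]
    using spectral_data.tridet_rec[OF data, of 0 "n - 2"] spectral_data.cofactor_right[OF data j] by simp
qed

lemma b_alp:
  assumes "i \<in> {1..<n}"
  obtains r where "r > 0" "Eb n (ent n (alp k u)) i = complex_of_real r * phase (u (i - 1))"
proof -
  have i: "i \<in> {1..n - 1}" using assms nodes_eq by blast
  then show thesis
    using that[of "rec_r (n - 1) (mu k u) (pp k u) (prodB k u) i"] spectral_data.r_pos[OF data i]
      spectral_data.bb_simps(1)[OF data i, of "phi u"]
    unfolding alp_entries alp_b_def by (simp add: phi_def)
qed

lemma Im_b_alp:
  assumes "i \<in> {1..<n}"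
  obtains \<kappa> where "\<kappa> > 0" "Im (Eb n (ent n (alp k u)) i) = \<kappa> * u (i - 1)"
proof -
  obtain r where r: "r > 0" "Eb n (ent n (alp k u)) i = complex_of_real r * phase (u (i - 1))"
    using b_alp[OF assms] .
  have "r / sqrt (1 + (u (i - 1))\<^sup>2) > 0"
    using r(1) by (simp add: add_pos_nonneg)
  then show thesis
    using that r(2) by (simp add: Im_phase)
qed

lemma Re_b_alp:
  assumes "i \<in> {1..<n}"
  shows "Re (Eb n (ent n (alp k u)) i) > 0"
proof -
  obtain r where r: "r > 0" "Eb n (ent n (alp k u)) i = complex_of_real r * phase (u (i - 1))"
    using b_alp[OF assms] .
  then show ?thesis
    by (simp add: Re_phase add_pos_nonneg)
qed

text \<open>With vanishing phases the other entries are positive reals, so \<open>b n\<close> has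
  the argument of the product.\<close>

lemma b_n_alp:
  assumes "\<And>i. i < n - 1 \<Longrightarrow> u i = 0"
  obtains \<kappa> where "\<kappa> > 0" "Eb n (ent n (alp k u)) n = complex_of_real \<kappa> * prodB k u"
proof -
  let ?b = "Eb n (ent n (alp k u))"
  have re: "?b i = complex_of_real (Re (?b i))" if "i \<in> {1..<n}" for i
  proof -
    obtain r where "?b i = complex_of_real r * phase (u (i - 1))"
      using b_alp[OF \<open>i \<in> {1..<n}\<close>] by metis
    moreover have "u (i - 1) = 0"
      using that by (intro assms) auto
    ultimately show ?thesis by simp
  qed
  have "(\<Prod>i = 1..n - 1. ?b i) = (\<Prod>i = 1..n - 1. complex_of_real (Re (?b i)))"
    unfolding nodes_eq by (intro prod.cong refl re)
  also have "\<dots> = complex_of_real (\<Prod>i = 1..n - 1. Re (?b i))"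
    by simp
  finally have "?b n = complex_of_real (inverse (\<Prod>i = 1..n - 1. Re (?b i))) * prodB k u"
    using spectral_data.bb_simps(2)[OF data, of "phi u"]
    unfolding alp_entries alp_b_def by (simp add: divide_inverse mult.commute)
  moreover have "inverse (\<Prod>i = 1..n - 1. Re (?b i)) > 0"
    unfolding nodes_eq using Re_b_alp by (intro positive_imp_inverse_positive prod_pos) auto
  ultimately show thesis
    using that by blast
qed

text \<open>The other nodes stay in their own gaps, so the remaining factors of \<open>EA\<close>
  have a fixed sign and the value at \<open>x j\<close> shows on which side of it the node
  lies.\<close>

lemma EA_crit_alp:
  assumes j: "j \<in> {1..<n}"
  obtains \<kappa> where "\<kappa> > 0" "s j * EA n (ent n (alp k u)) (x j) = \<kappa> * (mu k u j - x j)"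
proof -
  have j': "j \<in> {1..n - 1}" using j nodes_eq by blast
  let ?P = "\<Prod>i\<in>{1..n - 1} - {j}. x j - mu k u i"
  have "EA n (ent n (alp k u)) (x j) = (x j - mu k u j) * ?P"
    unfolding EA_alp using j' by (subst prod.remove[of _ j]) auto
  moreover have "c * ((y - m) * P) = (- c * P) * (m - y)" for c y m P :: real
    by (simp add: algebra_simps)
  ultimately have "s j * EA n (ent n (alp k u)) (x j) = (- s j * ?P) * (mu k u j - x j)"
    by metis
  then show thesis
    using that spectral_data.gap_prod_sign[OF data j' crit_gap[OF j]] by blast
qed

lemma cofactor_diff_alp:
  assumes "j \<in> {1..<n}" "mu k u j = x j"
  shows "- s j * (Ep n (ent n (alp k u)) (x j) - Ec n (ent n (alp k u)) (x j)) = root_diff k u j"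
  using pp_sum(2)[OF k u assms(1)] Ep_alp[OF assms(1)] Ec_alp[OF assms(1)] unfolding assms(2) by simp

text \<open>
  Used with \<open>(c, d) = (1 - t, t)\<close> for the straight homotopy from the identity to \<open>bet k \<circ> alp k\<close>, and with
  \<open>(c, d) = (0, 1)\<close> for \<open>bet l \<circ> alp k\<close>: each entry has the sign of a coordinate of \<open>u\<close> once the
  preceding coordinates vanish.
\<close>
lemma coordinates_zero:
  assumes phases: "\<And>i. i \<in> {1..<n} \<Longrightarrow> \<exists>c d. c + d > 0 \<and> c \<ge> 0 \<and> d \<ge> 0 \<and> c * u (i - 1) + d * Im (Eb n (ent n (alp k u)) i) = 0"
    and arg: "\<exists>c d. c + d > 0 \<and> c \<ge> 0 \<and> d \<ge> 0 \<and> c * u (n - 1) + d * Im (Eb n (ent n (alp k u)) n) = 0"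
    and nodes: "\<And>j. j \<in> J \<Longrightarrow> \<exists>c d. c + d > 0 \<and> c \<ge> 0 \<and> d \<ge> 0 \<and> c * u (slot j) + d * (s j * EA n (ent n (alp k u)) (x j)) = 0"
    and h: "u n = 0" and z: "u (n + 1) = 0"
  shows "u = (\<lambda>_. 0)"
proof -
  have pos: "v = 0" if "c + d > 0" "c \<ge> 0" "d \<ge> 0" "c * v + d * (\<kappa> * v) = 0" "\<kappa> > 0" for c d \<kappa> v :: real
  proof -
    have "(c + d * \<kappa>) * v = 0"
      using that(4) by (simp add: algebra_simps)
    moreover have "c + d * \<kappa> > 0"
      using that by (cases "c = 0") (auto intro: add_pos_nonneg)
    ultimately show ?thesis by simp
  qed
  have ph: "u i = 0" if "i < n - 1" for i
  proof -
    have i: "Suc i \<in> {1..<n}" using that by auto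
    obtain \<kappa> where "\<kappa> > 0" "Im (Eb n (ent n (alp k u)) (Suc i)) = \<kappa> * u i"
      using Im_b_alp[OF i] by auto
    then show ?thesis
      using phases[OF i] pos by auto
  qed
  obtain \<kappa> where "\<kappa> > 0" "Eb n (ent n (alp k u)) n = complex_of_real \<kappa> * prodB k u"
    using b_n_alp[OF ph] by blast
  then have tau: "u (n - 1) = 0"
    using arg pos by (auto simp: prodB_def)
  have sl: "u (slot j) = 0" if j: "j \<in> J" for j
  proof -
    have "j \<noteq> k" using k j by (auto simp: J_def)
    then have "mu k u j - x j = u (slot j)"
      using j by (simp add: mu_def)
    then obtain \<kappa> where "\<kappa> > 0" "s j * EA n (ent n (alp k u)) (x j) = \<kappa> * u (slot j)"
      using EA_crit_alp[OF JD(1)[OF j]] by metis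
    then show ?thesis
      using nodes[OF j] pos by auto
  qed
  show ?thesis
  proof
    fix i
    have "i < n - 1 \<or> i = n - 1 \<or> i = n \<or> i = n + 1 \<or> n + 2 \<le> i"
      by arith
    then consider "i < n - 1" | "i = n - 1" | "i = n" | "i = n + 1" | "n + 2 \<le> i" "i < dim" | "dim \<le> i"
      by linarith
    then show "u i = 0"
    proof cases
      case 5
      then have "i - (n + 2) < card J" "n + 2 + (i - (n + 2)) = i"
        by (auto simp: dim_def)
      then show ?thesis
        using sl[OF enum_J] slot_enum by metis
    next
      case 6
      then show ?thesis
        using u by (simp add: W_def topspace_Euclidean_space)
    qed (use ph tau h z in auto)
  qed
qed

end

lemma slot_dim: "j \<in> J \<Longrightarrow> slot j < dim" "j \<in> J \<Longrightarrow> \<not> slot j < n + 2" "j \<in> J \<Longrightarrow> enum (slot j - (n + 2)) = j"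
  by (metis enum_slot dim_def nat_add_left_cancel_less, metis enum_slot not_add_less1, metis enum_slot add_diff_cancel_left')

lemma bet_simps:
  "i \<in> {1..n} \<Longrightarrow> bet l L (i - 1) = Im (Eb n (ent n L) i)"
  "bet l L n = s l * EA n (ent n L) (x l)"
  "bet l L (n + 1) = - \<sigma> * (Ep n (ent n L) (x l) - Ec n (ent n L) (x l))"
  "j \<in> J \<Longrightarrow> bet l L (slot j) = s j * EA n (ent n L) (x j)"
proof -
  show "i \<in> {1..n} \<Longrightarrow> bet l L (i - 1) = Im (Eb n (ent n L) i)"
    by (cases i) (auto simp: bet_def dim_def)
  show "j \<in> J \<Longrightarrow> bet l L (slot j) = s j * EA n (ent n L) (x j)"
    using slot_dim[of j] by (auto simp: bet_def)
qed (auto simp: bet_def dim_def)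

text \<open>The order matters: component \<open>n\<close> puts the node of gap \<open>k\<close> at
  \<open>x k\<close>; only then are the cofactors at \<open>x k\<close> known, and component
  \<open>n + 1\<close> becomes a positive multiple of \<open>u (n + 1)\<close>.\<close>

lemma bet_alp_same:
  assumes k: "k \<in> K" and u: "u \<in> W k" and t: "t \<in> {0..1}"
    and zero: "(\<lambda>i. (1 - t) * u i + t * bet k (alp k u) i) = (\<lambda>_. 0)"
  shows "u = (\<lambda>_. 0)"
proof -
  have z: "(1 - t) * u i + t * bet k (alp k u) i = 0" for i
    using fun_cong[OF zero, of i] .
  have cd: "(1 - t) + t > 0 \<and> 1 - t \<ge> 0 \<and> t \<ge> 0"
    using t by auto
  have pos: "v = 0" if "(1 - t) * v + t * (\<kappa> * v) = 0" "\<kappa> > 0" for v \<kappa> :: real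
  proof -
    have "((1 - t) + t * \<kappa>) * v = 0"
      using that(1) by (simp add: algebra_simps)
    moreover have "(1 - t) + t * \<kappa> > 0"
      using t that(2) by (cases "t = 1") (auto intro: add_pos_nonneg)
    ultimately show ?thesis by simp
  qed
  have kn: "k \<in> {1..<n}" using KD(1)[OF k] .
  have mu_k: "mu k u k - x k = u n"
    by (simp add: mu_def)
  have h: "u n = 0"
  proof -
    obtain \<kappa> where "\<kappa> > 0" "s k * EA n (ent n (alp k u)) (x k) = \<kappa> * u n"
      using EA_crit_alp[OF k u kn] unfolding mu_k by metis
    then show ?thesis
      using z[of n] pos unfolding bet_simps by metis
  qed
  have "bet k (alp k u) (n + 1) = root_diff k u k"
    using cofactor_diff_alp[OF k u kn] mu_k h KD(2)[OF k] unfolding bet_simps by simp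
  also have "\<dots> = sqrt ((u (n + 1))\<^sup>2 + 4 * Bmod k u) * u (n + 1)"
    by (simp add: root_diff_def)
  finally have "u (n + 1) = 0"
    using z[of "n + 1"] Bmod_pos[OF u] pos[of "u (n + 1)" "sqrt ((u (n + 1))\<^sup>2 + 4 * Bmod k u)"]
    by (simp add: add_nonneg_pos)
  with h show ?thesis
  proof (intro coordinates_zero[OF k u])
    show "\<exists>c d. c + d > 0 \<and> c \<ge> 0 \<and> d \<ge> 0 \<and> c * u (i - 1) + d * Im (Eb n (ent n (alp k u)) i) = 0" if "i \<in> {1..<n}" for i
      using z[of "i - 1"] cd bet_simps(1)[of i k "alp k u"] that by (intro exI[of _ "1 - t"] exI[of _ t]) auto
    show "\<exists>c d. c + d > 0 \<and> c \<ge> 0 \<and> d \<ge> 0 \<and> c * u (n - 1) + d * Im (Eb n (ent n (alp k u)) n) = 0"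
      using z[of "n - 1"] cd bet_simps(1)[of n k "alp k u"] n by (intro exI[of _ "1 - t"] exI[of _ t]) auto
    show "\<exists>c d. c + d > 0 \<and> c \<ge> 0 \<and> d \<ge> 0 \<and> c * u (slot j) + d * (s j * EA n (ent n (alp k u)) (x j)) = 0" if "j \<in> J" for j
      using z[of "slot j"] cd bet_simps(4)[OF that, of k "alp k u"] by (intro exI[of _ "1 - t"] exI[of _ t]) auto
  qed auto
qed

text \<open>Gap \<open>l\<close> is frozen on the disc of \<open>k\<close>, so component
  \<open>n + 1\<close> of the projection is the nonnegative \<open>root_diff k u l\<close>. Together
  with \<open>t \<ge> 0\<close> it can vanish only if both vanish; then \<open>gg k u = M\<close>,
  and gap \<open>k\<close> is collapsed too.\<close>

lemma bet_alp_other: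
  assumes k: "k \<in> K" and l: "l \<in> K" "l \<noteq> k" and u: "u \<in> W k" and t: "t \<in> {0..1}"
    and zero: "(\<lambda>i. bet l (alp k u) i + t * (if i = n + 1 then 1 else 0)) = (\<lambda>_. 0)"
  shows "u = (\<lambda>_. 0)" "t = 0"
proof -
  have z: "bet l (alp k u) i + t * (if i = n + 1 then 1 else 0) = 0" for i
    using fun_cong[OF zero, of i] .
  have ln: "l \<in> {1..<n}" using KD(1)[OF l(1)] .
  have mu_l: "mu k u l = x l"
    using l by (simp add: mu_def J_def)
  have "bet l (alp k u) (n + 1) = root_diff k u l"
    using cofactor_diff_alp[OF k u ln mu_l] KD(2)[OF l(1)] unfolding bet_simps by simp
  moreover have "root_diff k u l \<ge> 0"
    using l cc_ge[OF k u ln] root_diff_sq[OF k u ln] by (simp add: root_diff_def)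
  ultimately have rt: "root_diff k u l = 0" "t = 0"
    using z[of "n + 1"] t by auto
  then have "(cc k u l)\<^sup>2 = (2 * Bmod k u)\<^sup>2"
    using root_diff_sq[OF k u ln] by (simp add: power_mult_distrib)
  then have "cc k u l = 2 * Bmod k u"
    by (rule power2_eq_imp_eq) (use cc_ge[OF k u ln] Bmod_pos[OF u] in linarith)+
  then have "gg k u = M"
    using cc_K[OF k l, of u] by linarith
  then have "mu k u k = x k" "u (n + 1) = 0"
    using gg_le(2)[OF k u] by blast+
  moreover from this have "u n = 0"
    by (simp add: mu_def)
  ultimately show "u = (\<lambda>_. 0)"
  proof (intro coordinates_zero[OF k u])
    have i1: "i - 1 \<noteq> n + 1" if "i \<in> {1..n}" for i
      using that by auto
    show "\<exists>c d. c + d > 0 \<and> c \<ge> 0 \<and> d \<ge> 0 \<and> c * u (i - 1) + d * Im (Eb n (ent n (alp k u)) i) = 0" if "i \<in> {1..<n}" for i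
      using z[of "i - 1"] bet_simps(1)[of i l "alp k u"] i1[of i] that by (intro exI[of _ 0] exI[of _ 1]) auto
    show "\<exists>c d. c + d > 0 \<and> c \<ge> 0 \<and> d \<ge> 0 \<and> c * u (n - 1) + d * Im (Eb n (ent n (alp k u)) n) = 0"
      using z[of "n - 1"] bet_simps(1)[of n l "alp k u"] i1[of n] n by (intro exI[of _ 0] exI[of _ 1]) auto
    show "\<exists>c d. c + d > 0 \<and> c \<ge> 0 \<and> d \<ge> 0 \<and> c * u (slot j) + d * (s j * EA n (ent n (alp k u)) (x j)) = 0" if "j \<in> J" for j
      using z[of "slot j"] bet_simps(4)[OF that, of l "alp k u"] slot_dim(2)[OF that] by (intro exI[of _ 0] exI[of _ 1]) auto
  qed auto
  show "t = 0" by (rule rt(2))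
qed

abbreviation (input) "origin \<equiv> (\<lambda>_::nat. 0::real)"

lemma alp_origin_nbhd:
  assumes k: "k \<in> K"
  shows "alp k origin \<in> nbhd"
proof -
  let ?E = "ent n (alp k origin)"
  have o: "origin \<in> W k" using zero_in_W[OF k] .
  \<comment> \<open>At the origin the nodes are the critical points, so the product is a nonzero
    square.\<close>
  have "0 < EA n ?E (lam i) * (\<Prod>j = 1..n - 1. lam i - x j)" if "i \<in> {1..n}" for i
    using spectral_data.node_poly_lam_nz[OF spectral_data_W[OF k o] that]
    unfolding EA_alp[OF k o] mu_0 by (metis not_real_square_gt_zero)
  moreover have "0 < Re (Eb n ?E i)" if "i \<in> {1..<n}" for i
    using Re_b_alp[OF k o that] .
  moreover have "\<sigma> * Re (Eb n ?E n) < 0"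
  proof -
    obtain \<kappa> where "\<kappa> > 0" "Eb n ?E n = complex_of_real \<kappa> * prodB k origin"
      using b_n_alp[OF k o] by blast
    moreover have "prodB k origin = Complex (\<sigma> * (- M / 4)) 0"
      by (simp add: prodB_def Bre_def gg_0[OF k])
    ultimately have "\<sigma> * Re (Eb n ?E n) = - \<kappa> * M / 4"
      using sigma by auto
    then show ?thesis
      using \<open>\<kappa> > 0\<close> M_pos by simp
  qed
  moreover have "- s j * Ec n ?E (x j) < - s j * Ep n ?E (x j)" if j: "j \<in> J" for j
  proof -
    have jn: "j \<in> {1..<n}" and jk: "j \<noteq> k"
      using j k by (auto simp: J_def)
    have "(2 * Bmod k origin)\<^sup>2 < (cc k origin j)\<^sup>2"
      using cc_J[OF o j] Bmod_pos[OF o] by (intro power_strict_mono) auto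
    then have "root_diff k origin j > 0"
      using jk by (simp add: root_diff_def power_mult_distrib)
    then show ?thesis
      using cofactor_diff_alp[OF k o jn] by (simp add: algebra_simps)
  qed
  ultimately show ?thesis
    unfolding nbhd_def using alp_in_X[OF k o] by blast
qed

lemma bet_alp_origin:
  assumes k: "k \<in> K"
  shows "bet k (alp k origin) = origin"
  unfolding bet_eq_0_iff
proof (intro conjI ballI)
  let ?E = "ent n (alp k origin)"
  have o: "origin \<in> W k" using zero_in_W[OF k] .
  show "Im (Eb n ?E i) = 0" if "i \<in> {1..n}" for i
  proof (cases "i = n")
    case True
    obtain \<kappa> where "Eb n ?E n = complex_of_real \<kappa> * prodB k origin"
      using b_n_alp[OF k o] by blast
    then show ?thesis
      using True by (simp add: prodB_def)
  next
    case False
    then have "i \<in> {1..<n}" using that by auto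
    from Im_b_alp[OF k o this] show ?thesis by auto
  qed
  have EA: "EA n ?E (x j) = 0" if "j \<in> {1..<n}" for j
  proof -
    have "s j * EA n ?E (x j) = 0"
      using EA_crit_alp[OF k o that] by auto
    then show ?thesis
      using gap_sign_cases[of j] by auto
  qed
  show "EA n ?E (x k) = 0"
    using EA KD(1)[OF k] by blast
  show "EA n ?E (x j) = 0" if "j \<in> J" for j
    using EA JD(1)[OF that] by blast
  show "Ep n ?E (x k) = Ec n ?E (x k)"
    using cofactor_diff_alp[OF k o KD(1)[OF k]] KD(2)[OF k] sigma by (auto simp: root_diff_def)
qed

text \<open>All discs have the same centre, since each centre is \<open>central\<close>. The vector
  \<open>e\<close> points in direction \<open>n + 1\<close>, in which the projection of the other
  disc is never negative. The obstruction sits in degree \<open>dim\<close> whatever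
  \<open>d\<close> is.\<close>

lemma collapsing_not_homology_manifold:
  assumes p: "p \<in> K" and q: "q \<in> K" and pq: "p \<noteq> q"
  shows "\<not> homology_manifold d X"
proof -
  define x0 where "x0 = alp p origin"
  have central: "central (alp k origin)" if "k \<in> K" for k
    by (rule zero_imp_central[OF alp_origin_nbhd[OF that] that bet_alp_origin[OF that]])
  have x0: "alp k origin = x0" if "k \<in> K" for k
    unfolding x0_def using central_unique central that p by blast
  have bet0: "bet k L = origin \<longleftrightarrow> L = x0" if "k \<in> K" "L \<in> nbhd" for k L
    using zero_imp_central[OF that(2,1)] central_unique central[OF that(1)] bet_alp_origin[OF that(1)] x0[OF that(1)] by metis
  let ?W = "W p \<inter> W q" and ?E = "Euclidean_space dim"
  have W: "openin ?E ?W"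
    by (intro openin_Int openin_W)
  have alp: "continuous_map (subtopology ?E ?W) X (alp k)" if "k = p \<or> k = q" for k
    using that continuous_alp[OF p] continuous_alp[OF q]
    by (metis continuous_map_from_subtopology_mono inf_le1 inf_le2)
  show ?thesis
  proof (rule two_discs_not_homology_manifold[where U = nbhd and x\<^sub>0 = x0 and W = ?W and \<alpha>\<^sub>1 = "alp p" and \<alpha>\<^sub>2 = "alp q"
        and \<beta>\<^sub>1 = "bet p" and \<beta>\<^sub>2 = "bet q" and N = dim and e = "\<lambda>i. if i = n + 1 then 1 else 0"])
    show "openin X nbhd" by (rule openin_nbhd)
    show x0n: "x0 \<in> nbhd"
      unfolding x0_def by (rule alp_origin_nbhd[OF p])
    show "closedin X {x0}"
      using nbhdD(1)[OF x0n] n by (intro closedin_isospectral_singleton) auto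
    show "openin ?E ?W" by (rule W)
    show "origin \<in> ?W"
      using zero_in_W p q by blast
    show "continuous_map (subtopology ?E ?W) X (alp p)" "continuous_map (subtopology ?E ?W) X (alp q)"
      by (rule alp; simp)+
    show "alp p origin = x0" "alp q origin = x0"
      using x0 p q by blast+
    show "continuous_map (subtopology X nbhd) ?E (bet p)" "continuous_map (subtopology X nbhd) ?E (bet q)"
      by (intro continuous_map_from_subtopology continuous_bet)+
    show "bet p L = origin \<longleftrightarrow> L = x0" "bet q L = origin \<longleftrightarrow> L = x0" if "L \<in> nbhd" for L
      using bet0 p q that by blast+
    show "(\<lambda>i. (1 - t) * u i + t * bet p (alp p u) i) \<noteq> origin" if "u \<in> ?W" "u \<noteq> origin" "t \<in> {0..1}" for u t
      using bet_alp_same[OF p _ that(3), of u] that by blast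
    show "(\<lambda>i. (1 - t) * u i + t * bet q (alp q u) i) \<noteq> origin" if "u \<in> ?W" "u \<noteq> origin" "t \<in> {0..1}" for u t
      using bet_alp_same[OF q _ that(3), of u] that by blast
    show "(\<lambda>i. bet p (alp q u) i + t * (if i = n + 1 then 1 else 0)) \<noteq> origin"
      if "u \<in> ?W" "u \<noteq> origin \<or> t \<noteq> 0" "t \<in> {0..1}" for u t
      using bet_alp_other[OF q p pq _ that(3), of u] that by blast
    show "(\<lambda>i. if i = n + 1 then 1 else 0) \<in> topspace ?E"
      by (simp add: topspace_Euclidean_space dim_def)
  qed
qed

end

theorem theorem3p9:
  fixes n :: nat and lam :: "nat \<Rightarrow> real"
  assumes "n \<ge> 3"
    and "strict_mono_on {1..n} lam"
    and "n_plus n lam > 1 \<or> n_minus n lam > 1"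
  shows "\<not> homology_manifold (2 * n) (isospectral_space n lam) \<and>
         (\<forall>d. \<not> smooth_manifold d (isospectral_space n lam))"
proof -
  interpret simple_spectrum n lam
    using assms(1,2) by unfold_locales
  obtain \<sigma> p q where \<sigma>: "\<sigma> = 1 \<or> \<sigma> = -1" and pq: "p \<in> {1..<n}" "q \<in> {1..<n}" "p \<noteq> q"
    "gap_sign p = \<sigma>" "gap_sign q = \<sigma>" "\<sigma> * F_poly n lam (gap_crit p) = level \<sigma>" "\<sigma> * F_poly n lam (gap_crit q) = level \<sigma>"
    using two_collapsing_gaps[OF assms(3)] .
  interpret collapsing n lam \<sigma>
    using \<sigma> by unfold_locales
  have "\<not> homology_manifold d (isospectral_space n lam)" for d
    using pq by (intro collapsing_not_homology_manifold[of p q]) (auto simp: K_def)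
  then show ?thesis
    using smooth_manifold_imp_homology_manifold by blast
qed

end
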